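(* Suppose that for some $\Omega_X,\Omega_Y>0$, $\sup_{x_1,x_2\in X}V_X(x_1,x_2)\le\Omega_X^2$ and $\sup_{y_1,y_2\in Y}V_Y(y_1,y_2)\le\Omega_Y^2$. Assume that the parameters $\beta_t,\theta_t,\eta_t,\tau_t$ of the stochastic APD algorithm described in the context satisfy $\beta_1=1$ and, for all $t\ge1$ (the second condition for all $t\ge2$) and for some $p,q\in(0,1)$, $$\beta_{t+1}-1=\beta_t\theta_{t+1},$$ $$0<\theta_t\le\min\left\{\frac{\eta_{t-1}}{\eta_t},\frac{\tau_{t-1}}{\tau_t}\right\},$$ $$\frac{q\alpha_X}{\eta_t}-\frac{L_G}{\beta_t}-\frac{L_K^2\tau_t}{p\alpha_Y}\ge0.$$ Let $\gamma_1=1$ and $\gamma_t=\theta_t^{-1}\gamma_{t-1}$ for $t\ge2$. Then: (a) Under assumption A1 (bounded variance, see context), for all $t\ge1$, $\mathbb E[g(z_{t+1}^{ag})]\le\mathcal Q_0(t)$, where $$\mathcal Q_0(t):=\frac1{\beta_t\gamma_t}\left\{\frac{2\gamma_t}{\eta_t}\Omega_X^2+\frac{2\gamma_t}{\tau_t}\Omega_Y^2\right\}+\frac1{2\beta_t\gamma_t}\sum_{i=1}^t\left\{\frac{(2-q)\eta_i\gamma_i}{(1-q)\alpha_X}\sigma_x^2+\frac{(2-p)\tau_i\gamma_i}{(1-p)\alpha_Y}\sigma_y^2\right\}.$$ (b) Under assumption A2 (light tails, see context), for all $\lambda>0$ and $t\ge1$, $$\mathrm{Prob}\{g(z_{t+1}^{ag})>\mathcal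 Q_0(t)+\lambda\mathcal Q_1(t)\}\le3\exp\{-\lambda^2/3\}+3\exp\{-\lambda\},$$ where $$\mathcal Q_1(t):=\frac1{\beta_t\gamma_t}\left(\frac{\sqrt2\,\sigma_x\Omega_X}{\sqrt{\alpha_X}}+\frac{\sigma_y\Omega_Y}{\sqrt{\alpha_Y}}\right)\sqrt{2\sum_{i=1}^t\gamma_i^2}+\frac1{2\beta_t\gamma_t}\sum_{i=1}^t\left\{\frac{(2-q)\eta_i\gamma_i}{(1-q)\alpha_X}\sigma_x^2+\frac{(2-p)\tau_i\gamma_i}{(1-p)\alpha_Y}\sigma_y^2\right\}.$$
   Context: Setting. $\mathcal X,\mathcal Y$ are finite-dimensional real vector spaces, each equipped with an inner product $\langle\cdot,\cdot\rangle$ and a norm $\|\cdot\|$, with dual norm $\|\cdot\|_*$; $X\subseteq\mathcal X$, $Y\subseteq\mathcal Y$ are closed convex sets and $Z=X\times Y$. $G$ is a smooth convex function with $G(y)-G(x)-\langle\nabla G(x),y-x\rangle\le\frac{L_G}{2}\|y-x\|^2$ for all $x,y\in X$, for some $L_G\ge0$. $K:\mathcal X\to\mathcal Y$ is linear with transpose $K^T$ and induced norm $L_K=\|K\|$ (so $\|Kx\|_*\le L_K\|x\|$ and $\langle Kx,y\rangle\le L_K\|x\|\|y\|$). $J:Y\to\mathbb R$ is proper, convex and lower semicontinuous. The saddle point problem is $\min_{x\in X}\max_{y\in Y}G(x)+\langle Kx,y\rangle-J(y)$. Bregman divergences: $V_X(x,u)=d_X(x)-d_X(u)-\langle\nabla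 d_X(u),x-u\rangle$ and $V_Y(y,v)=d_Y(y)-d_Y(v)-\langle\nabla d_Y(v),y-v\rangle$, where $d_X$, $d_Y$ are strongly convex (differentiable) functions with strong convexity parameters $\alpha_X,\alpha_Y>0$ with respect to the given norms. Stochastic oracle. A stochastic oracle returns unbiased estimators $\hat{\mathcal G}(x)=\mathcal G(x,\xi)$, $\hat{\mathcal K}_x(x)=\mathcal K_x(x,\xi)$, $\hat{\mathcal K}_y(y)=\mathcal K_y(y,\xi)$, with i.i.d. random vectors $\xi$: $\mathbb E[\hat{\mathcal G}(x)]=\nabla G(x)$, $\mathbb E[\hat{\mathcal K}_x(x)]=Kx$, $\mathbb E[\hat{\mathcal K}_y(y)]=K^Ty$. The samples used for the three evaluations in each iteration are independent of each other and of all previous iterations. A1: for constants $\sigma_{x,G},\sigma_y,\sigma_{x,K}\ge0$ and all query points, $\mathbb E\|\hat{\mathcal G}(x)-\nabla G(x)\|_*^2\le\sigma_{x,G}^2$, $\mathbb E\|\hat{\mathcal K}_x(x)-Kx\|_*^2\le\sigma_y^2$, $\mathbb E\|\hat{\mathcal K}_y(y)-K^Ty\|_*^2\le\sigma_{x,K}^2$. A2: $\mathbb E[\exp\{\|\nabla G(x)-\hat{\mathcal G}(x)\|_*^2/\sigma_{x,G}^2\}]\le\exp\{1\}$, $\mathbb E[\exp\{\|Kx-\hat{\mathcal K}_x(x)\|_*^2/\sigma_y^2\}]\le\exp\{1\}$, $\mathbb E[\exp\{\|K^Ty-\hat{\mathcal K}_y(y)\|_*^2/\sigma_{x,K}^2\}]\le\exp\{1\}$.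 Notation: $\sigma_x:=\sqrt{\sigma_{x,G}^2+\sigma_{x,K}^2}$. Stochastic APD algorithm. Choose $x_1\in X$, $y_1\in Y$; set $x_1^{ag}=x_1$, $y_1^{ag}=y_1$, $\bar x_1=x_1$. With positive stepsizes $\eta_t,\tau_t$, for $t=1,2,\dots$: $x_t^{md}=(1-\beta_t^{-1})x_t^{ag}+\beta_t^{-1}x_t$; $y_{t+1}=\operatorname{argmin}_{y\in Y}\langle-\hat{\mathcal K}_x(\bar x_t),y\rangle+J(y)+\frac1{\tau_t}V_Y(y,y_t)$; $x_{t+1}=\operatorname{argmin}_{x\in X}\langle\hat{\mathcal G}(x_t^{md}),x\rangle+\langle x,\hat{\mathcal K}_y(y_{t+1})\rangle+\frac1{\eta_t}V_X(x,x_t)$; $x_{t+1}^{ag}=(1-\beta_t^{-1})x_t^{ag}+\beta_t^{-1}x_{t+1}$; $y_{t+1}^{ag}=(1-\beta_t^{-1})y_t^{ag}+\beta_t^{-1}y_{t+1}$; $\bar x_{t+1}=\theta_{t+1}(x_{t+1}-x_t)+x_{t+1}$. Write $z_t^{ag}=(x_t^{ag},y_t^{ag})$. Gap function. For $\tilde z=(\tilde x,\tilde y)$, $z=(x,y)\in Z$: $Q(\tilde z,z)=[G(\tilde x)+\langle K\tilde x,y\rangle-J(y)]-[G(x)+\langle Kx,\tilde y\rangle-J(\tilde y)]$, and $g(\tilde z)=\max_{z\in Z}Q(\tilde z,z)$ (understood as a supremum). *)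

theory Defs
  imports "HOL-Probability.Probability"
begin

text \<open>
  The two spaces are Euclidean spaces (the inner product is the one of the type class). Each
  carries an additional norm \<open>n\<close>, which need not be the norm induced by the inner product.
\<close>

definition is_norm :: "('a::real_vector \<Rightarrow> real) \<Rightarrow> bool" where
  "is_norm n \<longleftrightarrow>
     (\<forall>x. 0 \<le> n x) \<and> (\<forall>x. n x = 0 \<longleftrightarrow> x = 0) \<and>
     (\<forall>c x. n (c *\<^sub>R x) = \<bar>c\<bar> * n x) \<and>
     (\<forall>x y. n (x + y) \<le> n x + n y)"

definition dual_norm :: "('a::real_inner \<Rightarrow> real) \<Rightarrow> 'a \<Rightarrow> real" where
  "dual_norm n w = (SUP x\<in>{x. n x \<le> 1}. w \<bullet> x)"

definition induced_norm ::
    "('a::real_inner \<Rightarrow> real) \<Rightarrow> ('b::real_inner \<Rightarrow> real) \<Rightarrow> ('a \<Rightarrow> 'b) \<Rightarrow> real" where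
  "induced_norm nX nY K = (SUP x\<in>{x. nX x \<le> 1}. dual_norm nY (K x))"

text \<open>
  Functions are total on the type, but only their values on \<open>S\<close> matter, so differentiability is
  taken relative to \<open>S\<close>. If \<open>S\<close> has empty interior the gradient is not unique; the products
  \<open>g u \<bullet> (x - u)\<close> with \<open>x, u \<in> S\<close> (\<open>S\<close> convex) do not depend on the choice.
\<close>

definition gradient_on :: "'a::real_inner set \<Rightarrow> ('a \<Rightarrow> real) \<Rightarrow> ('a \<Rightarrow> 'a) \<Rightarrow> bool" where
  "gradient_on S f g \<longleftrightarrow> (\<forall>x\<in>S. (f has_derivative (\<lambda>h. g x \<bullet> h)) (at x within S))"

definition lsc_on :: "'a::topological_space set \<Rightarrow> ('a \<Rightarrow> real) \<Rightarrow> bool" where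
  "lsc_on S f \<longleftrightarrow> (\<forall>x\<in>S. ereal (f x) \<le> Liminf (at x within S) (\<lambda>u. ereal (f u)))"

definition strongly_convex_on ::
    "'a::real_vector set \<Rightarrow> ('a \<Rightarrow> real) \<Rightarrow> real \<Rightarrow> ('a \<Rightarrow> real) \<Rightarrow> bool" where
  "strongly_convex_on S n \<alpha> d \<longleftrightarrow> convex S \<and>
     (\<forall>x\<in>S. \<forall>y\<in>S. \<forall>u\<ge>0. \<forall>v\<ge>0. u + v = 1 \<longrightarrow>
        d (u *\<^sub>R x + v *\<^sub>R y) \<le> u * d x + v * d y - \<alpha> / 2 * u * v * (n (x - y))\<^sup>2)"

definition bregman :: "('a::real_inner \<Rightarrow> real) \<Rightarrow> ('a \<Rightarrow> 'a) \<Rightarrow> 'a \<Rightarrow> 'a \<Rightarrow> real" where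
  "bregman d gd x u = d x - d u - gd u \<bullet> (x - u)"

definition Q_gap ::
    "('a \<Rightarrow> real) \<Rightarrow> ('a \<Rightarrow> 'b::real_inner) \<Rightarrow> ('b \<Rightarrow> real) \<Rightarrow> 'a \<times> 'b \<Rightarrow> 'a \<times> 'b \<Rightarrow> real" where
  "Q_gap G K J z' z =
     (G (fst z') + K (fst z') \<bullet> snd z - J (snd z)) - (G (fst z) + K (fst z) \<bullet> snd z' - J (snd z'))"

definition gap ::
    "'a set \<Rightarrow> 'b set \<Rightarrow> ('a \<Rightarrow> real) \<Rightarrow> ('a \<Rightarrow> 'b::real_inner) \<Rightarrow> ('b \<Rightarrow> real) \<Rightarrow> 'a \<times> 'b \<Rightarrow> ereal" where
  "gap X Y G K J z' = (SUP z\<in>X \<times> Y. ereal (Q_gap G K J z' z))"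

text \<open>
  One run of the algorithm. Here \<open>g t u\<close>, \<open>kx t u\<close>, \<open>ky t v\<close> are the answers of the three oracles to
  the queries \<open>u\<close>, \<open>u\<close>, \<open>v\<close> in iteration \<open>t\<close> of this run. All sequences are used at indices \<open>t \<ge> 1\<close>.
\<close>

definition APD_run ::
    "'a::real_inner set \<Rightarrow> 'b::real_inner set \<Rightarrow> ('b \<Rightarrow> real) \<Rightarrow>
     ('a \<Rightarrow> 'a \<Rightarrow> real) \<Rightarrow> ('b \<Rightarrow> 'b \<Rightarrow> real) \<Rightarrow>
     (nat \<Rightarrow> real) \<Rightarrow> (nat \<Rightarrow> real) \<Rightarrow> (nat \<Rightarrow> real) \<Rightarrow> (nat \<Rightarrow> real) \<Rightarrow>
     (nat \<Rightarrow> 'a \<Rightarrow> 'a) \<Rightarrow> (nat \<Rightarrow> 'a \<Rightarrow> 'b) \<Rightarrow> (nat \<Rightarrow> 'b \<Rightarrow> 'a) \<Rightarrow> 'a \<Rightarrow> 'b \<Rightarrow>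
     (nat \<Rightarrow> 'a) \<Rightarrow> (nat \<Rightarrow> 'b) \<Rightarrow> (nat \<Rightarrow> 'a) \<Rightarrow> (nat \<Rightarrow> 'a) \<Rightarrow> (nat \<Rightarrow> 'b) \<Rightarrow> (nat \<Rightarrow> 'a) \<Rightarrow> bool" where
  "APD_run X Y J VX VY \<beta> \<theta> \<eta> \<tau> g kx ky x1 y1 x y xmd xag yag xbar \<longleftrightarrow>
     x 1 = x1 \<and> y 1 = y1 \<and> xag 1 = x1 \<and> yag 1 = y1 \<and> xbar 1 = x1 \<and>
     (\<forall>t\<ge>1.
        xmd t = (1 - 1 / \<beta> t) *\<^sub>R xag t + (1 / \<beta> t) *\<^sub>R x t \<and>
        is_arg_min (\<lambda>v. - kx t (xbar t) \<bullet> v + J v + 1 / \<tau> t * VY v (y t)) (\<lambda>v. v \<in> Y) (y (t + 1)) \<and>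
        is_arg_min (\<lambda>u. g t (xmd t) \<bullet> u + u \<bullet> ky t (y (t + 1)) + 1 / \<eta> t * VX u (x t)) (\<lambda>u. u \<in> X)
          (x (t + 1)) \<and>
        xag (t + 1) = (1 - 1 / \<beta> t) *\<^sub>R xag t + (1 / \<beta> t) *\<^sub>R x (t + 1) \<and>
        yag (t + 1) = (1 - 1 / \<beta> t) *\<^sub>R yag t + (1 / \<beta> t) *\<^sub>R y (t + 1) \<and>
        xbar (t + 1) = \<theta> (t + 1) *\<^sub>R (x (t + 1) - x t) + x (t + 1))"

text \<open>The points \<open>xbar t\<close> may leave \<open>X\<close>, but they always lie in the following set.\<close>

definition extrapolated :: "'a::real_vector set \<Rightarrow> (nat \<Rightarrow> real) \<Rightarrow> 'a set" where
  "extrapolated X \<theta> = X \<union> {\<theta> t *\<^sub>R (x - u) + x | x u t. x \<in> X \<and> u \<in> X \<and> 2 \<le> t}"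

text \<open>
  A stochastic oracle for the map \<open>f\<close> answers a query \<open>u\<close> by \<open>F u s\<close>, where \<open>s\<close> is drawn from the
  distribution \<open>D\<close>; \<open>S\<close> is the set of possible queries.
\<close>

definition unbiased_oracle ::
    "'s measure \<Rightarrow> 'a::euclidean_space set \<Rightarrow> ('a \<Rightarrow> 's \<Rightarrow> 'b::euclidean_space) \<Rightarrow> ('a \<Rightarrow> 'b) \<Rightarrow> bool" where
  "unbiased_oracle D S F f \<longleftrightarrow>
     (\<lambda>(u, s). F u s) \<in> borel_measurable (borel \<Otimes>\<^sub>M D) \<and>
     (\<forall>u\<in>S. has_bochner_integral D (F u) (f u))"

definition bounded_variance ::
    "'s measure \<Rightarrow> ('b::euclidean_space \<Rightarrow> real) \<Rightarrow> 'a set \<Rightarrow> ('a \<Rightarrow> 's \<Rightarrow> 'b) \<Rightarrow> ('a \<Rightarrow> 'b) \<Rightarrow> real \<Rightarrow> bool"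
where
  "bounded_variance D n S F f \<sigma> \<longleftrightarrow>
     (\<forall>u\<in>S. (\<integral>\<^sup>+ s. ennreal ((dual_norm n (F u s - f u))\<^sup>2) \<partial>D) \<le> ennreal (\<sigma>\<^sup>2))"

text \<open>
  For \<open>\<sigma> = 0\<close> the quotient is read as \<open>0/0 = 0\<close> and \<open>c/0 = \<infinity>\<close> for \<open>c > 0\<close>, so that the condition says
  that the oracle is exact almost surely.
\<close>

definition light_tail ::
    "'s measure \<Rightarrow> ('b::euclidean_space \<Rightarrow> real) \<Rightarrow> 'a set \<Rightarrow> ('a \<Rightarrow> 's \<Rightarrow> 'b) \<Rightarrow> ('a \<Rightarrow> 'b) \<Rightarrow> real \<Rightarrow> bool"
where
  "light_tail D n S F f \<sigma> \<longleftrightarrow>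
     (\<forall>u\<in>S. if \<sigma> = 0 then AE s in D. F u s = f u
            else (\<integral>\<^sup>+ s. ennreal (exp ((dual_norm n (f u - F u s))\<^sup>2 / \<sigma>\<^sup>2)) \<partial>D) \<le> ennreal (exp 1))"

datatype oracle_call = CallG | CallKx | CallKy

end

theory Submission
  imports Defs
begin

text \<open>
  Multiplied by \<open>\<beta> t * \<gamma> t\<close>, the gap at a fixed comparison point obeys an energy estimate along
  every single run. Convexity and smoothness of \<open>G\<close> turn the averaged iterates into linear terms, the
  optimality conditions of the two prox steps turn these into differences of Bregman distances, and
  the extrapolated point \<open>xbar t\<close> makes the bilinear coupling telescope. The step size condition pays
  for the remaining errors with the fraction \<open>q\<close> of the Bregman distance between consecutive primal
  iterates and the fraction \<open>p\<close> of the dual one. The other fractions \<open>1 - q\<close> and \<open>1 - p\<close> are left over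
  to absorb the correlation of the noise with the iterate that it produces
  (\<open>energy_estimate\<close>, \<open>noise_terms_le\<close>).

  The noise also meets the comparison point, over which a supremum is taken, so it cannot simply be
  averaged. Auxiliary prox sequences that follow the noise bound this supremum by one more Bregman
  diameter and by squares of the noise (\<open>shadow_x_regret\<close>, \<open>shadow_y_regret\<close>), which explains the
  factor 2 in front of the diameters. The outcome, \<open>gap_le\<close>, bounds the gap by a constant, by
  weighted squared dual norms of the noise vectors, and by inner products of the noise vectors with
  bounded directions that are known before the oracle answers.

  The primal noise is a sum \<open>a + b\<close>, with \<open>a\<close> from the gradient oracle and \<open>b\<close> from the oracle for
  \<open>adjoint K\<close>. For a norm that does not come from an inner product, independence does not make the
  second moment of \<open>a + b\<close> at most the sum of the second moments. The proof therefore lets \<open>a\<close> and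
  \<open>b\<close> act in two successive prox steps (\<open>two_noise_bound\<close>, \<open>shadow_x\<close>), so that \<open>a\<close> and \<open>b\<close> contribute
  their separate squares. This needs the Bregman distances themselves in place of their lower bounds
  by squared norms. The additional error is an inner product of \<open>b\<close> with a vector that depends on \<open>a\<close>
  and the past; together with the one from the shadow sequence it tests \<open>b\<close> against a difference of
  two points of \<open>X\<close>, which is no longer than the diameter.

  The directions are known in advance, so the inner products have mean zero, which gives the bound
  in expectation. Under light tails their sums have Gaussian tails by a bound on the moment generating
  function (\<open>prob_noise_linear\<close>), and the weighted squares have exponential tails by Jensen's
  inequality (\<open>prob_noise_square\<close>). Each of the three oracles contributes one event of either kind.
  Their deviations add up to at most the bound because \<open>\<sigma>xG + \<sigma>xK \<le> sqrt 2 * \<sigma>x\<close>.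
\<close>

section \<open>Norms on a Euclidean space\<close>

locale vector_norm =
  fixes n :: "'a::euclidean_space \<Rightarrow> real"
  assumes is_norm: "is_norm n"
begin

lemma nonneg [simp]: "0 \<le> n x"
  and zero [simp]: "n 0 = 0"
  and eq_zero: "n x = 0 \<longleftrightarrow> x = 0"
  and scale: "n (c *\<^sub>R x) = \<bar>c\<bar> * n x"
  and triangle: "n (x + y) \<le> n x + n y"
  using is_norm unfolding is_norm_def by auto

lemma uminus [simp]: "n (- x) = n x"
  using scale[of "-1" x] by simp

lemma minus_commute: "n (x - y) = n (y - x)"
  using uminus[of "x - y"] by simp

lemma continuous: "continuous_on UNIV n"
proof (rule convex_on_continuous)
  show "convex_on UNIV n"
    by (intro convex_onI) (auto intro!: order.trans[OF triangle] simp: scale)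
qed auto

text \<open>The unit sphere is compact, so \<open>n\<close> has a positive minimum on it.\<close>

lemma lower_bound: "\<exists>c>0. \<forall>x. c * norm x \<le> n x"
proof -
  have "\<exists>x\<in>sphere 0 1. \<forall>y\<in>sphere 0 1. n x \<le> n y"
    by (intro continuous_attains_inf continuous_on_subset[OF continuous])
      (auto simp: vector_choose_size)
  then obtain x :: 'a where x: "norm x = 1" "\<And>y. norm y = 1 \<Longrightarrow> n x \<le> n y"
    by auto
  have "n x * norm y \<le> n y" for y
  proof (cases "y = 0")
    case False
    then have "n x \<le> n ((1 / norm y) *\<^sub>R y)"
      by (intro x(2)) simp
    with False show ?thesis
      by (simp add: scale field_simps)
  qed simp
  moreover have "n x \<noteq> 0"
    using x(1) by (auto simp: eq_zero)
  then have "0 < n x"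
    using nonneg[of x] by linarith
  ultimately show ?thesis by blast
qed

lemma bounded_unit_ball: "bounded {x. n x \<le> 1}"
proof -
  obtain c where c: "c > 0" "\<And>x. c * norm x \<le> n x"
    using lower_bound by blast
  show ?thesis
  proof (rule boundedI)
    fix x assume "x \<in> {x. n x \<le> 1}"
    with c(2)[of x] have "c * norm x \<le> 1" by simp
    with c(1) show "norm x \<le> 1 / c" by (simp add: field_simps)
  qed
qed

lemma bdd_above_inner: "bdd_above ((\<lambda>x. w \<bullet> x) ` {x. n x \<le> 1})"
proof -
  have "bounded ((\<lambda>x. w \<bullet> x) ` {x. n x \<le> 1})"
    by (intro bounded_linear_image[OF bounded_unit_ball] bounded_linear_inner_right)
  then show ?thesis by (rule bounded_imp_bdd_above)
qed

lemma inner_le_dual_norm: "w \<bullet> x \<le> dual_norm n w * n x"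
proof (cases "x = 0")
  case False
  then have "n x > 0"
    using nonneg[of x] eq_zero[of x] by linarith
  have "w \<bullet> ((1 / n x) *\<^sub>R x) \<le> dual_norm n w"
    unfolding dual_norm_def
    by (rule cSUP_upper[OF _ bdd_above_inner]) (use \<open>n x > 0\<close> in \<open>simp add: scale\<close>)
  with \<open>n x > 0\<close> show ?thesis by (simp add: field_simps)
qed simp

lemma dual_norm_least: "(\<And>x. n x \<le> 1 \<Longrightarrow> w \<bullet> x \<le> r) \<Longrightarrow> dual_norm n w \<le> r"
  unfolding dual_norm_def by (rule cSUP_least) (auto intro: exI[of _ 0])

lemma dual_norm_nonneg [simp]: "0 \<le> dual_norm n w"
  unfolding dual_norm_def using cSUP_upper[OF _ bdd_above_inner, of 0 w] by simp

lemma dual_norm_uminus [simp]: "dual_norm n (- w) = dual_norm n w"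
proof -
  have "dual_norm n (- w) \<le> dual_norm n w" for w
  proof (rule dual_norm_least)
    fix x assume "n x \<le> 1"
    have "- w \<bullet> x = w \<bullet> - x" by simp
    also have "\<dots> \<le> dual_norm n w * n x"
      using inner_le_dual_norm[of w "- x"] by simp
    also have "\<dots> \<le> dual_norm n w"
      using \<open>n x \<le> 1\<close> by (simp add: mult_left_le)
    finally show "- w \<bullet> x \<le> dual_norm n w" .
  qed
  from this[of w] this[of "- w"] show ?thesis by simp
qed

lemma dual_norm_minus_commute: "dual_norm n (v - w) = dual_norm n (w - v)"
  using dual_norm_uminus[of "v - w"] by simp

lemma continuous_dual_norm: "continuous_on UNIV (dual_norm n)"
proof (rule convex_on_continuous)
  show "convex_on UNIV (dual_norm n)"
  proof (rule convex_onI)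
    fix t :: real and v w :: 'a
    assume t: "0 < t" "t < 1"
    show "dual_norm n ((1 - t) *\<^sub>R v + t *\<^sub>R w) \<le> (1 - t) * dual_norm n v + t * dual_norm n w"
    proof (rule dual_norm_least)
      fix x assume "n x \<le> 1"
      have le: "w \<bullet> x \<le> dual_norm n w" for w
        using inner_le_dual_norm[of w x] mult_left_le[OF \<open>n x \<le> 1\<close> dual_norm_nonneg[of w]]
        by linarith
      show "((1 - t) *\<^sub>R v + t *\<^sub>R w) \<bullet> x \<le> (1 - t) * dual_norm n v + t * dual_norm n w"
        using t by (auto simp: inner_add_left intro!: add_mono mult_left_mono le)
    qed
  qed auto
qed auto

lemma dual_norm_measurable [measurable]: "dual_norm n \<in> borel_measurable borel"
  by (rule borel_measurable_continuous_onI[OF continuous_dual_norm])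

lemma measurable [measurable]: "n \<in> borel_measurable borel"
  by (rule borel_measurable_continuous_onI[OF continuous])

lemma abs_inner_le_dual_norm: "\<bar>w \<bullet> x\<bar> \<le> dual_norm n w * n x"
  using inner_le_dual_norm[of w x] inner_le_dual_norm[of "- w" x] by simp

lemma inner_le_squares:
  assumes "c > 0"
  shows "w \<bullet> x \<le> c / 2 * (dual_norm n w)\<^sup>2 + 1 / (2 * c) * (n x)\<^sup>2"
proof -
  let ?a = "dual_norm n w" and ?b = "n x"
  have "0 \<le> (c * ?a - ?b)\<^sup>2 / (2 * c)"
    using assms by simp
  also have "\<dots> = c / 2 * ?a\<^sup>2 + 1 / (2 * c) * ?b\<^sup>2 - ?a * ?b"
    using assms by (simp add: field_simps power2_eq_square)
  finally show ?thesis using inner_le_dual_norm[of w x] by linarith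
qed

end

lemma inner_le_induced_norm:
  assumes "is_norm nX" "is_norm nY" "linear (K :: 'a::euclidean_space \<Rightarrow> 'b::euclidean_space)"
  shows "K x \<bullet> y \<le> induced_norm nX nY K * nX x * nY y"
proof -
  interpret X: vector_norm nX by unfold_locales fact
  interpret Y: vector_norm nY by unfold_locales fact
  have "compact {x. nX x \<le> 1}"
    using X.bounded_unit_ball closed_Collect_le[OF X.continuous continuous_on_const]
    by (simp add: compact_eq_bounded_closed)
  moreover have "continuous_on UNIV (\<lambda>x. dual_norm nY (K x))"
    using continuous_on_compose2[OF Y.continuous_dual_norm linear_continuous_on[of K UNIV]] assms(3)
    by (simp add: linear_conv_bounded_linear)
  ultimately have "compact ((\<lambda>x. dual_norm nY (K x)) ` {x. nX x \<le> 1})"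
    by (intro compact_continuous_image) (auto intro: continuous_on_subset)
  then have bdd: "bdd_above ((\<lambda>x. dual_norm nY (K x)) ` {x. nX x \<le> 1})"
    by (intro bounded_imp_bdd_above compact_imp_bounded)
  show ?thesis
  proof (cases "x = 0")
    case True
    then show ?thesis using linear_0[OF assms(3)] by simp
  next
    case False
    then have pos: "nX x > 0"
      using X.nonneg[of x] X.eq_zero[of x] by linarith
    have "K ((1 / nX x) *\<^sub>R x) \<bullet> y \<le> dual_norm nY (K ((1 / nX x) *\<^sub>R x)) * nY y"
      by (rule Y.inner_le_dual_norm)
    also have "\<dots> \<le> induced_norm nX nY K * nY y"
      unfolding induced_norm_def
      by (intro mult_right_mono cSUP_upper[OF _ bdd] Y.nonneg) (use pos in \<open>simp add: X.scale\<close>)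
    finally show ?thesis
      using pos by (simp add: linear_scale[OF assms(3)] field_simps)
  qed
qed

section \<open>Gradients and strong convexity on a convex set\<close>

text \<open>
  Only directions that point into \<open>S\<close> are tested, so this is all that a gradient relative to \<open>S\<close>
  can provide, and it is all that convexity arguments use.
\<close>

lemma gradient_on_directional:
  assumes "gradient_on S f g" "convex S" "x \<in> S" "u \<in> S"
  shows "((\<lambda>l. (f (u + l *\<^sub>R (x - u)) - f u) / l) \<longlongrightarrow> g u \<bullet> (x - u)) (at_right 0)"
proof -
  have sub: "(\<lambda>l. u + l *\<^sub>R (x - u)) ` {0..1} \<subseteq> S"
  proof safe
    fix l :: real assume "l \<in> {0..1}"
    then have "(1 - l) *\<^sub>R u + l *\<^sub>R x \<in> S"
      using assms(2-4) by (intro convexD) auto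
    then show "u + l *\<^sub>R (x - u) \<in> S" by (simp add: algebra_simps)
  qed
  have "(f has_derivative (\<lambda>h. g u \<bullet> h)) (at (u + 0 *\<^sub>R (x - u)) within S)"
    using assms(1,4) by (simp add: gradient_on_def)
  then have "(f has_derivative (\<lambda>h. g u \<bullet> h))
      (at (u + 0 *\<^sub>R (x - u)) within (\<lambda>l. u + l *\<^sub>R (x - u)) ` {0..1})"
    by (rule has_derivative_subset) (rule sub)
  moreover have "((\<lambda>l. u + l *\<^sub>R (x - u)) has_derivative (\<lambda>l. l *\<^sub>R (x - u))) (at 0 within {0..1})"
    by (auto intro!: derivative_eq_intros)
  ultimately have "((\<lambda>l. f (u + l *\<^sub>R (x - u))) has_derivative (\<lambda>l. g u \<bullet> (l *\<^sub>R (x - u))))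
      (at 0 within {0..1})"
    by (rule has_derivative_in_compose[rotated])
  then have "((\<lambda>l. f (u + l *\<^sub>R (x - u))) has_field_derivative (g u \<bullet> (x - u))) (at 0 within {0..1})"
    by (simp add: has_field_derivative_def mult.commute[of _ "g u \<bullet> (x - u)"] mult_commute_abs)
  then have "((\<lambda>l. (f (u + l *\<^sub>R (x - u)) - f u) / l) \<longlongrightarrow> g u \<bullet> (x - u)) (at 0 within {0..1})"
    by (simp add: has_field_derivative_iff)
  then show ?thesis
    by (simp add: at_within_Icc_at_right)
qed

text \<open>
  If \<open>S\<close> has empty interior, a given gradient may be badly behaved across directions that leave
  \<open>S\<close>. Its component along the span of \<open>S - S\<close> is however a limit of difference quotients of a
  continuous function, hence Borel, and it is a gradient as well.
\<close>

lemma gradient_on_borel_representative: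
  fixes S :: "'a::euclidean_space set"
  assumes grad: "gradient_on S f g" and S: "convex S" "closed S" "S \<noteq> {}"
  obtains g' where "g' \<in> borel_measurable borel" "gradient_on S f g'"
    "\<And>x u. x \<in> S \<Longrightarrow> u \<in> S \<Longrightarrow> g' u \<bullet> (x - u) = g u \<bullet> (x - u)"
proof -
  obtain x0 where x0: "x0 \<in> S" using S by auto
  define W where "W = span ((\<lambda>w. w - x0) ` S)"
  obtain B where B: "B \<subseteq> W" "pairwise orthogonal B" "\<And>b. b \<in> B \<Longrightarrow> norm b = 1"
      "independent B" "span B = W"
    using orthonormal_basis_subspace[of W] unfolding W_def by (metis subspace_span)
  have "finite B" using B(4) by (rule independent_imp_finite)
  define g' where "g' u = (\<Sum>b\<in>B. (indicator S u * (g u \<bullet> b)) *\<^sub>R b)" for u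
  have S_borel [measurable]: "S \<in> sets borel" using S(2) by simp
  have f_meas: "f \<in> borel_measurable (restrict_space borel S)"
    by (rule borel_measurable_continuous_on_restrict)
      (use grad in \<open>auto simp: gradient_on_def intro!: has_derivative_continuous_on\<close>)
  have dir: "(\<lambda>u. g u \<bullet> (x - u)) \<in> borel_measurable (restrict_space borel S)" if "x \<in> S" for x
  proof (rule borel_measurable_LIMSEQ_real)
    fix u assume "u \<in> space (restrict_space borel S)"
    then have "u \<in> S" by (simp add: space_restrict_space)
    have "filterlim (\<lambda>i. 1 / real (Suc i)) (at_right 0) sequentially"
      using LIMSEQ_Suc[OF lim_1_over_n] unfolding filterlim_at by auto
    from filterlim_compose[OF gradient_on_directional[OF grad S(1) that \<open>u \<in> S\<close>] this]
    show "(\<lambda>i. (f (u + (1 / real (Suc i)) *\<^sub>R (x - u)) - f u) / (1 / real (Suc i)))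
        \<longlonglongrightarrow> g u \<bullet> (x - u)" .
  next
    fix i
    have "(\<lambda>u. u + (1 / real (Suc i)) *\<^sub>R (x - u)) \<in> restrict_space borel S \<rightarrow>\<^sub>M restrict_space borel S"
    proof (rule measurable_restrict_space2)
      show "(\<lambda>u. u + (1 / real (Suc i)) *\<^sub>R (x - u)) \<in> space (restrict_space borel S) \<rightarrow> S"
      proof
        fix u assume "u \<in> space (restrict_space borel S)"
        then have "(1 - 1 / real (Suc i)) *\<^sub>R u + (1 / real (Suc i)) *\<^sub>R x \<in> S"
          using that S(1) by (intro convexD) (auto simp: space_restrict_space)
        then show "u + (1 / real (Suc i)) *\<^sub>R (x - u) \<in> S"
          by (simp add: algebra_simps)
      qed
      show "(\<lambda>u. u + (1 / real (Suc i)) *\<^sub>R (x - u)) \<in> borel_measurable (restrict_space borel S)"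
        by (intro measurable_restrict_space1) measurable
    qed
    from measurable_compose[OF this f_meas]
    show "(\<lambda>u. (f (u + (1 / real (Suc i)) *\<^sub>R (x - u)) - f u) / (1 / real (Suc i)))
        \<in> borel_measurable (restrict_space borel S)"
      using f_meas by simp
  qed
  have W_meas: "(\<lambda>u. g u \<bullet> w) \<in> borel_measurable (restrict_space borel S)" if "w \<in> W" for w
    using that unfolding W_def
  proof (induction rule: span_induct_alt)
    case base
    show ?case by simp
  next
    case (step c w z)
    then obtain v where v: "v \<in> S" "w = v - x0" by auto
    have "(\<lambda>u. g u \<bullet> (v - u) - g u \<bullet> (x0 - u)) \<in> borel_measurable (restrict_space borel S)"
      by (intro borel_measurable_diff dir v x0)
    then have "(\<lambda>u. c * (g u \<bullet> w) + g u \<bullet> z) \<in> borel_measurable (restrict_space borel S)"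
      unfolding v by (intro borel_measurable_add borel_measurable_times step.IH)
        (simp_all add: inner_diff_right)
    then show ?case by (simp add: inner_add_right)
  qed
  have meas: "g' \<in> borel_measurable borel"
    unfolding g'_def
  proof (intro borel_measurable_sum borel_measurable_scaleR borel_measurable_const)
    fix b assume "b \<in> B"
    with B(1) W_meas have "(\<lambda>u. g u \<bullet> b) \<in> borel_measurable (restrict_space borel S)" by auto
    then show "(\<lambda>u. indicator S u * (g u \<bullet> b)) \<in> borel_measurable borel"
      by (subst (asm) borel_measurable_restrict_space_iff) (auto simp: mult.commute)
  qed
  have inner_W: "g' u \<bullet> w = g u \<bullet> w" if "w \<in> W" "u \<in> S" for u w
    using that(1) unfolding B(5)[symmetric]
  proof (induction rule: span_induct_alt)
    case (step c b z)
    have "g' u \<bullet> b = (\<Sum>b'\<in>B. (g u \<bullet> b') * (b' \<bullet> b))"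
      using \<open>u \<in> S\<close> by (simp add: g'_def inner_sum_left)
    also have "\<dots> = (\<Sum>b'\<in>B. if b' = b then g u \<bullet> b else 0)"
      using B(2,3) step(1) by (intro sum.cong)
        (auto simp: pairwise_def orthogonal_def norm_eq_1)
    also have "\<dots> = g u \<bullet> b" using step(1) \<open>finite B\<close> by simp
    finally show ?case using step by (simp add: inner_add_right)
  qed simp
  have agree: "g' u \<bullet> (x - u) = g u \<bullet> (x - u)" if "x \<in> S" "u \<in> S" for x u
  proof (rule inner_W)
    have "(x - x0) - (u - x0) \<in> W"
      unfolding W_def using that by (intro span_diff span_base) auto
    then show "x - u \<in> W" by simp
  qed fact
  have "gradient_on S f g'"
    unfolding gradient_on_def
  proof
    fix u assume "u \<in> S"
    then have "(f has_derivative (\<lambda>h. g u \<bullet> h)) (at u within S)"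
      using grad by (simp add: gradient_on_def)
    then have lim: "((\<lambda>x. (f x - f u - g u \<bullet> (x - u)) /\<^sub>R norm (x - u)) \<longlongrightarrow> 0) (at u within S)"
      unfolding has_derivative_at_within by simp
    have "((\<lambda>x. (f x - f u - g' u \<bullet> (x - u)) /\<^sub>R norm (x - u)) \<longlongrightarrow> 0) (at u within S)"
      by (rule Lim_transform_within_set_eq[THEN iffD1, OF _ Lim_transform_within[OF lim zero_less_one]])
        (use \<open>u \<in> S\<close> in \<open>auto simp: agree\<close>)
    then show "(f has_derivative (\<lambda>h. g' u \<bullet> h)) (at u within S)"
      unfolding has_derivative_at_within by (auto intro: bounded_linear_inner_right)
  qed
  from that[OF meas this agree] show thesis .
qed

lemma gradient_on_convex_le:
  assumes "convex_on S f" "gradient_on S f g" "x \<in> S" "u \<in> S"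
  shows "f u + g u \<bullet> (x - u) \<le> f x"
proof -
  have "g u \<bullet> (x - u) \<le> f x - f u"
  proof (rule tendsto_upperbound[OF gradient_on_directional[OF assms(2) _ assms(3,4)]])
    show "convex S" using assms(1) by (rule convex_on_imp_convex)
    show "\<forall>\<^sub>F l in at_right 0. (f (u + l *\<^sub>R (x - u)) - f u) / l \<le> f x - f u"
      unfolding eventually_at_right_field
    proof (intro exI[of _ 1] conjI allI impI)
      fix l :: real assume l: "0 < l" "l < 1"
      have "f ((1 - l) *\<^sub>R u + l *\<^sub>R x) \<le> (1 - l) * f u + l * f x"
        using assms l by (intro convex_onD) auto
      then have "f (u + l *\<^sub>R (x - u)) - f u \<le> l * (f x - f u)"
        by (simp add: algebra_simps)
      with l show "(f (u + l *\<^sub>R (x - u)) - f u) / l \<le> f x - f u"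
        by (simp add: field_simps)
    qed simp
  qed simp
  then show ?thesis by simp
qed

lemma gradient_on_strongly_convex_le:
  assumes "strongly_convex_on S n \<alpha> d" "gradient_on S d g" "x \<in> S" "u \<in> S"
  shows "d u + g u \<bullet> (x - u) + \<alpha> / 2 * (n (x - u))\<^sup>2 \<le> d x"
proof -
  have S: "convex S" using assms(1) by (simp add: strongly_convex_on_def)
  let ?N = "\<alpha> / 2 * (n (x - u))\<^sup>2"
  have "((\<lambda>l. (d (u + l *\<^sub>R (x - u)) - d u) / l - l * ?N) \<longlongrightarrow> g u \<bullet> (x - u) - 0 * ?N) (at_right 0)"
    by (intro tendsto_intros gradient_on_directional[OF assms(2) S assms(3,4)])
  then have "g u \<bullet> (x - u) - 0 * ?N \<le> d x - d u - ?N"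
  proof (rule tendsto_upperbound)
    show "\<forall>\<^sub>F l in at_right 0. (d (u + l *\<^sub>R (x - u)) - d u) / l - l * ?N \<le> d x - d u - ?N"
      unfolding eventually_at_right_field
    proof (intro exI[of _ 1] conjI allI impI)
      fix l :: real assume l: "0 < l" "l < 1"
      have "d (l *\<^sub>R x + (1 - l) *\<^sub>R u) \<le> l * d x + (1 - l) * d u - \<alpha> / 2 * l * (1 - l) * (n (x - u))\<^sup>2"
        using assms(1,3,4) l unfolding strongly_convex_on_def by simp
      then have "d (u + l *\<^sub>R (x - u)) - d u \<le> l * (d x - d u - ?N + l * ?N)"
        by (simp add: algebra_simps diff_divide_distrib)
      with l show "(d (u + l *\<^sub>R (x - u)) - d u) / l - l * ?N \<le> d x - d u - ?N"
        by (simp add: field_simps)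
    qed simp
  qed simp
  then show ?thesis by simp
qed

text \<open>
  Minimisers of \<open>h + \<langle>s, \<cdot>\<rangle>\<close> are unique and depend Lipschitz continuously on \<open>s\<close>, because \<open>h\<close> grows
  quadratically around each of them. Hence a minimiser is a measurable function of the data, however
  irregular \<open>h\<close> is.
\<close>

context vector_norm
begin

lemma tilted_growth:
  assumes h: "strongly_convex_on S n \<alpha> h" and z: "z \<in> S" and u: "u \<in> S"
    and min: "\<And>u. u \<in> S \<Longrightarrow> s \<bullet> z + h z \<le> s \<bullet> u + h u"
  shows "\<alpha> / 4 * (n (u - z))\<^sup>2 \<le> s \<bullet> (u - z) + h u - h z"
proof -
  let ?m = "(1/2) *\<^sub>R u + (1/2) *\<^sub>R z"
  have le: "h ?m \<le> 1/2 * h u + 1/2 * h z - \<alpha> / 2 * (1/2) * (1/2) * (n (u - z))\<^sup>2"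
    using h z u unfolding strongly_convex_on_def
    by (metis add_divide_distrib field_sum_of_halves half_gt_zero_iff less_eq_real_def zero_less_one)
  have "?m \<in> S"
    using h z u unfolding strongly_convex_on_def by (intro convexD) auto
  from min[OF this] le show ?thesis
    by (simp add: inner_add_right inner_diff_right field_simps)
qed

lemma argmin_tilted_unique:
  assumes "strongly_convex_on S n \<alpha> h" "\<alpha> > 0" "z \<in> S" "z' \<in> S"
    and "\<And>u. u \<in> S \<Longrightarrow> s \<bullet> z + h z \<le> s \<bullet> u + h u" "\<And>u. u \<in> S \<Longrightarrow> s \<bullet> z' + h z' \<le> s \<bullet> u + h u"
  shows "z = z'"
proof -
  have "\<alpha> / 4 * (n (z' - z))\<^sup>2 \<le> 0"
    using tilted_growth[OF assms(1,3,4,5)] assms(6)[OF assms(3)] by (simp add: inner_diff_right)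
  then have "n (z' - z) = 0" using assms(2) by (simp add: mult_le_0_iff)
  then show ?thesis by (simp add: eq_zero)
qed

lemma argmin_tilted_continuous:
  assumes h: "strongly_convex_on S n \<alpha> h" "\<alpha> > 0"
    and p: "\<And>s. s \<in> T \<Longrightarrow> p s \<in> S" "\<And>s u. s \<in> T \<Longrightarrow> u \<in> S \<Longrightarrow> s \<bullet> p s + h (p s) \<le> s \<bullet> u + h u"
  shows "continuous_on T p"
proof -
  obtain c where c: "c > 0" "\<And>x. c * norm x \<le> n x"
    using lower_bound by blast
  have growth: "\<alpha> / 4 * (n (u - p s))\<^sup>2 \<le> s \<bullet> (u - p s) + h u - h (p s)" if "s \<in> T" "u \<in> S" for s u
    using that by (intro tilted_growth[OF h(1)] p)
  have lip: "\<alpha> / 2 * c\<^sup>2 * norm (p s - p t) \<le> norm (s - t)" if "s \<in> T" "t \<in> T" for s t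
  proof (cases "p s = p t")
    case False
    have "\<alpha> / 2 * (c * norm (p s - p t))\<^sup>2 \<le> \<alpha> / 2 * (n (p s - p t))\<^sup>2"
      using c h(2) by (intro mult_left_mono power_mono) auto
    also have "\<dots> = \<alpha> / 4 * (n (p t - p s))\<^sup>2 + \<alpha> / 4 * (n (p s - p t))\<^sup>2"
      by (simp add: minus_commute)
    also have "\<dots> \<le> (s - t) \<bullet> (p t - p s)"
      using growth[OF that(1) p(1)[OF that(2)]] growth[OF that(2) p(1)[OF that(1)]]
      by (simp add: inner_diff_left inner_diff_right)
    also have "\<dots> \<le> norm (s - t) * norm (p s - p t)"
      using norm_cauchy_schwarz[of "s - t" "p t - p s"] by (simp add: norm_minus_commute)
    finally have "(\<alpha> / 2 * c\<^sup>2 * norm (p s - p t)) * norm (p s - p t) \<le> norm (s - t) * norm (p s - p t)"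
      by (simp add: power2_eq_square algebra_simps)
    with False show ?thesis by simp
  qed simp
  have "0 < \<alpha> / 2 * c\<^sup>2" using c h by simp
  then have "(2 / (\<alpha> * c\<^sup>2))-lipschitz_on T p"
    using lip by (intro lipschitz_onI) (auto simp: dist_norm field_simps)
  then show ?thesis by (rule lipschitz_on_continuous_on)
qed

lemma argmin_tilted_measurable:
  assumes h: "strongly_convex_on S n \<alpha> h" "\<alpha> > 0" and s: "s \<in> borel_measurable N"
    and z: "\<And>\<omega>. \<omega> \<in> space N \<Longrightarrow> z \<omega> \<in> S"
      "\<And>\<omega> u. \<omega> \<in> space N \<Longrightarrow> u \<in> S \<Longrightarrow> s \<omega> \<bullet> z \<omega> + h (z \<omega>) \<le> s \<omega> \<bullet> u + h u"
  shows "z \<in> borel_measurable N"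
proof -
  define T where "T = s ` space N"
  define p where "p t = z (SOME \<omega>. \<omega> \<in> space N \<and> s \<omega> = t)" for t
  have some: "(SOME \<omega>. \<omega> \<in> space N \<and> s \<omega> = t) \<in> space N \<and> s (SOME \<omega>. \<omega> \<in> space N \<and> s \<omega> = t) = t"
    if "t \<in> T" for t
    by (rule someI_ex) (use that in \<open>auto simp: T_def\<close>)
  have p: "p t \<in> S" "\<And>u. u \<in> S \<Longrightarrow> t \<bullet> p t + h (p t) \<le> t \<bullet> u + h u" if "t \<in> T" for t
    using z(1)[OF some[OF that, THEN conjunct1]] z(2)[OF some[OF that, THEN conjunct1]]
    unfolding p_def some[OF that, THEN conjunct2] by auto
  have "p \<in> borel_measurable (restrict_space borel T)"
    by (intro borel_measurable_continuous_on_restrict argmin_tilted_continuous[OF h] p)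
  moreover have "s \<in> N \<rightarrow>\<^sub>M restrict_space borel T"
    using s by (intro measurable_restrict_space2) (auto simp: T_def)
  ultimately have "(\<lambda>\<omega>. p (s \<omega>)) \<in> borel_measurable N"
    by (rule measurable_compose[rotated])
  moreover have "p (s \<omega>) = z \<omega>" if "\<omega> \<in> space N" for \<omega>
  proof (rule argmin_tilted_unique[OF h])
    have "s \<omega> \<in> T" using that by (simp add: T_def)
    from p[OF this] show "p (s \<omega>) \<in> S" "\<And>u. u \<in> S \<Longrightarrow> s \<omega> \<bullet> p (s \<omega>) + h (p (s \<omega>)) \<le> s \<omega> \<bullet> u + h u"
      by auto
  qed (use z[OF that] in auto)
  ultimately show ?thesis by (simp cong: measurable_cong)
qed

end

section \<open>Prox steps for a Bregman divergence of bounded range\<close>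

text \<open>
  The gradient is taken Borel measurable, so that the steps below are measurable in all their
  arguments; by \<open>gradient_on_borel_representative\<close> this is no restriction.
\<close>

locale mirror_setup = vector_norm n for n :: "'a::euclidean_space \<Rightarrow> real" +
  fixes S :: "'a set" and d :: "'a \<Rightarrow> real" and g :: "'a \<Rightarrow> 'a" and \<alpha> :: real
    and V :: "'a \<Rightarrow> 'a \<Rightarrow> real" and \<Omega> :: real
  assumes closed_S: "closed S" and nonempty_S: "S \<noteq> {}"
    and \<alpha>_pos: "\<alpha> > 0" and strongly_convex: "strongly_convex_on S n \<alpha> d"
    and gradient: "gradient_on S d g" and gradient_measurable [measurable]: "g \<in> borel_measurable borel"
    and V_eq: "\<And>x u. x \<in> S \<Longrightarrow> u \<in> S \<Longrightarrow> V x u = d x - d u - g u \<bullet> (x - u)"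
    and \<Omega>_pos: "\<Omega> > 0" and V_le: "\<And>x u. x \<in> S \<Longrightarrow> u \<in> S \<Longrightarrow> V x u \<le> \<Omega>\<^sup>2"
begin

lemma convex_S: "convex S"
  using strongly_convex by (simp add: strongly_convex_on_def)

lemma V_lower: "x \<in> S \<Longrightarrow> u \<in> S \<Longrightarrow> \<alpha> / 2 * (n (x - u))\<^sup>2 \<le> V x u"
  using gradient_on_strongly_convex_le[OF strongly_convex gradient, of x u] by (simp add: V_eq)

lemma V_nonneg: "x \<in> S \<Longrightarrow> u \<in> S \<Longrightarrow> 0 \<le> V x u"
  using V_lower[of x u] \<alpha>_pos by (smt (verit) divide_pos_pos mult_nonneg_nonneg zero_le_power2)

lemma diameter: "x \<in> S \<Longrightarrow> u \<in> S \<Longrightarrow> n (x - u) \<le> sqrt 2 * \<Omega> / sqrt \<alpha>"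
proof -
  assume *: "x \<in> S" "u \<in> S"
  have "\<alpha> / 2 * (n (x - u))\<^sup>2 \<le> \<Omega>\<^sup>2"
    using V_lower[OF *] V_le[OF *] by linarith
  then have "(n (x - u))\<^sup>2 \<le> (sqrt 2 * \<Omega> / sqrt \<alpha>)\<^sup>2"
    using \<alpha>_pos by (simp add: power_mult_distrib power_divide field_simps)
  then show ?thesis
    by (rule power2_le_imp_le) (use \<Omega>_pos \<alpha>_pos in simp)
qed

lemma compact_S: "compact S"
proof -
  obtain c where c: "c > 0" "\<And>x. c * norm x \<le> n x"
    using lower_bound by blast
  obtain x0 where x0: "x0 \<in> S" using nonempty_S by auto
  have "bounded S"
    unfolding bounded_def
  proof (intro exI ballI)
    fix x assume "x \<in> S"
    then have "c * norm (x0 - x) \<le> sqrt 2 * \<Omega> / sqrt \<alpha>"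
      using c(2)[of "x0 - x"] diameter[OF x0] by (meson order.trans)
    then show "dist x0 x \<le> sqrt 2 * \<Omega> / sqrt \<alpha> / c"
      unfolding dist_norm by (subst pos_le_divide_eq[OF c(1)]) (simp only: mult.commute)
  qed
  with closed_S show ?thesis by (simp add: compact_eq_bounded_closed)
qed

lemma continuous_d: "continuous_on S d"
  using gradient by (auto simp: gradient_on_def intro!: has_derivative_continuous_on)

text \<open>
  Only \<open>d\<close> is differentiable. Moving from the minimiser towards \<open>u\<close> changes \<open>h\<close> by at most its
  chord slope, and the directional derivative of the Bregman term is the right-hand side.
\<close>

lemma three_point:
  assumes h: "convex_on S h" and c: "c > 0" and x: "x \<in> S" and u: "u \<in> S"
    and p: "p \<in> S" "\<And>u. u \<in> S \<Longrightarrow> s \<bullet> p + h p + 1 / c * V p x \<le> s \<bullet> u + h u + 1 / c * V u x"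
  shows "s \<bullet> (p - u) + h p - h u \<le> 1 / c * (V u x - V u p - V p x)"
proof -
  define r where "r l = (d (p + l *\<^sub>R (u - p)) - d p) / l" for l
  have lim: "(r \<longlongrightarrow> g p \<bullet> (u - p)) (at_right 0)"
    unfolding r_def by (rule gradient_on_directional[OF gradient convex_S u p(1)])
  have "s \<bullet> (p - u) + h p - h u \<le> 1 / c * (g p \<bullet> (u - p) - g x \<bullet> (u - p))"
  proof (rule tendsto_lowerbound)
    show "((\<lambda>l. 1 / c * (r l - g x \<bullet> (u - p))) \<longlongrightarrow> 1 / c * (g p \<bullet> (u - p) - g x \<bullet> (u - p))) (at_right 0)"
      by (intro tendsto_intros lim)
    show "\<forall>\<^sub>F l in at_right 0. s \<bullet> (p - u) + h p - h u \<le> 1 / c * (r l - g x \<bullet> (u - p))"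
      unfolding eventually_at_right_field
    proof (intro exI[of _ 1] conjI allI impI)
      fix l :: real assume l: "0 < l" "l < 1"
      let ?q = "p + l *\<^sub>R (u - p)"
      have q: "?q = (1 - l) *\<^sub>R p + l *\<^sub>R u" by (simp add: algebra_simps)
      have "?q \<in> S"
        unfolding q using l p(1) u by (intro convexD[OF convex_S]) auto
      have "h ?q \<le> (1 - l) * h p + l * h u"
        unfolding q using l p(1) u by (intro convex_onD[OF h]) auto
      with p(2)[OF \<open>?q \<in> S\<close>]
      have "s \<bullet> p + h p + 1 / c * V p x \<le> s \<bullet> ?q + ((1 - l) * h p + l * h u) + 1 / c * V ?q x"
        by linarith
      moreover have "V ?q x - V p x = l * r l - l * (g x \<bullet> (u - p))"
        using \<open>?q \<in> S\<close> p(1) x l by (simp add: V_eq r_def inner_add_right inner_diff_right)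
      then have "1 / c * V ?q x = 1 / c * V p x + l * (1 / c * (r l - g x \<bullet> (u - p)))"
        using c by (simp add: field_simps)
      ultimately have "l * (s \<bullet> (p - u) + h p - h u) \<le> l * (1 / c * (r l - g x \<bullet> (u - p)))"
        by (simp add: inner_add_right inner_diff_right algebra_simps)
      with l(1) show "s \<bullet> (p - u) + h p - h u \<le> 1 / c * (r l - g x \<bullet> (u - p))"
        by (simp only: mult_le_cancel_left_pos)
    qed simp
  qed simp
  then show ?thesis
    using u x p(1) by (simp only: V_eq inner_diff_right) (simp add: algebra_simps)
qed

definition tilted_argmin :: "'a \<Rightarrow> 'a" where
  "tilted_argmin s = (SOME p. p \<in> S \<and> (\<forall>u\<in>S. s \<bullet> p + d p \<le> s \<bullet> u + d u))"

definition prox_step :: "real \<Rightarrow> 'a \<Rightarrow> 'a \<Rightarrow> 'a" where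
  "prox_step c s x = tilted_argmin (c *\<^sub>R s - g x)"

lemma tilted_argmin: "tilted_argmin s \<in> S \<and> (\<forall>u\<in>S. s \<bullet> tilted_argmin s + d (tilted_argmin s) \<le> s \<bullet> u + d u)"
proof -
  have "\<exists>p\<in>S. \<forall>u\<in>S. s \<bullet> p + d p \<le> s \<bullet> u + d u"
    by (intro continuous_attains_inf compact_S nonempty_S continuous_intros continuous_d)
  then have "\<exists>p. p \<in> S \<and> (\<forall>u\<in>S. s \<bullet> p + d p \<le> s \<bullet> u + d u)" by blast
  then show ?thesis
    unfolding tilted_argmin_def by (rule someI_ex)
qed

lemma prox_step_in: "prox_step c s x \<in> S"
  unfolding prox_step_def using tilted_argmin by blast

lemma prox_step_measurable [measurable]:
  assumes [measurable]: "s \<in> borel_measurable N" "x \<in> borel_measurable N"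
  shows "(\<lambda>\<omega>. prox_step c (s \<omega>) (x \<omega>)) \<in> borel_measurable N"
proof -
  have "continuous_on UNIV tilted_argmin"
    by (rule argmin_tilted_continuous[OF strongly_convex \<alpha>_pos]) (use tilted_argmin in auto)
  then have [measurable]: "tilted_argmin \<in> borel_measurable borel"
    by (rule borel_measurable_continuous_onI)
  show ?thesis unfolding prox_step_def by measurable
qed

lemma prox_step_three_point:
  assumes "c > 0" "x \<in> S" "u \<in> S"
  shows "s \<bullet> (prox_step c s x - u) \<le> 1 / c * (V u x - V u (prox_step c s x) - V (prox_step c s x) x)"
proof -
  let ?p = "prox_step c s x"
  have "s \<bullet> ?p + 0 + 1 / c * V ?p x \<le> s \<bullet> u + 0 + 1 / c * V u x" if "u \<in> S" for u
  proof -
    have "(c *\<^sub>R s - g x) \<bullet> ?p + d ?p \<le> (c *\<^sub>R s - g x) \<bullet> u + d u"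
      unfolding prox_step_def using tilted_argmin that by blast
    then have "c * (s \<bullet> ?p) + V ?p x \<le> c * (s \<bullet> u) + V u x"
      using that assms by (simp add: V_eq prox_step_in inner_diff_left inner_diff_right)
    then have "(c * (s \<bullet> ?p) + V ?p x) / c \<le> (c * (s \<bullet> u) + V u x) / c"
      by (rule divide_right_mono) (use assms(1) in simp)
    with assms(1) show ?thesis by (simp add: add_divide_distrib)
  qed
  moreover have "convex_on S (\<lambda>_. 0 :: real)"
    using convex_S by (simp add: convex_on_const)
  ultimately show ?thesis
    using three_point[of "\<lambda>_. 0" c x u ?p s] assms prox_step_in by simp
qed

text \<open>
  One step of the prox method against the linear functional \<open>s\<close>, tested at the point from which
  the step starts: Young's inequality hides the move itself in its own Bregman distance.
\<close>

lemma prox_step_bound: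
  assumes "c > 0" "x \<in> S" "u \<in> S"
  shows "s \<bullet> (x - u) \<le> 1 / c * (V u x - V u (prox_step c s x)) + c / (2 * \<alpha>) * (dual_norm n s)\<^sup>2"
proof -
  let ?p = "prox_step c s x"
  have "s \<bullet> (x - ?p) \<le> (c / \<alpha>) / 2 * (dual_norm n s)\<^sup>2 + 1 / (2 * (c / \<alpha>)) * (n (x - ?p))\<^sup>2"
    using assms \<alpha>_pos by (intro inner_le_squares) simp
  also have "1 / (2 * (c / \<alpha>)) * (n (x - ?p))\<^sup>2 = 1 / c * (\<alpha> / 2 * (n (?p - x))\<^sup>2)"
    by (simp add: minus_commute)
  also have "\<dots> \<le> 1 / c * V ?p x"
    using assms by (intro mult_left_mono V_lower prox_step_in) auto
  finally have "s \<bullet> (x - ?p) \<le> c / (2 * \<alpha>) * (dual_norm n s)\<^sup>2 + 1 / c * V ?p x" by simp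
  with prox_step_three_point[OF assms, of s] show ?thesis
    by (simp add: inner_diff_right algebra_simps)
qed

text \<open>
  The joint effect of two noise vectors. For a norm that does not come from an inner product,
  independence of \<open>a\<close> and \<open>b\<close> does not make the second moment of \<open>a + b\<close> the sum of those of \<open>a\<close>
  and \<open>b\<close>. Absorbing \<open>a\<close> first and then \<open>b\<close> yields the sum of the two squares nevertheless, at the
  price of an inner product of \<open>b\<close> with a displacement that depends on \<open>a\<close> and \<open>x\<close> only.
\<close>

lemma two_noise_bound:
  assumes "c > 0" "x \<in> S" "x' \<in> S"
  shows "(a + b) \<bullet> (x - x') - 1 / c * V x' x
    \<le> c / (2 * \<alpha>) * ((dual_norm n a)\<^sup>2 + (dual_norm n b)\<^sup>2) + b \<bullet> (x - prox_step c a x)"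
proof -
  let ?p = "prox_step c a x"
  have "a \<bullet> (x - x') \<le> 1 / c * (V x' x - V x' ?p) + c / (2 * \<alpha>) * (dual_norm n a)\<^sup>2"
    by (rule prox_step_bound[OF assms])
  moreover have "b \<bullet> (?p - x') \<le> 1 / c * (V x' ?p - V x' (prox_step c b ?p)) + c / (2 * \<alpha>) * (dual_norm n b)\<^sup>2"
    by (rule prox_step_bound[OF assms(1) prox_step_in assms(3)])
  moreover have "0 \<le> 1 / c * V x' (prox_step c b ?p)"
    using assms by (intro mult_nonneg_nonneg V_nonneg prox_step_in) auto
  ultimately show ?thesis
    by (simp add: inner_diff_right inner_add_left algebra_simps)
qed

lemma one_noise_bound:
  assumes "c > 0" "x \<in> S" "x' \<in> S"
  shows "a \<bullet> (x - x') - 1 / c * V x' x \<le> c / (2 * \<alpha>) * (dual_norm n a)\<^sup>2"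
proof -
  have "dual_norm n 0 = 0"
    using dual_norm_least[of 0 0] by (simp add: order_antisym)
  with two_noise_bound[OF assms, of a 0] show ?thesis by simp
qed

end

text \<open>
  Summation by parts: the increments of the weights are nonnegative and multiply values below \<open>B\<close>.
\<close>

lemma weighted_telescope:
  fixes w v :: "nat \<Rightarrow> real"
  assumes "\<And>i. i \<ge> 1 \<Longrightarrow> w i \<le> w (i + 1)" "0 \<le> w 1" "\<And>i. i \<ge> 1 \<Longrightarrow> v i \<le> B" "t \<ge> 1"
  shows "(\<Sum>i=1..t. w i * (v i - v (i + 1))) \<le> w t * (B - v (t + 1))"
  using \<open>t \<ge> 1\<close>
proof (induction t rule: dec_induct)
  case base
  show ?case using assms(2) assms(3)[of 1] by (auto intro!: mult_left_mono)
next
  case (step t)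
  have "w t * (B - v (t + 1)) \<le> w (t + 1) * (B - v (t + 1))"
    using assms(1)[of t] assms(3)[of "t + 1"] step.hyps by (intro mult_right_mono) auto
  with step.IH show ?case
    using step.hyps by (simp add: algebra_simps)
qed

section \<open>The energy estimate along one run\<close>

lemma weighted_regret:
  fixes A c r v w :: "nat \<Rightarrow> real"
  assumes A: "\<And>i. i \<ge> 1 \<Longrightarrow> A i \<le> 1 / c i * (v i - v (i + 1)) + r i"
    and w: "\<And>i. i \<ge> 1 \<Longrightarrow> 0 < w i" "\<And>i. i \<ge> 1 \<Longrightarrow> 0 < c i"
      "\<And>i. i \<ge> 1 \<Longrightarrow> w i / c i \<le> w (i + 1) / c (i + 1)"
    and v: "\<And>i. i \<ge> 1 \<Longrightarrow> 0 \<le> v i" "\<And>i. i \<ge> 1 \<Longrightarrow> v i \<le> B" and t: "t \<ge> 1"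
  shows "(\<Sum>i=1..t. w i * A i) \<le> w t / c t * B + (\<Sum>i=1..t. w i * r i)"
proof -
  have "(\<Sum>i=1..t. w i * A i) \<le> (\<Sum>i=1..t. w i / c i * (v i - v (i + 1)) + w i * r i)"
  proof (rule sum_mono)
    fix i assume "i \<in> {1..t}"
    then have "w i * A i \<le> w i * (1 / c i * (v i - v (i + 1)) + r i)"
      using A[of i] w(1)[of i] by (intro mult_left_mono) auto
    then show "w i * A i \<le> w i / c i * (v i - v (i + 1)) + w i * r i"
      by (simp add: algebra_simps)
  qed
  moreover have "(\<Sum>i=1..t. w i / c i * (v i - v (i + 1))) \<le> w t / c t * (B - v (t + 1))"
    using w(1,2)[of 1] by (intro weighted_telescope w v t) auto
  moreover have "w t / c t * (B - v (t + 1)) \<le> w t / c t * B"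
    using w(1,2)[OF t] v(1)[of "t + 1"] by (intro mult_left_mono) auto
  ultimately show ?thesis by (simp add: sum.distrib)
qed

locale saddle_problem =
  X: mirror_setup nX X dX gX \<alpha>X VX \<Omega>X + Y: mirror_setup nY Y dY gY \<alpha>Y VY \<Omega>Y
  for nX :: "'a::euclidean_space \<Rightarrow> real" and X dX gX \<alpha>X VX \<Omega>X
    and nY :: "'b::euclidean_space \<Rightarrow> real" and Y dY gY \<alpha>Y VY \<Omega>Y +
  fixes G :: "'a \<Rightarrow> real" and gradG :: "'a \<Rightarrow> 'a" and L_G :: real
    and K :: "'a \<Rightarrow> 'b" and L_K :: real and J :: "'b \<Rightarrow> real"
    and \<beta> \<theta> \<eta> \<tau> \<gamma> :: "nat \<Rightarrow> real" and p q :: real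
    and x1 :: 'a and y1 :: 'b
  assumes G_convex: "convex_on X G" and G_gradient: "gradient_on X G gradG"
    and G_smooth: "\<And>u v. u \<in> X \<Longrightarrow> v \<in> X \<Longrightarrow> G v - G u - gradG u \<bullet> (v - u) \<le> L_G / 2 * (nX (v - u))\<^sup>2"
    and K_linear: "linear K" and K_bound: "\<And>u v. K u \<bullet> v \<le> L_K * nX u * nY v"
    and J_convex: "convex_on Y J" and J_lsc: "lsc_on Y J"
    and \<eta>_pos: "\<And>t. t \<ge> 1 \<Longrightarrow> \<eta> t > 0" and \<tau>_pos: "\<And>t. t \<ge> 1 \<Longrightarrow> \<tau> t > 0"
    and pq: "0 < p" "p < 1" "0 < q" "q < 1"
    and \<beta>: "\<beta> 1 = 1" "\<And>t. t \<ge> 1 \<Longrightarrow> \<beta> (t + 1) - 1 = \<beta> t * \<theta> (t + 1)"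
    and \<theta>: "\<And>t. t \<ge> 2 \<Longrightarrow> 0 < \<theta> t \<and> \<theta> t \<le> min (\<eta> (t - 1) / \<eta> t) (\<tau> (t - 1) / \<tau> t)"
    and steps: "\<And>t. t \<ge> 1 \<Longrightarrow> q * \<alpha>X / \<eta> t - L_G / \<beta> t - L_K\<^sup>2 * \<tau> t / (p * \<alpha>Y) \<ge> 0"
    and \<gamma>: "\<gamma> 1 = 1" "\<And>t. t \<ge> 2 \<Longrightarrow> \<gamma> t = inverse (\<theta> t) * \<gamma> (t - 1)"
    and init: "x1 \<in> X" "y1 \<in> Y"
begin

lemma \<beta>_ge_1: "t \<ge> 1 \<Longrightarrow> \<beta> t \<ge> 1"
proof (induction t rule: dec_induct)
  case (step t)
  with \<theta>[of "t + 1"] have "0 \<le> \<beta> t * \<theta> (t + 1)" by (intro mult_nonneg_nonneg) auto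
  with \<beta>(2)[of t] step.hyps show ?case by simp
qed (use \<beta>(1) in simp)

lemma \<gamma>_Suc: "t \<ge> 1 \<Longrightarrow> \<gamma> (t + 1) * \<theta> (t + 1) = \<gamma> t"
  using \<gamma>(2)[of "t + 1"] \<theta>[of "t + 1"] by simp

lemma \<gamma>_pos: "t \<ge> 1 \<Longrightarrow> \<gamma> t > 0"
proof (induction t rule: dec_induct)
  case (step t)
  then have "0 < \<gamma> (t + 1) * \<theta> (t + 1)" by (simp only: \<gamma>_Suc)
  with \<theta>[of "t + 1"] step.hyps show ?case by (simp add: zero_less_mult_iff)
qed (use \<gamma>(1) in simp)

text \<open>
  By the upper bound on \<open>\<theta>\<close>; the Bregman distances are going to be telescoped with these weights.
\<close>

lemma weights_mono:
  assumes "t \<ge> 1"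
  shows "\<gamma> t / \<eta> t \<le> \<gamma> (t + 1) / \<eta> (t + 1)" "\<gamma> t / \<tau> t \<le> \<gamma> (t + 1) / \<tau> (t + 1)"
proof -
  have *: "\<gamma> t / c t \<le> \<gamma> (t + 1) / c (t + 1)"
    if "c t > 0" "c (t + 1) > 0" "\<theta> (t + 1) \<le> c t / c (t + 1)" for c
  proof -
    have "\<gamma> t = \<gamma> (t + 1) * \<theta> (t + 1)" using \<gamma>_Suc[OF assms] by simp
    also have "\<dots> \<le> \<gamma> (t + 1) * (c t / c (t + 1))"
      using that \<gamma>_pos[of "t + 1"] by (intro mult_left_mono) auto
    finally show ?thesis using that by (simp add: field_simps)
  qed
  show "\<gamma> t / \<eta> t \<le> \<gamma> (t + 1) / \<eta> (t + 1)" "\<gamma> t / \<tau> t \<le> \<gamma> (t + 1) / \<tau> (t + 1)"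
    using assms \<theta>[of "t + 1"] by (simp_all del: One_nat_def Suc_eq_plus1 add: * \<eta>_pos \<tau>_pos)
qed

text \<open>
  Auxiliary sequences that play the prox method against the linear functionals given by the noise,
  so that the worst case over all comparison points costs no more than one additional Bregman
  diameter. They start at index 1; the value at index 0 is a default.
\<close>

primrec shadow_x :: "(nat \<Rightarrow> 'a) \<Rightarrow> (nat \<Rightarrow> 'a) \<Rightarrow> nat \<Rightarrow> 'a" where
  "shadow_x a b 0 = x1"
| "shadow_x a b (Suc i) = (if i = 0 then x1
     else X.prox_step (\<eta> i) (- b i) (X.prox_step (\<eta> i) (- a i) (shadow_x a b i)))"

primrec shadow_y :: "(nat \<Rightarrow> 'b) \<Rightarrow> nat \<Rightarrow> 'b" where
  "shadow_y e 0 = y1"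
| "shadow_y e (Suc i) = (if i = 0 then y1 else Y.prox_step (\<tau> i) (e i) (shadow_y e i))"

lemma shadow_x_in: "shadow_x a b i \<in> X"
  by (induction i) (auto simp: init X.prox_step_in)

lemma shadow_y_in: "shadow_y e i \<in> Y"
  by (induction i) (auto simp: init Y.prox_step_in)

lemma shadow_x_regret:
  assumes "u \<in> X" "t \<ge> 1"
  shows "(\<Sum>i=1..t. \<gamma> i * (a i \<bullet> (u - shadow_x a b i)
        + b i \<bullet> (u - X.prox_step (\<eta> i) (- a i) (shadow_x a b i))))
    \<le> \<gamma> t / \<eta> t * \<Omega>X\<^sup>2
      + (\<Sum>i=1..t. \<gamma> i * (\<eta> i / (2 * \<alpha>X) * ((dual_norm nX (a i))\<^sup>2 + (dual_norm nX (b i))\<^sup>2)))"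
proof (rule weighted_regret)
  fix i :: nat assume i: "i \<ge> 1"
  let ?v = "shadow_x a b i" and ?w = "X.prox_step (\<eta> i) (- a i) (shadow_x a b i)"
  have "- a i \<bullet> (?v - u) \<le> 1 / \<eta> i * (VX u ?v - VX u ?w) + \<eta> i / (2 * \<alpha>X) * (dual_norm nX (- a i))\<^sup>2"
    by (intro X.prox_step_bound \<eta>_pos shadow_x_in assms i)
  moreover have "- b i \<bullet> (?w - u) \<le> 1 / \<eta> i * (VX u ?w - VX u (X.prox_step (\<eta> i) (- b i) ?w))
      + \<eta> i / (2 * \<alpha>X) * (dual_norm nX (- b i))\<^sup>2"
    by (intro X.prox_step_bound \<eta>_pos X.prox_step_in assms i)
  moreover have "shadow_x a b (i + 1) = X.prox_step (\<eta> i) (- b i) ?w"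
    using i by simp
  ultimately show "a i \<bullet> (u - ?v) + b i \<bullet> (u - ?w)
    \<le> 1 / \<eta> i * (VX u ?v - VX u (shadow_x a b (i + 1)))
      + \<eta> i / (2 * \<alpha>X) * ((dual_norm nX (a i))\<^sup>2 + (dual_norm nX (b i))\<^sup>2)"
    by (simp del: shadow_x.simps add: inner_diff_right algebra_simps)
qed (intro \<gamma>_pos \<eta>_pos weights_mono X.V_nonneg X.V_le shadow_x_in assms; assumption)+

lemma shadow_y_regret:
  assumes "v \<in> Y" "t \<ge> 1"
  shows "(\<Sum>i=1..t. \<gamma> i * (e i \<bullet> (shadow_y e i - v)))
    \<le> \<gamma> t / \<tau> t * \<Omega>Y\<^sup>2 + (\<Sum>i=1..t. \<gamma> i * (\<tau> i / (2 * \<alpha>Y) * (dual_norm nY (e i))\<^sup>2))"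
proof (rule weighted_regret)
  fix i :: nat assume i: "i \<ge> 1"
  have "e i \<bullet> (shadow_y e i - v) \<le> 1 / \<tau> i *
      (VY v (shadow_y e i) - VY v (Y.prox_step (\<tau> i) (e i) (shadow_y e i))) + \<tau> i / (2 * \<alpha>Y) * (dual_norm nY (e i))\<^sup>2"
    by (intro Y.prox_step_bound \<tau>_pos shadow_y_in assms i)
  with i show "e i \<bullet> (shadow_y e i - v) \<le> 1 / \<tau> i *
      (VY v (shadow_y e i) - VY v (shadow_y e (i + 1))) + \<tau> i / (2 * \<alpha>Y) * (dual_norm nY (e i))\<^sup>2"
    by simp
qed (intro \<gamma>_pos \<tau>_pos weights_mono Y.V_nonneg Y.V_le shadow_y_in assms; assumption)+

end

locale apd_path = saddle_problem +
  fixes g :: "nat \<Rightarrow> 'a \<Rightarrow> 'a" and kx :: "nat \<Rightarrow> 'a \<Rightarrow> 'b" and ky :: "nat \<Rightarrow> 'b \<Rightarrow> 'a"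
    and x xmd xag xbar :: "nat \<Rightarrow> 'a" and y yag :: "nat \<Rightarrow> 'b"
  assumes run: "APD_run X Y J VX VY \<beta> \<theta> \<eta> \<tau> g kx ky x1 y1 x y xmd xag yag xbar"
begin

definition noise_G :: "nat \<Rightarrow> 'a" where "noise_G i = g i (xmd i) - gradG (xmd i)"
definition noise_Kx :: "nat \<Rightarrow> 'b" where "noise_Kx i = kx i (xbar i) - K (xbar i)"
definition noise_Ky :: "nat \<Rightarrow> 'a" where "noise_Ky i = ky i (y (i + 1)) - adjoint K (y (i + 1))"

lemma start: "x 1 = x1" "y 1 = y1" "xag 1 = x1" "yag 1 = y1" "xbar 1 = x1"
  using run by (simp_all add: APD_run_def)

lemma update:
  assumes "t \<ge> 1"
  shows "xmd t = (1 - 1 / \<beta> t) *\<^sub>R xag t + (1 / \<beta> t) *\<^sub>R x t"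
    "is_arg_min (\<lambda>v. - kx t (xbar t) \<bullet> v + J v + 1 / \<tau> t * VY v (y t)) (\<lambda>v. v \<in> Y) (y (t + 1))"
    "is_arg_min (\<lambda>u. g t (xmd t) \<bullet> u + u \<bullet> ky t (y (t + 1)) + 1 / \<eta> t * VX u (x t)) (\<lambda>u. u \<in> X) (x (t + 1))"
    "xag (t + 1) = (1 - 1 / \<beta> t) *\<^sub>R xag t + (1 / \<beta> t) *\<^sub>R x (t + 1)"
    "yag (t + 1) = (1 - 1 / \<beta> t) *\<^sub>R yag t + (1 / \<beta> t) *\<^sub>R y (t + 1)"
    "xbar (t + 1) = \<theta> (t + 1) *\<^sub>R (x (t + 1) - x t) + x (t + 1)"
  using run assms by (auto simp: APD_run_def)

lemma x_in: "t \<ge> 1 \<Longrightarrow> x t \<in> X"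
  by (induction t rule: dec_induct) (use start init update(3) in \<open>auto simp: is_arg_min_def\<close>)

lemma y_in: "t \<ge> 1 \<Longrightarrow> y t \<in> Y"
  by (induction t rule: dec_induct) (use start init update(2) in \<open>auto simp: is_arg_min_def\<close>)

lemma average_in:
  assumes "t \<ge> 1" "convex S" "z \<in> S" "z' \<in> S"
  shows "(1 - 1 / \<beta> t) *\<^sub>R z + (1 / \<beta> t) *\<^sub>R z' \<in> S"
  using assms \<beta>_ge_1[of t] by (intro convexD) auto

lemma xag_in: "t \<ge> 1 \<Longrightarrow> xag t \<in> X"
proof (induction t rule: dec_induct)
  case (step t)
  then show ?case using update(4)[of t] average_in[OF _ X.convex_S, of t] x_in[of "t + 1"] by simp
qed (simp add: start init del: One_nat_def)

lemma yag_in: "t \<ge> 1 \<Longrightarrow> yag t \<in> Y"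
proof (induction t rule: dec_induct)
  case (step t)
  then show ?case using update(5)[of t] average_in[OF _ Y.convex_S, of t] y_in[of "t + 1"] by simp
qed (simp add: start init del: One_nat_def)

lemma xmd_in: "t \<ge> 1 \<Longrightarrow> xmd t \<in> X"
  using update(1)[of t] average_in[OF _ X.convex_S, of t] x_in xag_in by simp

lemma xbar_in: "t \<ge> 1 \<Longrightarrow> xbar t \<in> extrapolated X \<theta>"
proof (cases "t = 1")
  case False
  assume "t \<ge> 1"
  with False have t: "t - 1 \<ge> 1" "t - 1 + 1 = t" by auto
  from update(6)[OF t(1)] x_in[OF t(1)] x_in[OF \<open>t \<ge> 1\<close>] t show ?thesis
    unfolding extrapolated_def by fastforce
qed (use start init in \<open>simp add: extrapolated_def\<close>)

text \<open>
  As in the accelerated gradient method: \<open>xag (t + 1) - xmd t\<close> is \<open>1 / \<beta> t\<close> times the move of \<open>x\<close>, so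
  after multiplication by \<open>\<beta> t\<close> the quadratic error still carries a factor \<open>1 / \<beta> t\<close>.
\<close>

lemma G_step:
  assumes t: "t \<ge> 1" and u: "u \<in> X"
  shows "\<beta> t * G (xag (t + 1)) \<le> (\<beta> t - 1) * G (xag t) + G u + gradG (xmd t) \<bullet> (x (t + 1) - u)
    + L_G / (2 * \<beta> t) * (nX (x (t + 1) - x t))\<^sup>2"
proof -
  have b: "\<beta> t \<ge> 1" using \<beta>_ge_1[OF t] .
  have diff: "xag (t + 1) - xmd t = (1 / \<beta> t) *\<^sub>R (x (t + 1) - x t)"
    unfolding update(1,4)[OF t] by (simp add: scaleR_diff_right)
  have "G (xag (t + 1)) \<le> G (xmd t) + gradG (xmd t) \<bullet> (xag (t + 1) - xmd t)
      + L_G / 2 * (nX (xag (t + 1) - xmd t))\<^sup>2"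
    using G_smooth[OF xmd_in[OF t] xag_in[of "t + 1"]] t by simp
  also have "L_G / 2 * (nX (xag (t + 1) - xmd t))\<^sup>2
      = 1 / \<beta> t * (L_G / (2 * \<beta> t) * (nX (x (t + 1) - x t))\<^sup>2)"
    unfolding diff X.scale using b by (simp add: power2_eq_square)
  finally have "\<beta> t * G (xag (t + 1)) \<le> \<beta> t * (G (xmd t) + gradG (xmd t) \<bullet> (xag (t + 1) - xmd t)
      + 1 / \<beta> t * (L_G / (2 * \<beta> t) * (nX (x (t + 1) - x t))\<^sup>2))"
    using b by (intro mult_left_mono) auto
  also have "\<dots> = \<beta> t * G (xmd t) + gradG (xmd t) \<bullet> (\<beta> t *\<^sub>R (xag (t + 1) - xmd t))
      + L_G / (2 * \<beta> t) * (nX (x (t + 1) - x t))\<^sup>2"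
    using b by (simp add: distrib_left)
  also have "\<beta> t *\<^sub>R (xag (t + 1) - xmd t) = (\<beta> t - 1) *\<^sub>R (xag t - xmd t) + (x (t + 1) - xmd t)"
  proof -
    have "\<beta> t * (1 - 1 / \<beta> t) = \<beta> t - 1" "\<beta> t * (1 / \<beta> t) = 1"
      using b by (simp_all add: field_simps)
    then have "\<beta> t *\<^sub>R xag (t + 1) = (\<beta> t - 1) *\<^sub>R xag t + x (t + 1)"
      unfolding update(4)[OF t] scaleR_add_right scaleR_scaleR by simp
    then show ?thesis by (simp add: algebra_simps)
  qed
  also have "\<beta> t * G (xmd t) + gradG (xmd t) \<bullet> ((\<beta> t - 1) *\<^sub>R (xag t - xmd t) + (x (t + 1) - xmd t))
    = (\<beta> t - 1) * (G (xmd t) + gradG (xmd t) \<bullet> (xag t - xmd t))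
      + (G (xmd t) + gradG (xmd t) \<bullet> (u - xmd t)) + gradG (xmd t) \<bullet> (x (t + 1) - u)"
    by (simp add: inner_add_right inner_diff_right algebra_simps)
  also have "(\<beta> t - 1) * (G (xmd t) + gradG (xmd t) \<bullet> (xag t - xmd t)) \<le> (\<beta> t - 1) * G (xag t)"
    using b t by (intro mult_left_mono gradient_on_convex_le[OF G_convex G_gradient] xag_in xmd_in) auto
  also have "G (xmd t) + gradG (xmd t) \<bullet> (u - xmd t) \<le> G u"
    by (intro gradient_on_convex_le[OF G_convex G_gradient] xmd_in u t)
  finally show ?thesis by simp
qed

lemma J_step:
  assumes t: "t \<ge> 1"
  shows "\<beta> t * J (yag (t + 1)) \<le> (\<beta> t - 1) * J (yag t) + J (y (t + 1))"
proof -
  have b: "\<beta> t \<ge> 1" using \<beta>_ge_1[OF t] .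
  have "J (yag (t + 1)) \<le> (1 - 1 / \<beta> t) * J (yag t) + 1 / \<beta> t * J (y (t + 1))"
    unfolding update(5)[OF t] using b t yag_in[of t] y_in[of "t + 1"]
    by (intro convex_onD[OF J_convex]) auto
  then have "\<beta> t * J (yag (t + 1)) \<le> \<beta> t * ((1 - 1 / \<beta> t) * J (yag t) + 1 / \<beta> t * J (y (t + 1)))"
    using b by (intro mult_left_mono) auto
  also have "\<dots> = (\<beta> t - 1) * J (yag t) + J (y (t + 1))"
    using b by (simp add: field_simps)
  finally show ?thesis .
qed

text \<open>The value 0 at index 0 makes the formula for \<open>xbar\<close> hold at the first step as well.\<close>

definition increment :: "nat \<Rightarrow> 'a" where
  "increment i = (if i = 0 then 0 else x (i + 1) - x i)"

lemma xbar_eq: "t \<ge> 1 \<Longrightarrow> xbar t = x t + \<theta> t *\<^sub>R increment (t - 1)"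
proof (cases "t = 1")
  case False
  assume "t \<ge> 1"
  with False have t: "t - 1 \<ge> 1" "t - 1 + 1 = t" "t - 1 \<noteq> 0" by auto
  from update(6)[OF t(1)] show ?thesis
    unfolding increment_def if_not_P[OF t(3)] t(2) by (simp only: add.commute)
qed (use start in \<open>simp add: increment_def\<close>)

text \<open>
  The prox steps measured against a comparison point: what remains of the bilinear terms is the
  extrapolation error, and the noise enters through its inner products with the new iterates.
\<close>

lemma Q_step:
  assumes t: "t \<ge> 1" and u: "u \<in> X" and v: "v \<in> Y"
  shows "\<beta> t * Q_gap G K J (xag (t + 1), yag (t + 1)) (u, v)
    \<le> (\<beta> t - 1) * Q_gap G K J (xag t, yag t) (u, v)
      + 1 / \<eta> t * (VX u (x t) - VX u (x (t + 1)) - VX (x (t + 1)) (x t))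
      + 1 / \<tau> t * (VY v (y t) - VY v (y (t + 1)) - VY (y (t + 1)) (y t))
      + L_G / (2 * \<beta> t) * (nX (increment t))\<^sup>2
      + K (x (t + 1) - xbar t) \<bullet> (v - y (t + 1))
      - (noise_G t + noise_Ky t) \<bullet> (x (t + 1) - u) + noise_Kx t \<bullet> (y (t + 1) - v)"
proof -
  have b: "\<beta> t \<ge> 1" using \<beta>_ge_1[OF t] .
  have Kdiff: "K (u - v) = K u - K v" for u v by (rule linear_diff[OF K_linear])
  have px: "(g t (xmd t) + ky t (y (t + 1))) \<bullet> (x (t + 1) - u) + 0 - 0
      \<le> 1 / \<eta> t * (VX u (x t) - VX u (x (t + 1)) - VX (x (t + 1)) (x t))"
  proof (rule X.three_point[where h = "\<lambda>_. 0"])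
    fix u assume "u \<in> X"
    with update(3)[OF t]
    have "g t (xmd t) \<bullet> x (t + 1) + x (t + 1) \<bullet> ky t (y (t + 1)) + 1 / \<eta> t * VX (x (t + 1)) (x t)
      \<le> g t (xmd t) \<bullet> u + u \<bullet> ky t (y (t + 1)) + 1 / \<eta> t * VX u (x t)"
      unfolding is_arg_min_def by (meson not_le)
    then show "(g t (xmd t) + ky t (y (t + 1))) \<bullet> x (t + 1) + 0 + 1 / \<eta> t * VX (x (t + 1)) (x t)
      \<le> (g t (xmd t) + ky t (y (t + 1))) \<bullet> u + 0 + 1 / \<eta> t * VX u (x t)"
      by (simp only: inner_add_left inner_commute[of _ "ky t (y (t + 1))"])
  qed (use t u x_in \<eta>_pos X.convex_S in \<open>auto simp: convex_on_const\<close>)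
  have py: "- kx t (xbar t) \<bullet> (y (t + 1) - v) + J (y (t + 1)) - J v
      \<le> 1 / \<tau> t * (VY v (y t) - VY v (y (t + 1)) - VY (y (t + 1)) (y t))"
  proof (rule Y.three_point[where h = J])
    fix v assume "v \<in> Y"
    with update(2)[OF t]
    show "- kx t (xbar t) \<bullet> y (t + 1) + J (y (t + 1)) + 1 / \<tau> t * VY (y (t + 1)) (y t)
      \<le> - kx t (xbar t) \<bullet> v + J v + 1 / \<tau> t * VY v (y t)"
      unfolding is_arg_min_def by (meson not_le)
  qed (use t v y_in \<tau>_pos J_convex in auto)
  have "K (xag (t + 1)) = (1 - 1 / \<beta> t) *\<^sub>R K (xag t) + (1 / \<beta> t) *\<^sub>R K (x (t + 1))"
    unfolding update(4)[OF t] by (simp only: linear_add[OF K_linear] linear_scale[OF K_linear])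
  then have Kx: "\<beta> t * (K (xag (t + 1)) \<bullet> v) = (\<beta> t - 1) * (K (xag t) \<bullet> v) + K (x (t + 1)) \<bullet> v"
    using b by (simp add: inner_add_left field_simps)
  have Ky: "\<beta> t * (K u \<bullet> yag (t + 1)) = (\<beta> t - 1) * (K u \<bullet> yag t) + K u \<bullet> y (t + 1)"
    unfolding update(5)[OF t] using b by (simp add: inner_add_right field_simps)
  have adj: "adjoint K (y (t + 1)) \<bullet> w = K w \<bullet> y (t + 1)" for w
    using adjoint_works[OF K_linear, of w "y (t + 1)"] by (simp add: inner_commute)
  have inc: "increment t = x (t + 1) - x t" using t by (simp add: increment_def)
  have "\<beta> t * Q_gap G K J (xag (t + 1), yag (t + 1)) (u, v)
      = \<beta> t * G (xag (t + 1)) + \<beta> t * (K (xag (t + 1)) \<bullet> v) - \<beta> t * J v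
        - \<beta> t * G u - \<beta> t * (K u \<bullet> yag (t + 1)) + \<beta> t * J (yag (t + 1))"
    by (simp add: Q_gap_def algebra_simps)
  also have "\<dots> \<le> ((\<beta> t - 1) * G (xag t) + G u + gradG (xmd t) \<bullet> (x (t + 1) - u)
        + L_G / (2 * \<beta> t) * (nX (x (t + 1) - x t))\<^sup>2)
      + ((\<beta> t - 1) * (K (xag t) \<bullet> v) + K (x (t + 1)) \<bullet> v) - \<beta> t * J v
      - \<beta> t * G u - ((\<beta> t - 1) * (K u \<bullet> yag t) + K u \<bullet> y (t + 1))
      + ((\<beta> t - 1) * J (yag t) + J (y (t + 1)))"
    using G_step[OF t u] J_step[OF t] Kx Ky by linarith
  also have "\<dots> = (\<beta> t - 1) * Q_gap G K J (xag t, yag t) (u, v)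
      + gradG (xmd t) \<bullet> (x (t + 1) - u) + L_G / (2 * \<beta> t) * (nX (increment t))\<^sup>2
      + K (x (t + 1)) \<bullet> v - K u \<bullet> y (t + 1) + J (y (t + 1)) - J v"
    by (simp add: Q_gap_def inc algebra_simps)
  also have "gradG (xmd t) \<bullet> (x (t + 1) - u)
      = (g t (xmd t) + ky t (y (t + 1))) \<bullet> (x (t + 1) - u)
        - (noise_G t + noise_Ky t) \<bullet> (x (t + 1) - u) - K (x (t + 1) - u) \<bullet> y (t + 1)"
    unfolding adj[symmetric] noise_G_def noise_Ky_def
    by (simp add: inner_add_left inner_diff_left)
  finally have *: "\<beta> t * Q_gap G K J (xag (t + 1), yag (t + 1)) (u, v)
      \<le> (\<beta> t - 1) * Q_gap G K J (xag t, yag t) (u, v)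
      + ((g t (xmd t) + ky t (y (t + 1))) \<bullet> (x (t + 1) - u)
        - (noise_G t + noise_Ky t) \<bullet> (x (t + 1) - u) - K (x (t + 1) - u) \<bullet> y (t + 1))
      + L_G / (2 * \<beta> t) * (nX (increment t))\<^sup>2
      + K (x (t + 1)) \<bullet> v - K u \<bullet> y (t + 1) + J (y (t + 1)) - J v" .
  have bil: "K (x (t + 1)) \<bullet> v - K u \<bullet> y (t + 1) - K (x (t + 1) - u) \<bullet> y (t + 1)
      = K (x (t + 1) - xbar t) \<bullet> (v - y (t + 1)) - kx t (xbar t) \<bullet> (y (t + 1) - v)
        + noise_Kx t \<bullet> (y (t + 1) - v)"
    unfolding noise_Kx_def Kdiff
    by (simp add: inner_diff_left inner_diff_right)
  from * px py bil show ?thesis by simp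
qed


definition noise_terms :: "'a \<Rightarrow> 'b \<Rightarrow> nat \<Rightarrow> real" where
  "noise_terms u v i = - (noise_G i + noise_Ky i) \<bullet> (x (i + 1) - u)
     - (1 - q) / \<eta> i * VX (x (i + 1)) (x i)
     + noise_Kx i \<bullet> (y (i + 1) - v) - (1 - p) / \<tau> i * VY (y (i + 1)) (y i)"

text \<open>
  The extrapolation makes the bilinear error telescope, up to the inner product of two consecutive
  increments. The latter is paid for by the fraction \<open>q\<close> of the previous Bregman distance in \<open>X\<close>
  and the fraction \<open>p\<close> of the current one in \<open>Y\<close>; the remaining fractions are kept for the noise.
\<close>

lemma energy_estimate:
  assumes u: "u \<in> X" and v: "v \<in> Y" and t: "t \<ge> 1"
  shows "\<beta> t * \<gamma> t * Q_gap G K J (xag (t + 1), yag (t + 1)) (u, v)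
    \<le> \<gamma> t / \<eta> t * \<Omega>X\<^sup>2 + \<gamma> t / \<tau> t * \<Omega>Y\<^sup>2 + (\<Sum>i=1..t. \<gamma> i * noise_terms u v i)"
proof -
  let ?Q = "\<lambda>i. Q_gap G K J (xag i, yag i) (u, v)"
  define T where "T i = \<gamma> i * (K (increment i) \<bullet> (v - y (i + 1)))" for i
  define E where "E i = (if i = 0 then 0 else L_K\<^sup>2 * \<gamma> i * \<tau> i / (2 * p * \<alpha>Y) * (nX (increment i))\<^sup>2)" for i
  define P where "P i = \<gamma> i / \<eta> i * (VX u (x i) - VX u (x (i + 1)))
     + \<gamma> i / \<tau> i * (VY v (y i) - VY v (y (i + 1))) + \<gamma> i * noise_terms u v i" for i
  have K0: "K 0 = 0" by (rule linear_0[OF K_linear])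
  have K_pay: "\<gamma> i * (K w \<bullet> z) \<le> L_K\<^sup>2 * \<gamma> i * \<tau> i / (2 * p * \<alpha>Y) * (nX w)\<^sup>2 + p * \<alpha>Y * \<gamma> i / (2 * \<tau> i) * (nY z)\<^sup>2"
    if "i \<ge> 1" for i w z
  proof -
    define c where "c = p * \<alpha>Y / \<tau> i"
    have c: "c > 0" using pq Y.\<alpha>_pos \<tau>_pos[OF that] by (simp add: c_def)
    have "0 \<le> (L_K * nX w - c * nY z)\<^sup>2 / (2 * c)" using c by simp
    also have "\<dots> = L_K\<^sup>2 / (2 * c) * (nX w)\<^sup>2 + c / 2 * (nY z)\<^sup>2 - L_K * nX w * nY z"
      using c by (simp add: field_simps power2_eq_square)
    finally have "K w \<bullet> z \<le> L_K\<^sup>2 / (2 * c) * (nX w)\<^sup>2 + c / 2 * (nY z)\<^sup>2"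
      using K_bound[of w z] by linarith
    then have "\<gamma> i * (K w \<bullet> z) \<le> \<gamma> i * (L_K\<^sup>2 / (2 * c) * (nX w)\<^sup>2 + c / 2 * (nY z)\<^sup>2)"
      using \<gamma>_pos[OF that] by (intro mult_left_mono) auto
    also have "\<dots> = L_K\<^sup>2 * \<gamma> i * \<tau> i / (2 * p * \<alpha>Y) * (nX w)\<^sup>2 + p * \<alpha>Y * \<gamma> i / (2 * \<tau> i) * (nY z)\<^sup>2"
      using pq Y.\<alpha>_pos \<tau>_pos[OF that] by (simp add: c_def field_simps)
    finally show ?thesis .
  qed
  have Y_pay: "p * \<alpha>Y * \<gamma> i / (2 * \<tau> i) * (nY (a - b))\<^sup>2 \<le> \<gamma> i / \<tau> i * (p * VY a b)"
    if "i \<ge> 1" "a \<in> Y" "b \<in> Y" for i a b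
  proof -
    have "\<gamma> i / \<tau> i * (p * (\<alpha>Y / 2 * (nY (a - b))\<^sup>2)) \<le> \<gamma> i / \<tau> i * (p * VY a b)"
      using that pq \<gamma>_pos[of i] \<tau>_pos[of i] by (intro mult_left_mono Y.V_lower) auto
    then show ?thesis by (simp add: algebra_simps)
  qed
  \<comment> \<open>the extrapolation scales the square of the earlier increment by the square of \<open>\<theta> i\<close>, which
    makes its weight at most the one in \<open>E (i - 1)\<close>\<close>
  have cross: "\<gamma> i * (K (\<theta> i *\<^sub>R increment (i - 1)) \<bullet> (y (i + 1) - y i))
      \<le> E (i - 1) + p * \<alpha>Y * \<gamma> i / (2 * \<tau> i) * (nY (y (i + 1) - y i))\<^sup>2" if i: "i \<ge> 1" for i
  proof (cases "i = 1")
    case True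
    then have "increment (i - 1) = 0" "E (i - 1) = 0" by (simp_all add: increment_def E_def)
    moreover have "0 \<le> p * \<alpha>Y * \<gamma> i / (2 * \<tau> i) * (nY (y (i + 1) - y i))\<^sup>2"
      using pq Y.\<alpha>_pos \<tau>_pos[OF i] \<gamma>_pos[OF i]
      by (intro mult_nonneg_nonneg divide_nonneg_nonneg) auto
    ultimately show ?thesis by (simp only: K0 scaleR_zero_right inner_zero_left mult_zero_right)
  next
    case False
    with i obtain j where j: "i = j + 1" "j \<ge> 1" using that[of "i - 1"] by simp
    have \<theta>_pos: "0 < \<theta> i" and \<theta>_le: "\<theta> i \<le> \<tau> j / \<tau> i"
      using \<theta>[of i] j by auto
    have "\<gamma> i * \<tau> i * (\<theta> i)\<^sup>2 = \<gamma> j * (\<tau> i * \<theta> i)"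
      using \<gamma>_Suc[OF j(2), folded j(1)] by (simp add: power2_eq_square)
    also have "\<dots> \<le> \<gamma> j * \<tau> j"
      using \<theta>_le \<tau>_pos[OF i] \<gamma>_pos[OF j(2)] by (intro mult_left_mono) (auto simp: field_simps)
    finally have le: "\<gamma> i * \<tau> i * (\<theta> i)\<^sup>2 \<le> \<gamma> j * \<tau> j" .
    have "L_K\<^sup>2 * \<gamma> i * \<tau> i / (2 * p * \<alpha>Y) * (nX (\<theta> i *\<^sub>R increment j))\<^sup>2
      = L_K\<^sup>2 * (nX (increment j))\<^sup>2 / (2 * p * \<alpha>Y) * (\<gamma> i * \<tau> i * (\<theta> i)\<^sup>2)"
      by (simp add: X.scale power_mult_distrib)
    also have "\<dots> \<le> L_K\<^sup>2 * (nX (increment j))\<^sup>2 / (2 * p * \<alpha>Y) * (\<gamma> j * \<tau> j)"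
      using pq Y.\<alpha>_pos by (intro mult_left_mono le) auto
    also have "\<dots> = E j" using j by (simp add: E_def)
    finally show ?thesis
      using K_pay[OF i, of "\<theta> i *\<^sub>R increment j" "y (i + 1) - y i"] j(1) by simp
  qed
  have one_step: "\<gamma> i * \<beta> i * ?Q (i + 1) \<le> \<gamma> i * (\<beta> i - 1) * ?Q i + P i + (T i - E i) - (T (i - 1) - E (i - 1))"
    if i: "i \<ge> 1" for i
  proof -
    have g: "\<gamma> i > 0" using \<gamma>_pos[OF i] .
    have inc: "increment i = x (i + 1) - x i" using i by (simp add: increment_def)
    have "\<gamma> i * (\<beta> i * ?Q (i + 1)) \<le> \<gamma> i * ((\<beta> i - 1) * ?Q i
      + 1 / \<eta> i * (VX u (x i) - VX u (x (i + 1)) - VX (x (i + 1)) (x i))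
      + 1 / \<tau> i * (VY v (y i) - VY v (y (i + 1)) - VY (y (i + 1)) (y i))
      + L_G / (2 * \<beta> i) * (nX (increment i))\<^sup>2
      + K (x (i + 1) - xbar i) \<bullet> (v - y (i + 1))
      - (noise_G i + noise_Ky i) \<bullet> (x (i + 1) - u) + noise_Kx i \<bullet> (y (i + 1) - v))"
      using g by (intro mult_left_mono Q_step i u v) simp
    also have "\<dots> = \<gamma> i * (\<beta> i - 1) * ?Q i + P i
      - q * (\<gamma> i / \<eta> i * VX (x (i + 1)) (x i)) - \<gamma> i / \<tau> i * (p * VY (y (i + 1)) (y i))
      + \<gamma> i * L_G / (2 * \<beta> i) * (nX (increment i))\<^sup>2
      + \<gamma> i * (K (x (i + 1) - xbar i) \<bullet> (v - y (i + 1)))"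
      unfolding P_def noise_terms_def
      by (simp add: algebra_simps diff_divide_distrib)
    also have "\<gamma> i * (K (x (i + 1) - xbar i) \<bullet> (v - y (i + 1)))
      = T i - T (i - 1) + \<gamma> i * (K (\<theta> i *\<^sub>R increment (i - 1)) \<bullet> (y (i + 1) - y i))"
    proof -
      have T_prev: "T (i - 1) = \<gamma> i * (\<theta> i * (K (increment (i - 1)) \<bullet> (v - y i)))"
      proof (cases "i = 1")
        case True
        then show ?thesis by (simp add: T_def increment_def K0)
      next
        case False
        with i have j: "i - 1 \<ge> 1" "i - 1 + 1 = i" by auto
        from \<gamma>_Suc[OF j(1)] show ?thesis
          unfolding T_def j(2) by (metis mult.assoc)
      qed
      have K_diff: "K (x (i + 1) - xbar i) = K (increment i) - \<theta> i *\<^sub>R K (increment (i - 1))"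
        unfolding xbar_eq[OF i] inc
        by (simp only: linear_diff[OF K_linear] linear_add[OF K_linear] linear_scale[OF K_linear] diff_diff_add)
      show ?thesis
        unfolding T_prev K_diff linear_scale[OF K_linear]
        by (simp add: T_def inner_diff_left inner_diff_right algebra_simps)
    qed
    also have "\<gamma> i * (K (\<theta> i *\<^sub>R increment (i - 1)) \<bullet> (y (i + 1) - y i))
      \<le> E (i - 1) + \<gamma> i / \<tau> i * (p * VY (y (i + 1)) (y i))"
      using cross[OF i] Y_pay[OF i y_in[of "i + 1"] y_in[OF i]] by simp
    also have "\<gamma> i * L_G / (2 * \<beta> i) * (nX (increment i))\<^sup>2 \<le> q * (\<gamma> i / \<eta> i * VX (x (i + 1)) (x i)) - E i"
    proof -
      have "(L_G / \<beta> i + L_K\<^sup>2 * \<tau> i / (p * \<alpha>Y)) * (\<gamma> i / 2 * (nX (increment i))\<^sup>2)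
          \<le> (q * \<alpha>X / \<eta> i) * (\<gamma> i / 2 * (nX (increment i))\<^sup>2)"
        using steps[OF i] g by (intro mult_right_mono) auto
      moreover have "q * (\<gamma> i / \<eta> i * (\<alpha>X / 2 * (nX (increment i))\<^sup>2)) \<le> q * (\<gamma> i / \<eta> i * VX (x (i + 1)) (x i))"
        unfolding inc using pq g \<eta>_pos[OF i] i by (intro mult_left_mono X.V_lower x_in) auto
      ultimately show ?thesis
        using i by (simp add: E_def algebra_simps)
    qed
    finally show ?thesis by (simp add: algebra_simps)
  qed
  have "\<gamma> t * \<beta> t * ?Q (t + 1) \<le> (\<Sum>i=1..t. P i) + (T t - E t)"
    using t
  proof (induction t rule: dec_induct)
    case base
    have "T 0 = 0" "E 0 = 0" by (simp_all add: T_def E_def increment_def K0)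
    with one_step[of 1] \<beta>(1) show ?case by simp
  next
    case (step t)
    have "\<gamma> (t + 1) * (\<beta> (t + 1) - 1) = \<gamma> t * \<beta> t"
      using \<beta>(2)[OF step.hyps(1)] \<gamma>_Suc[OF step.hyps(1)] by (metis mult.assoc mult.commute)
    with step.IH one_step[of "t + 1"] step.hyps show ?case by simp
  qed
  also have "T t - E t \<le> \<gamma> t / \<tau> t * VY v (y (t + 1))"
  proof -
    have "T t - E t \<le> p * \<alpha>Y * \<gamma> t / (2 * \<tau> t) * (nY (v - y (t + 1)))\<^sup>2"
      using K_pay[OF t, of "increment t" "v - y (t + 1)"] t by (simp add: T_def E_def)
    also have "\<dots> \<le> \<gamma> t / \<tau> t * (p * VY v (y (t + 1)))"
      using t by (intro Y_pay v y_in) auto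
    also have "\<dots> \<le> \<gamma> t / \<tau> t * VY v (y (t + 1))"
      using pq \<gamma>_pos[OF t] \<tau>_pos[OF t] Y.V_nonneg[OF v y_in[of "t + 1"]]
      by (intro mult_left_mono mult_left_le_one_le) auto
    finally show ?thesis .
  qed
  also have "(\<Sum>i=1..t. P i) \<le> \<gamma> t / \<eta> t * (\<Omega>X\<^sup>2 - VX u (x (t + 1)))
      + \<gamma> t / \<tau> t * (\<Omega>Y\<^sup>2 - VY v (y (t + 1))) + (\<Sum>i=1..t. \<gamma> i * noise_terms u v i)"
    unfolding P_def sum.distrib
    using \<gamma>_pos[of 1] \<eta>_pos[of 1] \<tau>_pos[of 1]
    by (intro add_mono order.refl weighted_telescope weights_mono X.V_le Y.V_le u v x_in y_in t) auto
  finally have "\<gamma> t * \<beta> t * ?Q (t + 1) \<le> \<gamma> t / \<eta> t * \<Omega>X\<^sup>2 + \<gamma> t / \<tau> t * \<Omega>Y\<^sup>2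
      + (\<Sum>i=1..t. \<gamma> i * noise_terms u v i) - \<gamma> t / \<eta> t * VX u (x (t + 1))"
    by (simp add: algebra_simps)
  moreover have "0 \<le> \<gamma> t / \<eta> t * VX u (x (t + 1))"
    using \<gamma>_pos[OF t] \<eta>_pos[OF t] X.V_nonneg[OF u x_in[of "t + 1"]] by auto
  ultimately show ?thesis by (simp add: mult.commute[of "\<beta> t"])
qed

text \<open>
  The directions against which the three noise vectors are tested. Each of them is determined
  before the corresponding oracle is called, and is a difference of two points of \<open>X\<close> or of \<open>Y\<close>.
\<close>

definition dir_G :: "nat \<Rightarrow> 'a" where
  "dir_G i = shadow_x noise_G noise_Ky i - x i"

definition dir_Ky :: "nat \<Rightarrow> 'a" where
  "dir_Ky i = X.prox_step (\<eta> i) (- noise_G i) (shadow_x noise_G noise_Ky i)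
     - X.prox_step (\<eta> i / (1 - q)) (noise_G i) (x i)"

definition dir_Kx :: "nat \<Rightarrow> 'b" where
  "dir_Kx i = y i - shadow_y noise_Kx i"

text \<open>
  The squares absorb the part of the noise that moves the new iterates, and the terms in \<open>u\<close> and \<open>v\<close>
  are left to the shadow sequences. In the inner products with \<open>noise_Ky i\<close> the point \<open>x i\<close> cancels,
  which leaves \<open>dir_Ky\<close> as a difference of two points of \<open>X\<close>.
\<close>

lemma noise_terms_le:
  assumes u: "u \<in> X" and v: "v \<in> Y" and i: "i \<ge> 1"
  shows "noise_terms u v i
    \<le> \<eta> i / (2 * (1 - q) * \<alpha>X) * ((dual_norm nX (noise_G i))\<^sup>2 + (dual_norm nX (noise_Ky i))\<^sup>2)
      + \<tau> i / (2 * (1 - p) * \<alpha>Y) * (dual_norm nY (noise_Kx i))\<^sup>2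
      + (noise_G i \<bullet> dir_G i + noise_Ky i \<bullet> dir_Ky i + noise_Kx i \<bullet> dir_Kx i)
      + (noise_G i \<bullet> (u - shadow_x noise_G noise_Ky i)
         + noise_Ky i \<bullet> (u - X.prox_step (\<eta> i) (- noise_G i) (shadow_x noise_G noise_Ky i)))
      + noise_Kx i \<bullet> (shadow_y noise_Kx i - v)"
proof -
  have "(noise_G i + noise_Ky i) \<bullet> (x i - x (i + 1)) - 1 / (\<eta> i / (1 - q)) * VX (x (i + 1)) (x i)
    \<le> \<eta> i / (1 - q) / (2 * \<alpha>X) * ((dual_norm nX (noise_G i))\<^sup>2 + (dual_norm nX (noise_Ky i))\<^sup>2)
      + noise_Ky i \<bullet> (x i - X.prox_step (\<eta> i / (1 - q)) (noise_G i) (x i))"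
    using i pq \<eta>_pos[OF i] by (intro X.two_noise_bound x_in) auto
  moreover have "- noise_Kx i \<bullet> (y i - y (i + 1)) - 1 / (\<tau> i / (1 - p)) * VY (y (i + 1)) (y i)
    \<le> \<tau> i / (1 - p) / (2 * \<alpha>Y) * (dual_norm nY (- noise_Kx i))\<^sup>2"
    using i pq \<tau>_pos[OF i] by (intro Y.one_noise_bound y_in) auto
  ultimately show ?thesis
    unfolding noise_terms_def dir_G_def dir_Ky_def dir_Kx_def
    by (simp add: inner_diff_right inner_diff_left inner_add_left mult_ac)
qed

definition noise_square :: "nat \<Rightarrow> real" where
  "noise_square i =
     (2 - q) * \<eta> i * \<gamma> i / ((1 - q) * \<alpha>X) * ((dual_norm nX (noise_G i))\<^sup>2 + (dual_norm nX (noise_Ky i))\<^sup>2)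
     + (2 - p) * \<tau> i * \<gamma> i / ((1 - p) * \<alpha>Y) * (dual_norm nY (noise_Kx i))\<^sup>2"

definition noise_linear :: "nat \<Rightarrow> real" where
  "noise_linear i = \<gamma> i * (noise_G i \<bullet> dir_G i) + \<gamma> i * (noise_Ky i \<bullet> dir_Ky i) + \<gamma> i * (noise_Kx i \<bullet> dir_Kx i)"

text \<open>
  The comparison points have been traded for a second Bregman diameter, so the bound is uniform in
  them; what is left of the noise are its squares and its inner products with the directions above.
\<close>

lemma gap_le:
  assumes t: "t \<ge> 1"
  shows "gap X Y G K J (xag (t + 1), yag (t + 1))
    \<le> ereal (1 / (\<beta> t * \<gamma> t) * (2 * \<gamma> t / \<eta> t * \<Omega>X\<^sup>2 + 2 * \<gamma> t / \<tau> t * \<Omega>Y\<^sup>2)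
        + 1 / (2 * \<beta> t * \<gamma> t) * (\<Sum>i=1..t. noise_square i) + 1 / (\<beta> t * \<gamma> t) * (\<Sum>i=1..t. noise_linear i))"
    (is "_ \<le> ereal ?R")
  unfolding gap_def
proof (intro SUP_least, clarify)
  fix u v assume u: "u \<in> X" and v: "v \<in> Y"
  let ?a = "\<lambda>i. (dual_norm nX (noise_G i))\<^sup>2 + (dual_norm nX (noise_Ky i))\<^sup>2"
  let ?e = "\<lambda>i. (dual_norm nY (noise_Kx i))\<^sup>2"
  let ?m = "\<lambda>i. \<eta> i * \<gamma> i / (2 * (1 - q) * \<alpha>X) * ?a i + \<tau> i * \<gamma> i / (2 * (1 - p) * \<alpha>Y) * ?e i + noise_linear i"
  let ?rx = "\<lambda>i. \<gamma> i * (noise_G i \<bullet> (u - shadow_x noise_G noise_Ky i)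
         + noise_Ky i \<bullet> (u - X.prox_step (\<eta> i) (- noise_G i) (shadow_x noise_G noise_Ky i)))"
  let ?ry = "\<lambda>i. \<gamma> i * (noise_Kx i \<bullet> (shadow_y noise_Kx i - v))"
  have pos: "\<beta> t * \<gamma> t > 0" using \<beta>_ge_1[OF t] \<gamma>_pos[OF t] by simp
  have "(\<Sum>i=1..t. \<gamma> i * noise_terms u v i)
    \<le> (\<Sum>i=1..t. ?m i
         + ?rx i + ?ry i)"
  proof (rule sum_mono)
    fix i assume "i \<in> {1..t}"
    then have i: "i \<ge> 1" by simp
    from mult_left_mono[OF noise_terms_le[OF u v i] less_imp_le[OF \<gamma>_pos[OF i]]]
    show "\<gamma> i * noise_terms u v i \<le> (\<eta> i * \<gamma> i / (2 * (1 - q) * \<alpha>X) * ?a i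
        + \<tau> i * \<gamma> i / (2 * (1 - p) * \<alpha>Y) * ?e i + noise_linear i) + ?rx i + ?ry i"
      unfolding noise_linear_def by (simp only: distrib_left) (simp add: mult_ac)
  qed
  also have "\<dots> = (\<Sum>i=1..t. ?m i) + (\<Sum>i=1..t. ?rx i) + (\<Sum>i=1..t. ?ry i)"
    by (simp only: sum.distrib)
  also have "(\<Sum>i=1..t. ?rx i) \<le> \<gamma> t / \<eta> t * \<Omega>X\<^sup>2 + (\<Sum>i=1..t. \<gamma> i * (\<eta> i / (2 * \<alpha>X) * ?a i))"
    by (rule shadow_x_regret[OF u t])
  also have "(\<Sum>i=1..t. ?ry i) \<le> \<gamma> t / \<tau> t * \<Omega>Y\<^sup>2 + (\<Sum>i=1..t. \<gamma> i * (\<tau> i / (2 * \<alpha>Y) * ?e i))"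
    by (rule shadow_y_regret[OF v t])
  finally have "(\<Sum>i=1..t. \<gamma> i * noise_terms u v i) \<le> \<gamma> t / \<eta> t * \<Omega>X\<^sup>2 + \<gamma> t / \<tau> t * \<Omega>Y\<^sup>2
     + (\<Sum>i=1..t. ?m i
        + \<gamma> i * (\<eta> i / (2 * \<alpha>X) * ?a i) + \<gamma> i * (\<tau> i / (2 * \<alpha>Y) * ?e i))"
    by (simp only: sum.distrib) linarith
  also have "(\<Sum>i=1..t. ?m i
        + \<gamma> i * (\<eta> i / (2 * \<alpha>X) * ?a i) + \<gamma> i * (\<tau> i / (2 * \<alpha>Y) * ?e i))
      = (\<Sum>i=1..t. noise_square i / 2 + noise_linear i)"
  proof (rule sum.cong)
    fix i
    have coeff: "c * d / (2 * (1 - r) * a) + d * (c / (2 * a)) = ((2 - r) * c * d / ((1 - r) * a)) / 2"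
      if "r < 1" "a > 0" for c d r a :: real
      using that by (simp add: divide_simps) (simp add: algebra_simps)
    show "?m i
        + \<gamma> i * (\<eta> i / (2 * \<alpha>X) * ?a i) + \<gamma> i * (\<tau> i / (2 * \<alpha>Y) * ?e i) = noise_square i / 2 + noise_linear i"
      using arg_cong[OF coeff[OF pq(4) X.\<alpha>_pos, of "\<eta> i" "\<gamma> i"], of "\<lambda>c. c * ?a i"]
        arg_cong[OF coeff[OF pq(2) Y.\<alpha>_pos, of "\<tau> i" "\<gamma> i"], of "\<lambda>c. c * ?e i"]
      unfolding noise_square_def distrib_right mult.assoc add_divide_distrib times_divide_eq_left
      by linarith
  qed simp
  also have "\<dots> = (\<Sum>i=1..t. noise_square i) / 2 + (\<Sum>i=1..t. noise_linear i)"
    by (simp add: sum.distrib sum_divide_distrib)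
  finally have "\<beta> t * \<gamma> t * Q_gap G K J (xag (t + 1), yag (t + 1)) (u, v)
      \<le> 2 * \<gamma> t / \<eta> t * \<Omega>X\<^sup>2 + 2 * \<gamma> t / \<tau> t * \<Omega>Y\<^sup>2
        + (\<Sum>i=1..t. noise_square i) / 2 + (\<Sum>i=1..t. noise_linear i)"
    using energy_estimate[OF u v t] by simp
  then have "Q_gap G K J (xag (t + 1), yag (t + 1)) (u, v)
      \<le> (2 * \<gamma> t / \<eta> t * \<Omega>X\<^sup>2 + 2 * \<gamma> t / \<tau> t * \<Omega>Y\<^sup>2
        + (\<Sum>i=1..t. noise_square i) / 2 + (\<Sum>i=1..t. noise_linear i)) / (\<beta> t * \<gamma> t)"
    using pos by (simp only: pos_le_divide_eq mult.commute)
  also have "\<dots> = ?R"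
    by (simp add: add_divide_distrib)
  finally show "ereal (Q_gap G K J (xag (t + 1), yag (t + 1)) (u, v)) \<le> ereal ?R" by simp
qed

lemma gap_nonneg:
  assumes "t \<ge> 1"
  shows "gap X Y G K J (xag (t + 1), yag (t + 1)) \<ge> 0"
proof -
  have "ereal (Q_gap G K J (xag (t + 1), yag (t + 1)) (xag (t + 1), yag (t + 1)))
      \<le> gap X Y G K J (xag (t + 1), yag (t + 1))"
    unfolding gap_def using assms xag_in[of "t + 1"] yag_in[of "t + 1"]
    by (intro SUP_upper) auto
  then show ?thesis by (simp add: Q_gap_def zero_ereal_def)
qed

end

section \<open>Concentration for noise that is fresh given the past\<close>

text \<open>
  The constant \<open>9/16\<close> is what makes the two regimes of \<open>nn_integral_exp_centred_le\<close> meet. The two sides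
  differ by little between \<open>0\<close> and \<open>1\<close>, so Taylor polynomials of fairly high degree are compared.
\<close>

lemma exp_le_linear_plus_gaussian: "exp x \<le> x + exp (9 / 16 * x\<^sup>2)" for x :: real
proof -
  consider "x \<le> 0" | "0 < x" "x < 16 / 9" | "x \<ge> 16 / 9" by linarith
  then show ?thesis
  proof cases
    case 1
    then obtain t where "\<bar>t\<bar> \<le> \<bar>x\<bar>" "exp x = (\<Sum>m<3. x ^ m / fact m) + exp t / fact 3 * x ^ 3"
      using Maclaurin_exp_le[of x 3] by blast
    moreover have "exp t / fact 3 * x ^ 3 \<le> 0"
      using 1 by (intro mult_nonneg_nonpos) (auto simp: power_le_zero_eq)
    ultimately have "exp x \<le> 1 + x + x\<^sup>2 / 2"
      by (simp add: numeral_eq_Suc)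
    moreover have "1 + 9 / 16 * x\<^sup>2 \<le> exp (9 / 16 * x\<^sup>2)"
      by (rule exp_ge_add_one_self)
    ultimately show ?thesis using zero_le_power2[of x] by linarith
  next
    case 2
    obtain t where t: "\<bar>t\<bar> \<le> \<bar>x\<bar>" "exp x = (\<Sum>m<7. x ^ m / fact m) + exp t / fact 7 * x ^ 7"
      using Maclaurin_exp_le[of x 7] by blast
    have "exp t \<le> exp (2 * 1)" using t(1) 2 by (subst exp_le_cancel_iff) linarith
    also have "\<dots> = (exp 1)\<^sup>2" by (rule exp_double)
    also have "\<dots> \<le> 3\<^sup>2" by (intro power_mono exp_le) simp
    finally have "exp t / fact 7 * x ^ 7 \<le> 9 / fact 7 * x ^ 7"
      using 2 by (intro mult_right_mono divide_right_mono) auto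
    also have "\<dots> \<le> 9 / fact 7 * (16 / 9 * x ^ 6)"
      using 2 by (intro mult_left_mono) (auto simp: power_Suc[of x 6, simplified] mult_right_mono)
    finally have upper: "exp x \<le> 1 + x + x\<^sup>2 / 2 + x ^ 3 / 6 + x ^ 4 / 24 + x ^ 5 / 120 + x ^ 6 / 720 + x ^ 6 / 315"
      unfolding t(2) by (simp add: lessThan_nat_numeral fact_numeral)
    define y where "y = 9 / 16 * x\<^sup>2"
    obtain t' where t': "exp y = (\<Sum>m<4. y ^ m / fact m) + exp t' / fact 4 * y ^ 4"
      using Maclaurin_exp_le[of y 4] by blast
    have "0 \<le> exp t' / fact 4 * y ^ 4" by simp
    then have lower: "1 + y + y\<^sup>2 / 2 + y ^ 3 / 6 \<le> exp y"
      unfolding t' by (simp add: lessThan_nat_numeral fact_numeral)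
    \<comment> \<open>a sum of squares below the difference of the two Taylor polynomials\<close>
    have "0 \<le> x\<^sup>2 * (1 / 4 - x / 3)\<^sup>2 + x ^ 4 * (x / 8 - 1 / 30)\<^sup>2" by simp
    also have "\<dots> = x\<^sup>2 / 16 - x ^ 3 / 6 + 101 / 900 * x ^ 4 - x ^ 5 / 120 + x ^ 6 / 64"
      by (simp add: power2_eq_square power3_eq_cube power4_eq_xxxx eval_nat_numeral field_simps)
    finally have sos: "0 \<le> x\<^sup>2 / 16 - x ^ 3 / 6 + 101 / 900 * x ^ 4 - x ^ 5 / 120 + x ^ 6 / 64" .
    have "0 \<le> x ^ 4" "0 \<le> x ^ 6" by simp_all
    with sos have "1 + x + x\<^sup>2 / 2 + x ^ 3 / 6 + x ^ 4 / 24 + x ^ 5 / 120 + x ^ 6 / 720 + x ^ 6 / 315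
        \<le> x + (1 + 9 / 16 * x\<^sup>2 + 81 / 512 * x ^ 4 + 243 / 8192 * x ^ 6)"
      by linarith
    moreover have "81 / 512 * x ^ 4 = y\<^sup>2 / 2" "243 / 8192 * x ^ 6 = y ^ 3 / 6"
      by (simp_all add: y_def power_mult_distrib power_mult[symmetric] power_divide)
    ultimately show ?thesis using upper lower unfolding y_def by linarith
  next
    case 3
    then have "x * 1 \<le> x * (9 / 16 * x)" by (intro mult_left_mono) auto
    then have "exp x \<le> exp (9 / 16 * x\<^sup>2)" by (simp add: power2_eq_square)
    with 3 show ?thesis by linarith
  qed
qed

text \<open>
  The samples \<open>\<zeta> i\<close> of one oracle, and for each \<open>i\<close> the \<sigma>-algebra \<open>F i\<close> of the events that precede
  the call.
\<close>

locale fresh_samples = prob_space M for M :: "'w measure" +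
  fixes F :: "nat \<Rightarrow> 'w measure" and D :: "'s measure" and \<zeta> :: "nat \<Rightarrow> 'w \<Rightarrow> 's"
  assumes space_F: "\<And>i. space (F i) = space M" and sets_F: "\<And>i. sets (F i) \<subseteq> sets M"
    and F_mono: "\<And>i j. i \<le> j \<Longrightarrow> sets (F i) \<subseteq> sets (F j)"
    and sample_measurable: "\<And>i. i \<ge> 1 \<Longrightarrow> \<zeta> i \<in> F (i + 1) \<rightarrow>\<^sub>M D"
    and sample_distr: "\<And>i. i \<ge> 1 \<Longrightarrow> distr M D (\<zeta> i) = D"
    and sample_indep: "\<And>i A B. i \<ge> 1 \<Longrightarrow> A \<in> sets (F i) \<Longrightarrow> B \<in> sets D \<Longrightarrow>
      prob (A \<inter> (\<zeta> i -` B \<inter> space M)) = prob A * prob (\<zeta> i -` B \<inter> space M)"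
begin

lemma F_measurable_M: "f \<in> F i \<rightarrow>\<^sub>M N \<Longrightarrow> f \<in> M \<rightarrow>\<^sub>M N"
  using sets_F[of i] by (auto simp: measurable_def space_F)

lemma F_measurable_mono: "f \<in> F i \<rightarrow>\<^sub>M N \<Longrightarrow> i \<le> j \<Longrightarrow> f \<in> F j \<rightarrow>\<^sub>M N"
  using F_mono[of i j] by (auto simp: measurable_def space_F)

lemma sample_measurable_M: "i \<ge> 1 \<Longrightarrow> \<zeta> i \<in> M \<rightarrow>\<^sub>M D"
  using F_measurable_M[OF sample_measurable] .

lemma prob_space_D: "i \<ge> 1 \<Longrightarrow> prob_space D" for i :: nat
  using prob_space_distr[OF sample_measurable_M, of i] sample_distr[of i] by simp

lemma id_measurable: "(\<lambda>\<omega>. \<omega>) \<in> M \<rightarrow>\<^sub>M F i"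
proof (rule measurableI)
  fix A assume "A \<in> sets (F i)"
  then have "A \<in> sets M" using sets_F by blast
  then show "(\<lambda>\<omega>. \<omega>) -` A \<inter> space M \<in> sets M" by simp
qed (simp add: space_F)

text \<open>
  Independence as a product measure. The past enters through the identity map into the smaller
  \<open>\<sigma>\<close>-algebra, so that every quantity known before the call can be treated as a constant at once.
\<close>

lemma distr_pair:
  assumes i: "i \<ge> 1"
  shows "distr M (F i \<Otimes>\<^sub>M D) (\<lambda>\<omega>. (\<omega>, \<zeta> i \<omega>)) = distr M (F i) (\<lambda>\<omega>. \<omega>) \<Otimes>\<^sub>M D"
proof (rule pair_measure_eqI[symmetric])
  have meas [measurable]: "(\<lambda>\<omega>. \<omega>) \<in> M \<rightarrow>\<^sub>M F i" "\<zeta> i \<in> M \<rightarrow>\<^sub>M D"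
    using id_measurable sample_measurable_M[OF i] by auto
  interpret D: prob_space D using prob_space_D[OF i] .
  interpret F: prob_space "distr M (F i) (\<lambda>\<omega>. \<omega>)" by (rule prob_space_distr[OF id_measurable])
  show "sigma_finite_measure (distr M (F i) (\<lambda>\<omega>. \<omega>))" "sigma_finite_measure D"
    by unfold_locales
  show "sets (distr M (F i) (\<lambda>\<omega>. \<omega>) \<Otimes>\<^sub>M D) = sets (distr M (F i \<Otimes>\<^sub>M D) (\<lambda>\<omega>. (\<omega>, \<zeta> i \<omega>)))"
    by (simp cong: sets_pair_measure_cong)
  fix A B assume "A \<in> sets (distr M (F i) (\<lambda>\<omega>. \<omega>))" and B: "B \<in> sets D"
  then have A: "A \<in> sets (F i)" by simp
  then have "A \<in> sets M" using sets_F by blast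
  then have [simp]: "A \<inter> space M = A" by auto
  have "emeasure (distr M (F i \<Otimes>\<^sub>M D) (\<lambda>\<omega>. (\<omega>, \<zeta> i \<omega>))) (A \<times> B)
      = emeasure M ((\<lambda>\<omega>. (\<omega>, \<zeta> i \<omega>)) -` (A \<times> B) \<inter> space M)"
    using A B by (intro emeasure_distr) auto
  also have "(\<lambda>\<omega>. (\<omega>, \<zeta> i \<omega>)) -` (A \<times> B) \<inter> space M = A \<inter> (\<zeta> i -` B \<inter> space M)"
    using \<open>A \<inter> space M = A\<close> by auto
  also have "emeasure M \<dots> = emeasure M A * emeasure M (\<zeta> i -` B \<inter> space M)"
    using sample_indep[OF i A B] by (simp add: emeasure_eq_measure ennreal_mult)
  also have "emeasure M A = emeasure (distr M (F i) (\<lambda>\<omega>. \<omega>)) A"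
    using A by (simp add: emeasure_distr)
  also have "emeasure M (\<zeta> i -` B \<inter> space M) = emeasure (distr M D (\<zeta> i)) B"
    using B by (simp add: emeasure_distr)
  finally show "emeasure (distr M (F i) (\<lambda>\<omega>. \<omega>)) A * emeasure D B
      = emeasure (distr M (F i \<Otimes>\<^sub>M D) (\<lambda>\<omega>. (\<omega>, \<zeta> i \<omega>))) (A \<times> B)"
    by (simp add: sample_distr[OF i])
qed

text \<open>Integrating out the fresh sample with the past held fixed.\<close>

lemma nn_integral_sample:
  assumes i: "i \<ge> 1" and f: "(\<lambda>(\<omega>, s). f \<omega> s) \<in> borel_measurable (F i \<Otimes>\<^sub>M D)"
  shows "(\<integral>\<^sup>+ \<omega>. f \<omega> (\<zeta> i \<omega>) \<partial>M) = (\<integral>\<^sup>+ \<omega>. (\<integral>\<^sup>+ s. f \<omega> s \<partial>D) \<partial>M)"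
proof -
  interpret D: prob_space D using prob_space_D[OF i] .
  have pair: "(\<lambda>\<omega>. (\<omega>, \<zeta> i \<omega>)) \<in> M \<rightarrow>\<^sub>M F i \<Otimes>\<^sub>M D"
    using id_measurable sample_measurable_M[OF i] by measurable
  have f': "(\<lambda>(\<omega>, s). f \<omega> s) \<in> borel_measurable (distr M (F i) (\<lambda>\<omega>. \<omega>) \<Otimes>\<^sub>M D)"
    using f by (simp cong: measurable_cong_sets sets_pair_measure_cong)
  have "(\<integral>\<^sup>+ \<omega>. f \<omega> (\<zeta> i \<omega>) \<partial>M) = (\<integral>\<^sup>+ z. (case z of (\<omega>, s) \<Rightarrow> f \<omega> s) \<partial>distr M (F i \<Otimes>\<^sub>M D) (\<lambda>\<omega>. (\<omega>, \<zeta> i \<omega>)))"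
    by (subst nn_integral_distr) (use f in \<open>simp_all only: measurable_distr_eq1 pair split\<close>)
  also have "\<dots> = (\<integral>\<^sup>+ \<omega>. (\<integral>\<^sup>+ s. f \<omega> s \<partial>D) \<partial>distr M (F i) (\<lambda>\<omega>. \<omega>))"
    unfolding distr_pair[OF i] by (subst D.nn_integral_fst[OF f', symmetric]) simp
  also have "\<dots> = (\<integral>\<^sup>+ \<omega>. (\<integral>\<^sup>+ s. f \<omega> s \<partial>D) \<partial>M)"
    by (intro nn_integral_distr id_measurable D.borel_measurable_nn_integral[OF f'])
  finally show ?thesis .
qed

lemma integral_sample:
  fixes f :: "'w \<Rightarrow> 's \<Rightarrow> real"
  assumes i: "i \<ge> 1" and f: "(\<lambda>(\<omega>, s). f \<omega> s) \<in> borel_measurable (F i \<Otimes>\<^sub>M D)"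
    and int: "integrable M (\<lambda>\<omega>. f \<omega> (\<zeta> i \<omega>))"
  shows "(LINT \<omega>|M. f \<omega> (\<zeta> i \<omega>)) = (LINT \<omega>|M. (LINT s|D. f \<omega> s))"
proof -
  interpret D: prob_space D using prob_space_D[OF i] .
  interpret F: prob_space "distr M (F i) (\<lambda>\<omega>. \<omega>)" by (rule prob_space_distr[OF id_measurable])
  interpret P: pair_sigma_finite "distr M (F i) (\<lambda>\<omega>. \<omega>)" D ..
  have pair: "(\<lambda>\<omega>. (\<omega>, \<zeta> i \<omega>)) \<in> M \<rightarrow>\<^sub>M F i \<Otimes>\<^sub>M D"
    using id_measurable sample_measurable_M[OF i] by measurable
  have f': "(\<lambda>(\<omega>, s). f \<omega> s) \<in> borel_measurable (distr M (F i) (\<lambda>\<omega>. \<omega>) \<Otimes>\<^sub>M D)"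
    using f by (simp cong: measurable_cong_sets sets_pair_measure_cong)
  have "integrable (distr M (F i \<Otimes>\<^sub>M D) (\<lambda>\<omega>. (\<omega>, \<zeta> i \<omega>))) (\<lambda>(\<omega>, s). f \<omega> s)"
    by (subst integrable_distr_eq[OF pair f]) (use int in simp)
  then have int': "integrable (distr M (F i) (\<lambda>\<omega>. \<omega>) \<Otimes>\<^sub>M D) (\<lambda>(\<omega>, s). f \<omega> s)"
    unfolding distr_pair[OF i] .
  have "(LINT \<omega>|M. f \<omega> (\<zeta> i \<omega>)) = (LINT z|distr M (F i \<Otimes>\<^sub>M D) (\<lambda>\<omega>. (\<omega>, \<zeta> i \<omega>)). (case z of (\<omega>, s) \<Rightarrow> f \<omega> s))"
    by (subst integral_distr[OF pair f]) simp
  also have "\<dots> = (LINT \<omega>|distr M (F i) (\<lambda>\<omega>. \<omega>). (LINT s|D. f \<omega> s))"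
    unfolding distr_pair[OF i] by (subst P.integral_fst'[OF int', symmetric]) simp
  also have "\<dots> = (LINT \<omega>|M. (LINT s|D. f \<omega> s))"
    by (intro integral_distr id_measurable D.borel_measurable_lebesgue_integral f)
  finally show ?thesis .
qed

end

text \<open>Jensen's inequality for the concave power \<open>a\<close>, obtained from the tangent at \<open>Z = 1\<close>.\<close>

lemma (in prob_space) nn_integral_exp_scaled_le:
  assumes [measurable]: "Z \<in> borel_measurable M"
    and Z: "(\<integral>\<^sup>+ \<omega>. ennreal (exp (Z \<omega>)) \<partial>M) \<le> ennreal (exp 1)" and a: "0 \<le> a" "a \<le> 1"
  shows "(\<integral>\<^sup>+ \<omega>. ennreal (exp (a * Z \<omega>)) \<partial>M) \<le> ennreal (exp a)"
proof -
  have "exp (a * z) \<le> exp a * (1 - a) + exp a * a / exp 1 * exp z" for z :: real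
  proof -
    have "exp ((1 - a) *\<^sub>R 0 + a *\<^sub>R (z - 1)) \<le> (1 - a) * exp 0 + a * exp (z - 1)"
      using a by (intro convex_onD[OF exp_convex]) auto
    then have "exp a * exp (a * (z - 1)) \<le> exp a * ((1 - a) + a * exp (z - 1))"
      by (intro mult_left_mono) auto
    moreover have "exp a * exp (a * (z - 1)) = exp (a * z)"
      by (simp add: exp_add[symmetric] algebra_simps)
    ultimately show ?thesis by (simp add: exp_diff algebra_simps)
  qed
  then have "(\<integral>\<^sup>+ \<omega>. ennreal (exp (a * Z \<omega>)) \<partial>M)
      \<le> (\<integral>\<^sup>+ \<omega>. ennreal (exp a * (1 - a)) + ennreal (exp a * a / exp 1) * ennreal (exp (Z \<omega>)) \<partial>M)"
    using a by (intro nn_integral_mono) (simp add: ennreal_mult'[symmetric] ennreal_plus[symmetric] del: ennreal_plus)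
  also have "\<dots> = ennreal (exp a * (1 - a)) + ennreal (exp a * a / exp 1) * (\<integral>\<^sup>+ \<omega>. ennreal (exp (Z \<omega>)) \<partial>M)"
    by (simp add: nn_integral_add nn_integral_cmult emeasure_space_1)
  also have "\<dots> \<le> ennreal (exp a * (1 - a)) + ennreal (exp a * a / exp 1) * ennreal (exp 1)"
    by (intro add_left_mono mult_left_mono Z) auto
  also have "\<dots> = ennreal (exp a * (1 - a) + exp a * a / exp 1 * exp 1)"
    using a by (simp add: ennreal_mult'[symmetric] ennreal_plus[symmetric] del: ennreal_plus)
  finally show ?thesis by (simp add: algebra_simps)
qed

lemma (in prob_space) prob_ge_le_exp:
  assumes Y: "Y \<in> borel_measurable M" and E: "(\<integral>\<^sup>+ \<omega>. ennreal (exp (Y \<omega>)) \<partial>M) \<le> ennreal (exp b)"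
  shows "prob {\<omega> \<in> space M. a \<le> Y \<omega>} \<le> exp (b - a)"
proof -
  note [measurable] = Y
  have "{\<omega> \<in> space M. a \<le> Y \<omega>} = {\<omega> \<in> space M. 1 \<le> ennreal (exp (- a)) * ennreal (exp (Y \<omega>))}"
    by (simp add: ennreal_mult'[symmetric] exp_add[symmetric])
  then have "emeasure M {\<omega> \<in> space M. a \<le> Y \<omega>}
      \<le> ennreal (exp (- a)) * (\<integral>\<^sup>+ \<omega>. ennreal (exp (Y \<omega>)) * indicator (space M) \<omega> \<partial>M)"
    by (simp only:) (rule nn_integral_Markov_inequality; measurable)
  also have "(\<integral>\<^sup>+ \<omega>. ennreal (exp (Y \<omega>)) * indicator (space M) \<omega> \<partial>M) = (\<integral>\<^sup>+ \<omega>. ennreal (exp (Y \<omega>)) \<partial>M)"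
    by (intro nn_integral_cong) simp
  also have "ennreal (exp (- a)) * \<dots> \<le> ennreal (exp (- a)) * ennreal (exp b)"
    by (intro mult_left_mono E) auto
  also have "\<dots> = ennreal (exp (b - a))"
    by (simp add: ennreal_mult'[symmetric] exp_add[symmetric])
  finally show ?thesis by (simp add: emeasure_eq_measure)
qed

text \<open>
  The moment generating function of a centred light-tailed variable. For small variance proxy \<open>L\<close>
  the first order term averages out; for large \<open>L\<close> a quadratic bound without cancellation suffices.
\<close>

lemma (in prob_space) nn_integral_exp_centred_le:
  assumes X: "has_bochner_integral M X 0" and [measurable]: "Z \<in> borel_measurable M"
    and L: "L \<ge> 0" and XZ: "\<And>\<omega>. (X \<omega>)\<^sup>2 \<le> L * Z \<omega>" and Z_nonneg: "\<And>\<omega>. 0 \<le> Z \<omega>"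
    and Z: "(\<integral>\<^sup>+ \<omega>. ennreal (exp (Z \<omega>)) \<partial>M) \<le> ennreal (exp 1)"
  shows "(\<integral>\<^sup>+ \<omega>. ennreal (exp (X \<omega>)) \<partial>M) \<le> ennreal (exp (3 / 4 * L))"
proof (cases "9 / 16 * L \<le> 1")
  case True
  define B where "B \<omega> = exp (9 / 16 * L * Z \<omega>)" for \<omega>
  have [measurable]: "B \<in> borel_measurable M" unfolding B_def by measurable
  have B_le: "(\<integral>\<^sup>+ \<omega>. ennreal (B \<omega>) \<partial>M) \<le> ennreal (exp (9 / 16 * L))"
    unfolding B_def using L True by (intro nn_integral_exp_scaled_le Z) auto
  have B_int: "integrable M B"
  proof (rule integrableI_bounded)
    have "(\<integral>\<^sup>+ \<omega>. ennreal (norm (B \<omega>)) \<partial>M) = (\<integral>\<^sup>+ \<omega>. ennreal (B \<omega>) \<partial>M)"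
      by (simp add: B_def)
    also have "\<dots> < \<infinity>" using B_le by (rule order.strict_trans1) simp
    finally show "(\<integral>\<^sup>+ \<omega>. ennreal (norm (B \<omega>)) \<partial>M) < \<infinity>" .
  qed simp
  have X_int: "integrable M X" "(LINT \<omega>|M. X \<omega>) = 0"
    using X by (auto simp: has_bochner_integral_iff)
  have "exp (X \<omega>) \<le> X \<omega> + B \<omega>" for \<omega>
  proof -
    have "exp (9 / 16 * (X \<omega>)\<^sup>2) \<le> B \<omega>"
      unfolding B_def using XZ[of \<omega>] by simp
    with exp_le_linear_plus_gaussian[of "X \<omega>"] show ?thesis by linarith
  qed
  note le = this
  have "(\<integral>\<^sup>+ \<omega>. ennreal (exp (X \<omega>)) \<partial>M) \<le> (\<integral>\<^sup>+ \<omega>. ennreal (X \<omega> + B \<omega>) \<partial>M)"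
    by (intro nn_integral_mono ennreal_leI le)
  also have "\<dots> = ennreal (LINT \<omega>|M. X \<omega> + B \<omega>)"
    using le by (intro nn_integral_eq_integral Bochner_Integration.integrable_add X_int B_int AE_I2)
      (meson exp_ge_zero order.trans)
  also have "(LINT \<omega>|M. X \<omega> + B \<omega>) = (LINT \<omega>|M. B \<omega>)"
    using X_int B_int by simp
  also have "ennreal \<dots> = (\<integral>\<^sup>+ \<omega>. ennreal (B \<omega>) \<partial>M)"
    by (intro nn_integral_eq_integral[symmetric] B_int) (simp add: B_def)
  also have "\<dots> \<le> ennreal (exp (9 / 16 * L))" by (rule B_le)
  also have "\<dots> \<le> ennreal (exp (3 / 4 * L))"
    using L by (intro ennreal_leI) simp
  finally show ?thesis .
next
  case False
  have "exp (X \<omega>) \<le> exp (3 / 8 * L) * exp (2 / 3 * Z \<omega>)" for \<omega>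
  proof -
    have "(X \<omega>)\<^sup>2 \<le> L * Z \<omega>" by (rule XZ)
    also have "\<dots> \<le> (3 / 8 * L + 2 / 3 * Z \<omega>)\<^sup>2"
    proof -
      have "0 \<le> (3 / 8 * L - 2 / 3 * Z \<omega>)\<^sup>2" by simp
      also have "\<dots> = (3 / 8 * L + 2 / 3 * Z \<omega>)\<^sup>2 - L * Z \<omega>"
        by (simp add: power2_eq_square algebra_simps)
      finally show ?thesis by simp
    qed
    finally have "X \<omega> \<le> 3 / 8 * L + 2 / 3 * Z \<omega>"
      by (rule power2_le_imp_le) (use L Z_nonneg[of \<omega>] in simp)
    then show ?thesis by (simp add: exp_add[symmetric])
  qed
  then have "(\<integral>\<^sup>+ \<omega>. ennreal (exp (X \<omega>)) \<partial>M)
      \<le> (\<integral>\<^sup>+ \<omega>. ennreal (exp (3 / 8 * L)) * ennreal (exp (2 / 3 * Z \<omega>)) \<partial>M)"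
    by (intro nn_integral_mono) (simp add: ennreal_mult'[symmetric])
  also have "\<dots> = ennreal (exp (3 / 8 * L)) * (\<integral>\<^sup>+ \<omega>. ennreal (exp (2 / 3 * Z \<omega>)) \<partial>M)"
    by (intro nn_integral_cmult) simp
  also have "\<dots> \<le> ennreal (exp (3 / 8 * L)) * ennreal (exp (2 / 3))"
    by (intro mult_left_mono nn_integral_exp_scaled_le Z) auto
  also have "\<dots> = ennreal (exp (3 / 8 * L + 2 / 3))"
    by (simp add: ennreal_mult'[symmetric] exp_add)
  also have "\<dots> \<le> ennreal (exp (3 / 4 * L))"
    using False by (intro ennreal_leI) simp
  finally show ?thesis .
qed

text \<open>
  The queries are separated from the directions below, because some directions are built from the
  noise of other oracles, whose measurability has to be known first.
\<close>

locale oracle_queries = fresh_samples M F D \<zeta>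
  for M :: "'w measure" and F and D :: "'s measure" and \<zeta> +
  fixes S :: "'a::euclidean_space set" and Or :: "'a \<Rightarrow> 's \<Rightarrow> 'b::euclidean_space" and f :: "'a \<Rightarrow> 'b"
    and U :: "nat \<Rightarrow> 'w \<Rightarrow> 'a"
  assumes unbiased: "unbiased_oracle D S Or f"
    and query_measurable: "\<And>i. i \<ge> 1 \<Longrightarrow> U i \<in> borel_measurable (F i)"
    and query_in: "\<And>i \<omega>. i \<ge> 1 \<Longrightarrow> \<omega> \<in> space M \<Longrightarrow> U i \<omega> \<in> S"
begin

definition noise :: "nat \<Rightarrow> 'w \<Rightarrow> 'b" where
  "noise i \<omega> = Or (U i \<omega>) (\<zeta> i \<omega>) - f (U i \<omega>)"

lemma oracle_measurable [measurable]: "(\<lambda>(u, s). Or u s) \<in> borel_measurable (borel \<Otimes>\<^sub>M D)"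
  using unbiased by (simp add: unbiased_oracle_def)

lemma oracle_mean: "u \<in> S \<Longrightarrow> has_bochner_integral D (Or u) (f u)"
  using unbiased by (simp add: unbiased_oracle_def)

text \<open>
  Nothing is known about the regularity of \<open>f\<close>. It is measurable along the queries because it is a
  parametric integral of the jointly measurable oracle.
\<close>

lemma truth_measurable:
  assumes i: "i \<ge> 1"
  shows "(\<lambda>\<omega>. f (U i \<omega>)) \<in> borel_measurable (F i)"
proof -
  interpret D: prob_space D using prob_space_D[OF i] .
  note [measurable] = query_measurable[OF i]
  have "(\<lambda>\<omega>. LINT s|D. Or (U i \<omega>) s) \<in> borel_measurable (F i)"
    by measurable
  also have "(\<lambda>\<omega>. LINT s|D. Or (U i \<omega>) s) \<in> borel_measurable (F i) \<longleftrightarrow> ?thesis"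
    by (intro measurable_cong)
      (auto simp: space_F dest!: query_in[OF i] oracle_mean intro: has_bochner_integral_integral_eq)
  finally show ?thesis .
qed

lemma noise_pair_measurable:
  assumes i: "i \<ge> 1"
  shows "(\<lambda>(\<omega>, s). Or (U i \<omega>) s - f (U i \<omega>)) \<in> borel_measurable (F i \<Otimes>\<^sub>M D)"
proof -
  note [measurable] = query_measurable[OF i] truth_measurable[OF i]
  show ?thesis by measurable
qed

lemma noise_measurable:
  assumes i: "i \<ge> 1"
  shows "noise i \<in> borel_measurable (F (i + 1))"
proof -
  have [measurable]: "\<zeta> i \<in> F (i + 1) \<rightarrow>\<^sub>M D" "U i \<in> borel_measurable (F (i + 1))"
    "(\<lambda>\<omega>. f (U i \<omega>)) \<in> borel_measurable (F (i + 1))"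
    using sample_measurable[OF i] F_measurable_mono[OF query_measurable[OF i]]
      F_measurable_mono[OF truth_measurable[OF i]] by auto
  show ?thesis unfolding noise_def by measurable
qed

lemmas noise_measurable_M = F_measurable_M[OF noise_measurable]

lemma nn_integral_noise:
  assumes i: "i \<ge> 1" and \<Phi>: "(\<lambda>(\<omega>, v). \<Phi> \<omega> v) \<in> borel_measurable (F i \<Otimes>\<^sub>M borel)"
  shows "(\<integral>\<^sup>+ \<omega>. \<Phi> \<omega> (noise i \<omega>) \<partial>M) = (\<integral>\<^sup>+ \<omega>. (\<integral>\<^sup>+ s. \<Phi> \<omega> (Or (U i \<omega>) s - f (U i \<omega>)) \<partial>D) \<partial>M)"
  unfolding noise_def
proof (rule nn_integral_sample[OF i])
  note [measurable] = \<Phi> noise_pair_measurable[OF i]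
  have "(\<lambda>z. (fst z, (case z of (\<omega>, s) \<Rightarrow> Or (U i \<omega>) s - f (U i \<omega>)))) \<in> F i \<Otimes>\<^sub>M D \<rightarrow>\<^sub>M F i \<Otimes>\<^sub>M borel"
    by measurable
  from measurable_compose[OF this \<Phi>]
  show "(\<lambda>(\<omega>, s). \<Phi> \<omega> (Or (U i \<omega>) s - f (U i \<omega>))) \<in> borel_measurable (F i \<Otimes>\<^sub>M D)"
    by (simp add: case_prod_beta')
qed

end

text \<open>
  Bounded directions keep the inner products with the noise integrable when only the variance is
  controlled, and make \<open>R * \<sigma>\<close> the scale of their tails.
\<close>

locale oracle_calls = oracle_queries M F D \<zeta> S Or f U + N: vector_norm n
  for M :: "'w measure" and F and D :: "'s measure" and \<zeta>
    and S :: "'a::euclidean_space set" and Or :: "'a \<Rightarrow> 's \<Rightarrow> 'b::euclidean_space" and f and U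
    and n :: "'b \<Rightarrow> real" +
  fixes h :: "nat \<Rightarrow> 'w \<Rightarrow> 'b" and R :: real and w :: "nat \<Rightarrow> real"
  assumes direction_measurable: "\<And>i. i \<ge> 1 \<Longrightarrow> h i \<in> borel_measurable (F i)"
    and direction_le: "\<And>i \<omega>. i \<ge> 1 \<Longrightarrow> \<omega> \<in> space M \<Longrightarrow> n (h i \<omega>) \<le> R"
    and R_pos: "R > 0" and weight_pos: "\<And>i. i \<ge> 1 \<Longrightarrow> w i > 0"
begin

lemmas direction_measurable_M = F_measurable_M[OF direction_measurable]

subsection \<open>Bounded variance\<close>

lemma noise_second_moment:
  assumes var: "bounded_variance D n S Or f \<sigma>" and i: "i \<ge> 1"
  shows "integrable M (\<lambda>\<omega>. (dual_norm n (noise i \<omega>))\<^sup>2)"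
    and "(LINT \<omega>|M. (dual_norm n (noise i \<omega>))\<^sup>2) \<le> \<sigma>\<^sup>2"
proof -
  note [measurable] = noise_measurable_M[OF i]
  have "(\<integral>\<^sup>+ \<omega>. ennreal ((dual_norm n (noise i \<omega>))\<^sup>2) \<partial>M)
      = (\<integral>\<^sup>+ \<omega>. (\<integral>\<^sup>+ s. ennreal ((dual_norm n (Or (U i \<omega>) s - f (U i \<omega>)))\<^sup>2) \<partial>D) \<partial>M)"
    by (rule nn_integral_noise[OF i]) measurable
  also have "\<dots> \<le> (\<integral>\<^sup>+ \<omega>. ennreal (\<sigma>\<^sup>2) \<partial>M)"
    using var query_in[OF i] by (intro nn_integral_mono) (auto simp: bounded_variance_def)
  also have "\<dots> = ennreal (\<sigma>\<^sup>2)" by (simp add: emeasure_space_1)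
  finally have le: "(\<integral>\<^sup>+ \<omega>. ennreal ((dual_norm n (noise i \<omega>))\<^sup>2) \<partial>M) \<le> ennreal (\<sigma>\<^sup>2)" .
  show int: "integrable M (\<lambda>\<omega>. (dual_norm n (noise i \<omega>))\<^sup>2)"
  proof (rule integrableI_bounded)
    show "(\<integral>\<^sup>+ \<omega>. ennreal (norm ((dual_norm n (noise i \<omega>))\<^sup>2)) \<partial>M) < \<infinity>"
      using le by (simp add: order.strict_trans1)
  qed simp
  have "ennreal (LINT \<omega>|M. (dual_norm n (noise i \<omega>))\<^sup>2) \<le> ennreal (\<sigma>\<^sup>2)"
    using le by (subst nn_integral_eq_integral[OF int, symmetric]) auto
  then show "(LINT \<omega>|M. (dual_norm n (noise i \<omega>))\<^sup>2) \<le> \<sigma>\<^sup>2" by simp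
qed

lemma noise_inner_mean:
  assumes var: "bounded_variance D n S Or f \<sigma>" and i: "i \<ge> 1"
  shows "integrable M (\<lambda>\<omega>. noise i \<omega> \<bullet> h i \<omega>)" and "(LINT \<omega>|M. noise i \<omega> \<bullet> h i \<omega>) = 0"
proof -
  interpret D: prob_space D using prob_space_D[OF i] .
  note [measurable] = noise_measurable_M[OF i] direction_measurable_M[OF i]
  show int: "integrable M (\<lambda>\<omega>. noise i \<omega> \<bullet> h i \<omega>)"
  proof (rule Bochner_Integration.integrable_bound)
    show "integrable M (\<lambda>\<omega>. R * (1 + (dual_norm n (noise i \<omega>))\<^sup>2))"
      using noise_second_moment(1)[OF var i] by simp
    show "AE \<omega> in M. norm (noise i \<omega> \<bullet> h i \<omega>) \<le> norm (R * (1 + (dual_norm n (noise i \<omega>))\<^sup>2))"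
    proof (rule AE_I2)
      fix \<omega> assume \<omega>: "\<omega> \<in> space M"
      let ?d = "dual_norm n (noise i \<omega>)"
      have "\<bar>noise i \<omega> \<bullet> h i \<omega>\<bar> \<le> ?d * n (h i \<omega>)" by (rule N.abs_inner_le_dual_norm)
      also have "\<dots> \<le> ?d * R" by (intro mult_left_mono direction_le i \<omega>) auto
      also have "\<dots> \<le> (1 + ?d\<^sup>2) * R"
        using R_pos sum_squares_ge_zero[of "?d - 1" ?d]
        by (intro mult_right_mono) (auto simp: power2_eq_square algebra_simps)
      finally show "norm (noise i \<omega> \<bullet> h i \<omega>) \<le> norm (R * (1 + ?d\<^sup>2))"
        using R_pos by (simp add: abs_mult mult.commute)
    qed
  qed simp
  have "(LINT \<omega>|M. noise i \<omega> \<bullet> h i \<omega>) = (LINT \<omega>|M. (LINT s|D. (Or (U i \<omega>) s - f (U i \<omega>)) \<bullet> h i \<omega>))"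
    unfolding noise_def
  proof (rule integral_sample[OF i])
    note [measurable] = direction_measurable[OF i] query_measurable[OF i] truth_measurable[OF i]
    show "(\<lambda>(\<omega>, s). (Or (U i \<omega>) s - f (U i \<omega>)) \<bullet> h i \<omega>) \<in> borel_measurable (F i \<Otimes>\<^sub>M D)"
      by measurable
    show "integrable M (\<lambda>\<omega>. (Or (U i \<omega>) (\<zeta> i \<omega>) - f (U i \<omega>)) \<bullet> h i \<omega>)"
      using int by (simp add: noise_def)
  qed
  also have "\<dots> = (LINT \<omega>|M. 0)"
  proof (rule Bochner_Integration.integral_cong)
    fix \<omega> assume "\<omega> \<in> space M"
    from oracle_mean[OF query_in[OF i this]]
    show "(LINT s|D. (Or (U i \<omega>) s - f (U i \<omega>)) \<bullet> h i \<omega>) = 0"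
      by (simp add: has_bochner_integral_iff D.prob_space)
  qed simp
  finally show "(LINT \<omega>|M. noise i \<omega> \<bullet> h i \<omega>) = 0" by simp
qed

subsection \<open>Light tails\<close>

lemma noise_exact:
  assumes lt: "light_tail D n S Or f 0" and i: "i \<ge> 1"
  shows "AE \<omega> in M. noise i \<omega> = 0"
proof -
  note [measurable] = noise_measurable_M[OF i]
  have "(\<integral>\<^sup>+ \<omega>. indicator (- {0}) (noise i \<omega>) \<partial>M)
      = (\<integral>\<^sup>+ \<omega>. (\<integral>\<^sup>+ s. indicator (- {0}) (Or (U i \<omega>) s - f (U i \<omega>)) \<partial>D) \<partial>M)"
    by (rule nn_integral_noise[OF i]) measurable
  also have "\<dots> = (\<integral>\<^sup>+ \<omega>. 0 \<partial>M)"
  proof (rule nn_integral_cong)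
    fix \<omega> assume "\<omega> \<in> space M"
    then have "AE s in D. Or (U i \<omega>) s = f (U i \<omega>)"
      using lt query_in[OF i] by (simp add: light_tail_def)
    then have "(\<integral>\<^sup>+ s. indicator (- {0}) (Or (U i \<omega>) s - f (U i \<omega>)) \<partial>D) = (\<integral>\<^sup>+ s. 0 \<partial>D)"
      by (intro nn_integral_cong_AE) auto
    then show "(\<integral>\<^sup>+ s. indicator (- {0}) (Or (U i \<omega>) s - f (U i \<omega>)) \<partial>D) = 0" by simp
  qed
  finally have "AE \<omega> in M. indicator (- {0}) (noise i \<omega>) = (0 :: ennreal)"
    by (simp add: nn_integral_0_iff_AE)
  then show ?thesis by eventually_elim (auto split: split_indicator_asm)
qed

lemma exp_noise_square:
  assumes lt: "light_tail D n S Or f \<sigma>" "\<sigma> \<noteq> 0" and i: "i \<ge> 1"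
  shows "(\<integral>\<^sup>+ \<omega>. ennreal (exp ((dual_norm n (noise i \<omega>))\<^sup>2 / \<sigma>\<^sup>2)) \<partial>M) \<le> ennreal (exp 1)"
proof -
  have "(\<integral>\<^sup>+ \<omega>. ennreal (exp ((dual_norm n (noise i \<omega>))\<^sup>2 / \<sigma>\<^sup>2)) \<partial>M)
      = (\<integral>\<^sup>+ \<omega>. (\<integral>\<^sup>+ s. ennreal (exp ((dual_norm n (Or (U i \<omega>) s - f (U i \<omega>)))\<^sup>2 / \<sigma>\<^sup>2)) \<partial>D) \<partial>M)"
    by (rule nn_integral_noise[OF i]) measurable
  also have "\<dots> \<le> (\<integral>\<^sup>+ \<omega>. ennreal (exp 1) \<partial>M)"
    using lt query_in[OF i] by (intro nn_integral_mono) (simp add: light_tail_def N.dual_norm_minus_commute)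
  finally show ?thesis by (simp add: emeasure_space_1)
qed

text \<open>
  Given the past, the last inner product is centred and light-tailed with variance proxy
  \<open>(l * R * \<sigma>)\<^sup>2\<close>, and the factor \<open>W\<close> that collects the earlier ones is a constant.
\<close>

lemma exp_noise_linear_step:
  assumes lt: "light_tail D n S Or f \<sigma>" "\<sigma> \<noteq> 0" and i: "i \<ge> 1"
    and W: "W \<in> borel_measurable (F i)"
  shows "(\<integral>\<^sup>+ \<omega>. W \<omega> * ennreal (exp (l * (noise i \<omega> \<bullet> h i \<omega>))) \<partial>M)
    \<le> ennreal (exp (3 / 4 * (l\<^sup>2 * R\<^sup>2 * \<sigma>\<^sup>2))) * (\<integral>\<^sup>+ \<omega>. W \<omega> \<partial>M)"
proof -
  interpret D: prob_space D using prob_space_D[OF i] .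
  note [measurable] = W direction_measurable[OF i] query_measurable[OF i] truth_measurable[OF i]
  have inner: "(\<integral>\<^sup>+ s. ennreal (exp (l * ((Or (U i \<omega>) s - f (U i \<omega>)) \<bullet> h i \<omega>))) \<partial>D)
      \<le> ennreal (exp (3 / 4 * (l\<^sup>2 * R\<^sup>2 * \<sigma>\<^sup>2)))" if \<omega>: "\<omega> \<in> space M" for \<omega>
  proof (rule D.nn_integral_exp_centred_le)
    have mean: "has_bochner_integral D (Or (U i \<omega>)) (f (U i \<omega>))"
      by (rule oracle_mean[OF query_in[OF i \<omega>]])
    then show "has_bochner_integral D (\<lambda>s. l * ((Or (U i \<omega>) s - f (U i \<omega>)) \<bullet> h i \<omega>)) 0"
      by (simp add: has_bochner_integral_iff D.prob_space)
    have [measurable]: "Or (U i \<omega>) \<in> borel_measurable D"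
      using mean by (simp add: has_bochner_integral_iff)
    show "(\<lambda>s. (dual_norm n (Or (U i \<omega>) s - f (U i \<omega>)))\<^sup>2 / \<sigma>\<^sup>2) \<in> borel_measurable D"
      by measurable
    show "(\<integral>\<^sup>+ s. ennreal (exp ((dual_norm n (Or (U i \<omega>) s - f (U i \<omega>)))\<^sup>2 / \<sigma>\<^sup>2)) \<partial>D) \<le> ennreal (exp 1)"
      using lt query_in[OF i \<omega>] by (simp add: light_tail_def N.dual_norm_minus_commute)
    fix s
    let ?d = "dual_norm n (Or (U i \<omega>) s - f (U i \<omega>))"
    have "\<bar>(Or (U i \<omega>) s - f (U i \<omega>)) \<bullet> h i \<omega>\<bar> \<le> ?d * R"
      using N.abs_inner_le_dual_norm[of "Or (U i \<omega>) s - f (U i \<omega>)" "h i \<omega>"]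
        mult_left_mono[OF direction_le[OF i \<omega>], of ?d] by simp
    then have "((Or (U i \<omega>) s - f (U i \<omega>)) \<bullet> h i \<omega>)\<^sup>2 \<le> (?d * R)\<^sup>2"
      using abs_le_square_iff[of "(Or (U i \<omega>) s - f (U i \<omega>)) \<bullet> h i \<omega>" "?d * R"] R_pos
      by simp
    then have "l\<^sup>2 * ((Or (U i \<omega>) s - f (U i \<omega>)) \<bullet> h i \<omega>)\<^sup>2 \<le> l\<^sup>2 * (?d * R)\<^sup>2"
      by (intro mult_left_mono) auto
    then show "(l * ((Or (U i \<omega>) s - f (U i \<omega>)) \<bullet> h i \<omega>))\<^sup>2 \<le> l\<^sup>2 * R\<^sup>2 * \<sigma>\<^sup>2 * (?d\<^sup>2 / \<sigma>\<^sup>2)"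
      using lt(2) by (simp add: power_mult_distrib mult_ac)
    show "0 \<le> ?d\<^sup>2 / \<sigma>\<^sup>2" by simp
  qed simp
  have "(\<integral>\<^sup>+ \<omega>. W \<omega> * ennreal (exp (l * (noise i \<omega> \<bullet> h i \<omega>))) \<partial>M)
    = (\<integral>\<^sup>+ \<omega>. (\<integral>\<^sup>+ s. W \<omega> * ennreal (exp (l * ((Or (U i \<omega>) s - f (U i \<omega>)) \<bullet> h i \<omega>))) \<partial>D) \<partial>M)"
    by (rule nn_integral_noise[OF i]) measurable
  also have "\<dots> = (\<integral>\<^sup>+ \<omega>. W \<omega> * (\<integral>\<^sup>+ s. ennreal (exp (l * ((Or (U i \<omega>) s - f (U i \<omega>)) \<bullet> h i \<omega>))) \<partial>D) \<partial>M)"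
  proof (rule nn_integral_cong, rule nn_integral_cmult)
    fix \<omega> assume "\<omega> \<in> space M"
    then have [measurable]: "Or (U i \<omega>) \<in> borel_measurable D"
      using oracle_mean[OF query_in[OF i]] by (simp add: has_bochner_integral_iff)
    show "(\<lambda>s. ennreal (exp (l * ((Or (U i \<omega>) s - f (U i \<omega>)) \<bullet> h i \<omega>)))) \<in> borel_measurable D"
      by measurable
  qed
  also have "\<dots> \<le> (\<integral>\<^sup>+ \<omega>. W \<omega> * ennreal (exp (3 / 4 * (l\<^sup>2 * R\<^sup>2 * \<sigma>\<^sup>2))) \<partial>M)"
    by (intro nn_integral_mono mult_left_mono inner) auto
  also have "\<dots> = (\<integral>\<^sup>+ \<omega>. W \<omega> \<partial>M) * ennreal (exp (3 / 4 * (l\<^sup>2 * R\<^sup>2 * \<sigma>\<^sup>2)))"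
    by (intro nn_integral_multc F_measurable_M[OF W])
  finally show ?thesis by (simp add: mult.commute)
qed

lemma exp_noise_linear:
  assumes lt: "light_tail D n S Or f \<sigma>" "\<sigma> \<noteq> 0"
  shows "(\<integral>\<^sup>+ \<omega>. ennreal (exp (l * (\<Sum>i=1..t. w i * (noise i \<omega> \<bullet> h i \<omega>)))) \<partial>M)
    \<le> ennreal (exp (3 / 4 * (l\<^sup>2 * R\<^sup>2 * \<sigma>\<^sup>2 * (\<Sum>i=1..t. (w i)\<^sup>2))))"
proof (induction t)
  case 0
  show ?case by (simp add: emeasure_space_1)
next
  case (Suc t)
  define W where "W \<omega> = ennreal (exp (l * (\<Sum>i=1..t. w i * (noise i \<omega> \<bullet> h i \<omega>))))" for \<omega>
  have W: "W \<in> borel_measurable (F (Suc t))"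
  proof -
    have "(\<lambda>\<omega>. \<Sum>i=1..t. w i * (noise i \<omega> \<bullet> h i \<omega>)) \<in> borel_measurable (F (Suc t))"
    proof (rule borel_measurable_sum)
      fix i assume i: "i \<in> {1..t}"
      then have [measurable]: "noise i \<in> borel_measurable (F (Suc t))" "h i \<in> borel_measurable (F (Suc t))"
        by (auto intro: F_measurable_mono[OF noise_measurable] F_measurable_mono[OF direction_measurable])
      show "(\<lambda>\<omega>. w i * (noise i \<omega> \<bullet> h i \<omega>)) \<in> borel_measurable (F (Suc t))" by measurable
    qed
    then show ?thesis unfolding W_def by measurable
  qed
  have "(\<integral>\<^sup>+ \<omega>. ennreal (exp (l * (\<Sum>i=1..Suc t. w i * (noise i \<omega> \<bullet> h i \<omega>)))) \<partial>M)
     = (\<integral>\<^sup>+ \<omega>. W \<omega> * ennreal (exp (l * w (Suc t) * (noise (Suc t) \<omega> \<bullet> h (Suc t) \<omega>))) \<partial>M)"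
    unfolding W_def
    by (intro nn_integral_cong) (simp add: ennreal_mult'[symmetric] exp_add[symmetric] algebra_simps)
  also have "\<dots> \<le> ennreal (exp (3 / 4 * ((l * w (Suc t))\<^sup>2 * R\<^sup>2 * \<sigma>\<^sup>2))) * (\<integral>\<^sup>+ \<omega>. W \<omega> \<partial>M)"
    by (rule exp_noise_linear_step[OF lt _ W]) simp
  also have "\<dots> \<le> ennreal (exp (3 / 4 * ((l * w (Suc t))\<^sup>2 * R\<^sup>2 * \<sigma>\<^sup>2)))
      * ennreal (exp (3 / 4 * (l\<^sup>2 * R\<^sup>2 * \<sigma>\<^sup>2 * (\<Sum>i=1..t. (w i)\<^sup>2))))"
    using Suc unfolding W_def by (intro mult_left_mono) auto
  also have "\<dots> = ennreal (exp (3 / 4 * (l\<^sup>2 * R\<^sup>2 * \<sigma>\<^sup>2 * (\<Sum>i=1..Suc t. (w i)\<^sup>2))))"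
    by (simp add: ennreal_mult'[symmetric] exp_add[symmetric] algebra_simps power_mult_distrib)
  finally show ?case .
qed

text \<open>Chernoff's bound, with the exponent that minimises it.\<close>

lemma prob_noise_linear:
  assumes lt: "light_tail D n S Or f \<sigma>" and \<sigma>: "\<sigma> \<ge> 0" and lam: "lam > 0" and t: "t \<ge> 1"
  shows "prob {\<omega> \<in> space M. (\<Sum>i=1..t. w i * (noise i \<omega> \<bullet> h i \<omega>)) > lam * (R * \<sigma> * sqrt (\<Sum>i=1..t. (w i)\<^sup>2))}
    \<le> exp (- (lam\<^sup>2 / 3))"
proof -
  let ?Y = "\<lambda>\<omega>. \<Sum>i=1..t. w i * (noise i \<omega> \<bullet> h i \<omega>)"
  have [measurable]: "noise i \<in> borel_measurable M" "h i \<in> borel_measurable M" if "i \<in> {1..t}" for i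
    using noise_measurable_M[of i] direction_measurable_M[of i] that by auto
  define B where "B = R * \<sigma> * sqrt (\<Sum>i=1..t. (w i)\<^sup>2)"
  show ?thesis
  proof (cases "\<sigma> = 0")
    case True
    have "AE \<omega> in M. \<forall>i\<in>{1..t}. noise i \<omega> = 0"
      using lt True by (intro AE_finite_allI noise_exact) auto
    then have "AE \<omega> in M. \<not> ?Y \<omega> > 0"
      by eventually_elim simp
    moreover have "{\<omega> \<in> space M. ?Y \<omega> > 0} \<in> events" by measurable
    ultimately have "prob {\<omega> \<in> space M. ?Y \<omega> > 0} = 0"
      by (simp only: prob_eq_0) (auto elim: eventually_mono)
    with True show ?thesis by simp
  next
    case False
    have "(w 1)\<^sup>2 \<le> (\<Sum>i=1..t. (w i)\<^sup>2)"
      using t by (intro member_le_sum) auto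
    then have S: "(\<Sum>i=1..t. (w i)\<^sup>2) > 0"
      using weight_pos[of 1] by (smt (verit) order.refl zero_less_power)
    then have B: "B > 0" using False \<sigma> R_pos by (simp add: B_def)
    have B2: "B\<^sup>2 = R\<^sup>2 * \<sigma>\<^sup>2 * (\<Sum>i=1..t. (w i)\<^sup>2)"
      using S by (simp add: B_def power_mult_distrib)
    define l where "l = 2 * lam / (3 * B)"
    have l: "l > 0" using lam B by (simp add: l_def)
    have "prob {\<omega> \<in> space M. ?Y \<omega> > lam * B} \<le> prob {\<omega> \<in> space M. l * (lam * B) \<le> l * ?Y \<omega>}"
      using l by (intro finite_measure_mono) (simp_all del: One_nat_def add: subset_iff, measurable)
    also have "\<dots> \<le> exp (3 / 4 * (l\<^sup>2 * B\<^sup>2) - l * (lam * B))"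
      using exp_noise_linear[OF lt False, of l t] by (intro prob_ge_le_exp) (auto simp: B2 mult.assoc)
    also have "3 / 4 * (l\<^sup>2 * B\<^sup>2) - l * (lam * B) = - (lam\<^sup>2 / 3)"
      using B by (simp add: l_def field_simps power2_eq_square)
    finally show ?thesis by (simp add: B_def)
  qed
qed

text \<open>
  By convexity of the exponential, a weighted average of light-tailed squares is light-tailed; this
  works for arbitrary dependence between the calls.
\<close>

lemma prob_noise_square:
  assumes lt: "light_tail D n S Or f \<sigma>" and t: "t \<ge> 1" and c: "\<And>i. i \<ge> 1 \<Longrightarrow> c i > 0"
  shows "prob {\<omega> \<in> space M. (\<Sum>i=1..t. c i * (dual_norm n (noise i \<omega>))\<^sup>2) > (1 + lam) * (\<Sum>i=1..t. c i * \<sigma>\<^sup>2)}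
    \<le> exp (- lam)"
proof -
  let ?Y = "\<lambda>\<omega>. \<Sum>i=1..t. c i * (dual_norm n (noise i \<omega>))\<^sup>2"
  have m [measurable]: "noise i \<in> borel_measurable M" if "i \<in> {1..t}" for i
    using noise_measurable_M[of i] that by simp
  have [measurable]: "?Y \<in> borel_measurable M"
    by (intro borel_measurable_sum borel_measurable_times borel_measurable_const
          borel_measurable_power measurable_compose[OF m N.dual_norm_measurable])
  show ?thesis
  proof (cases "\<sigma> = 0")
    case True
    have "dual_norm n 0 = 0"
      using N.dual_norm_least[of 0 0] by (simp add: order_antisym)
    moreover have "AE \<omega> in M. \<forall>i\<in>{1..t}. noise i \<omega> = 0"
      using lt True by (intro AE_finite_allI noise_exact) auto
    ultimately have "AE \<omega> in M. \<not> ?Y \<omega> > 0"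
      by (auto elim!: eventually_mono)
    moreover have "{\<omega> \<in> space M. ?Y \<omega> > 0} \<in> events" by measurable
    ultimately have "prob {\<omega> \<in> space M. ?Y \<omega> > 0} = 0"
      by (simp only: prob_eq_0) (auto elim: eventually_mono)
    with True show ?thesis by simp
  next
    case False
    define C where "C = (\<Sum>i=1..t. c i)"
    have "c 1 \<le> C"
      unfolding C_def using t c by (intro member_le_sum) (auto intro: less_imp_le)
    then have C: "C > 0" using c[of 1] by simp
    let ?Z = "\<lambda>i \<omega>. (dual_norm n (noise i \<omega>))\<^sup>2 / \<sigma>\<^sup>2"
    have jensen: "exp (?Y \<omega> / (C * \<sigma>\<^sup>2)) \<le> (\<Sum>i=1..t. c i / C * exp (?Z i \<omega>))" for \<omega>
    proof -
      have "exp (\<Sum>i\<in>{1..t}. (c i / C) *\<^sub>R ?Z i \<omega>) \<le> (\<Sum>i\<in>{1..t}. c i / C * exp (?Z i \<omega>))"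
        by (rule convex_on_sum[OF _ _ exp_convex])
          (use t C c in \<open>auto simp: C_def sum_divide_distrib[symmetric] intro!: less_imp_le divide_pos_pos\<close>)
      then show ?thesis
        by (simp add: sum_divide_distrib)
    qed
    have "(\<integral>\<^sup>+ \<omega>. ennreal (exp (?Y \<omega> / (C * \<sigma>\<^sup>2))) \<partial>M)
        \<le> (\<integral>\<^sup>+ \<omega>. (\<Sum>i=1..t. ennreal (c i / C) * ennreal (exp (?Z i \<omega>))) \<partial>M)"
    proof (rule nn_integral_mono)
      fix \<omega>
      have "(\<Sum>i=1..t. ennreal (c i / C) * ennreal (exp (?Z i \<omega>))) = ennreal (\<Sum>i=1..t. c i / C * exp (?Z i \<omega>))"
      proof (subst sum_ennreal[symmetric])
        fix i assume "i \<in> {1..t}"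
        then show "0 \<le> c i / C * exp (?Z i \<omega>)" using c[of i] C by simp
      next
        show "(\<Sum>i=1..t. ennreal (c i / C) * ennreal (exp (?Z i \<omega>))) = (\<Sum>i=1..t. ennreal (c i / C * exp (?Z i \<omega>)))"
          using c C by (intro sum.cong refl ennreal_mult[symmetric]) (auto intro: less_imp_le)
      qed
      then show "ennreal (exp (?Y \<omega> / (C * \<sigma>\<^sup>2))) \<le> (\<Sum>i=1..t. ennreal (c i / C) * ennreal (exp (?Z i \<omega>)))"
        using jensen[of \<omega>] by (simp add: ennreal_leI)
    qed
    also have "\<dots> = (\<Sum>i=1..t. ennreal (c i / C) * (\<integral>\<^sup>+ \<omega>. ennreal (exp (?Z i \<omega>)) \<partial>M))"
      by (subst nn_integral_sum) (auto intro!: sum.cong nn_integral_cmult)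
    also have "\<dots> \<le> (\<Sum>i=1..t. ennreal (c i / C) * ennreal (exp 1))"
      using exp_noise_square[OF lt False] by (intro sum_mono mult_left_mono) auto
    also have "\<dots> = ennreal (\<Sum>i=1..t. c i / C * exp 1)"
    proof (subst sum_ennreal[symmetric])
      fix i assume "i \<in> {1..t}"
      then show "0 \<le> c i / C * exp 1" using c[of i] C by simp
    next
      show "(\<Sum>i=1..t. ennreal (c i / C) * ennreal (exp 1)) = (\<Sum>i=1..t. ennreal (c i / C * exp 1))"
        using c C by (intro sum.cong refl ennreal_mult[symmetric]) (auto intro: less_imp_le)
    qed
    also have "(\<Sum>i=1..t. c i / C * exp 1) = exp (1 :: real)"
      using C unfolding C_def by (simp only: sum_distrib_right[symmetric] sum_divide_distrib[symmetric]) simp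
    finally have mean: "(\<integral>\<^sup>+ \<omega>. ennreal (exp (?Y \<omega> / (C * \<sigma>\<^sup>2))) \<partial>M) \<le> ennreal (exp 1)" .
    have "1 + lam \<le> Y / (C * \<sigma>\<^sup>2)" if "Y > (1 + lam) * (C * \<sigma>\<^sup>2)" for Y
      using that C False by (subst pos_le_divide_eq) auto
    then have "prob {\<omega> \<in> space M. ?Y \<omega> > (1 + lam) * (C * \<sigma>\<^sup>2)}
        \<le> prob {\<omega> \<in> space M. 1 + lam \<le> ?Y \<omega> / (C * \<sigma>\<^sup>2)}"
      by (intro finite_measure_mono) (auto, measurable)
    also have "\<dots> \<le> exp (1 - (1 + lam))"
      by (rule prob_ge_le_exp[OF _ mean]) measurable
    finally show ?thesis by (simp add: C_def sum_distrib_right)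
  qed
qed

end

section \<open>The order of the oracle calls\<close>

text \<open>
  In iteration \<open>t\<close> the dual step calls its oracle first; the gradient is evaluated at a point that
  does not depend on the answer, and the last oracle is queried at the new dual iterate.
\<close>

primrec call_rank :: "oracle_call \<Rightarrow> nat" where
  "call_rank CallKx = 0" | "call_rank CallG = 1" | "call_rank CallKy = 2"

locale call_samples = prob_space M for M :: "'w measure" +
  fixes D :: "'s measure" and \<xi> :: "oracle_call \<Rightarrow> nat \<Rightarrow> 'w \<Rightarrow> 's"
  assumes indep: "indep_vars (\<lambda>_. D) (\<lambda>(c, t). \<xi> c t) (UNIV \<times> {1..})"
    and distr: "\<And>c t. t \<ge> 1 \<Longrightarrow> distr M D (\<xi> c t) = D"
begin

definition calls_before :: "nat \<Rightarrow> (oracle_call \<times> nat) set" where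
  "calls_before k = {(c, t). 1 \<le> t \<and> 3 * t + call_rank c < k}"

text \<open>
  The \<open>\<sigma>\<close>-algebra of the past is generated by one random variable, the tuple of all earlier samples,
  so that independence of disjoint groups of samples applies to it directly.
\<close>

definition record_before :: "nat \<Rightarrow> 'w \<Rightarrow> oracle_call \<times> nat \<Rightarrow> 's" where
  "record_before k \<omega> = restrict (\<lambda>i. (case i of (c, t) \<Rightarrow> \<xi> c t) \<omega>) (calls_before k)"

definition past :: "nat \<Rightarrow> 'w measure" where
  "past k = vimage_algebra (space M) (record_before k) (PiM (calls_before k) (\<lambda>_. D))"

lemma sample_rv: "t \<ge> 1 \<Longrightarrow> \<xi> c t \<in> M \<rightarrow>\<^sub>M D"
  using indep unfolding indep_vars_def by force

lemma space_past [simp]: "space (past k) = space M"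
  by (simp add: past_def)

lemma record_measurable:
  assumes "space N = space M" "\<And>c t. 1 \<le> t \<Longrightarrow> 3 * t + call_rank c < k \<Longrightarrow> \<xi> c t \<in> N \<rightarrow>\<^sub>M D"
  shows "record_before k \<in> N \<rightarrow>\<^sub>M PiM (calls_before k) (\<lambda>_. D)"
  unfolding record_before_def
  by (intro measurable_restrict) (use assms(2) in \<open>auto simp: calls_before_def\<close>)

lemma record_measurable_M: "record_before k \<in> M \<rightarrow>\<^sub>M PiM (calls_before k) (\<lambda>_. D)"
  by (rule record_measurable) (auto intro: sample_rv)

lemma sets_past: "sets (past k) \<subseteq> sets M"
  unfolding past_def by (rule sets_image_in_sets[OF refl record_measurable_M])

lemma sample_past:
  assumes "t \<ge> 1" "3 * t + call_rank c < k"
  shows "\<xi> c t \<in> past k \<rightarrow>\<^sub>M D"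
proof -
  have k: "(c, t) \<in> calls_before k" using assms by (simp add: calls_before_def)
  have "record_before k \<in> past k \<rightarrow>\<^sub>M PiM (calls_before k) (\<lambda>_. D)"
    unfolding past_def
    by (rule measurable_vimage_algebra1) (use measurable_space[OF record_measurable_M] in auto)
  from measurable_compose[OF this measurable_component_singleton[OF k]]
  show ?thesis using k by (simp add: record_before_def)
qed

lemma past_mono: "k \<le> l \<Longrightarrow> sets (past k) \<subseteq> sets (past l)"
  unfolding past_def[of k]
  by (rule sets_image_in_sets) (auto intro!: record_measurable sample_past)

lemma fresh: "fresh_samples M (\<lambda>t. past (3 * t + call_rank c)) D (\<xi> c)"
proof
  fix t A B assume t: "t \<ge> (1::nat)" and A: "A \<in> sets (past (3 * t + call_rank c))" and B: "B \<in> sets D"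
  let ?single = "\<lambda>\<omega>. restrict (\<lambda>i. (case i of (c, t) \<Rightarrow> \<xi> c t) \<omega>) {(c, t)}"
  let ?B = "(\<lambda>f. f (c, t)) -` B \<inter> space (PiM {(c, t)} (\<lambda>_. D))"
  let ?I = "calls_before (3 * t + call_rank c)"
  obtain A' where A': "A' \<in> sets (PiM ?I (\<lambda>_. D))" "A = record_before (3 * t + call_rank c) -` A' \<inter> space M"
    using A measurable_space[OF record_measurable_M] unfolding past_def
    by (subst (asm) sets_vimage_algebra2) auto
  have ind: "indep_var (PiM ?I (\<lambda>_. D)) (record_before (3 * t + call_rank c))
      (PiM {(c, t)} (\<lambda>_. D)) ?single"
    unfolding record_before_def
    by (rule indep_var_restrict[OF indep]) (use t in \<open>auto simp: calls_before_def\<close>)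
  have B': "?B \<in> sets (PiM {(c, t)} (\<lambda>_. D))"
    by (rule measurable_sets[OF _ B]) (rule measurable_component_singleton, simp)
  have single: "?single -` ?B \<inter> space M = \<xi> c t -` B \<inter> space M"
    using measurable_space[OF sample_rv[OF t]] by (auto simp: space_PiM)
  have both: "(\<lambda>\<omega>. (record_before (3 * t + call_rank c) \<omega>, ?single \<omega>)) -` (A' \<times> ?B) \<inter> space M
    = A \<inter> (\<xi> c t -` B \<inter> space M)"
    unfolding A'(2) single[symmetric] by blast
  show "prob (A \<inter> (\<xi> c t -` B \<inter> space M)) = prob A * prob (\<xi> c t -` B \<inter> space M)"
    using indep_varD[OF ind A'(1) B'] unfolding both single A'(2)[symmetric] .
qed (use sets_past past_mono sample_past distr in auto)

end

section \<open>Measurability of the gap\<close>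

lemma lsc_on_sublevel_closed:
  fixes S :: "'a::metric_space set"
  assumes "lsc_on S f" "closed S"
  shows "closed {x \<in> S. f x \<le> c}"
  unfolding closed_limpt
proof (intro allI impI)
  fix x assume x: "x islimpt {x \<in> S. f x \<le> c}"
  then have "x islimpt S" by (rule islimpt_subset) auto
  with assms(2) have "x \<in> S" by (auto simp: closed_limpt)
  moreover have "f x \<le> c"
  proof (rule ccontr)
    assume "\<not> f x \<le> c"
    then have "ereal c < ereal (f x)" by simp
    also have "\<dots> \<le> Liminf (at x within S) (\<lambda>u. ereal (f u))"
      using assms(1) \<open>x \<in> S\<close> by (simp add: lsc_on_def)
    finally have "\<forall>\<^sub>F u in at x within S. ereal c < ereal (f u)"
      by (rule less_LiminfD)
    then obtain d where d: "d > 0" "\<And>u. u \<in> S \<Longrightarrow> u \<noteq> x \<Longrightarrow> dist u x < d \<Longrightarrow> c < f u"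
      by (auto simp: eventually_at)
    from x d(1) obtain u where "u \<in> S" "f u \<le> c" "u \<noteq> x" "dist u x < d"
      unfolding islimpt_approachable by blast
    with d(2)[of u] show False by simp
  qed
  ultimately show "x \<in> {x \<in> S. f x \<le> c}" by simp
qed

text \<open>
  The gap is \<open>G + J\<close> plus a supremum of continuous functions, hence Borel although the supremum
  ranges over an uncountable set.
\<close>

lemma (in saddle_problem) gap_measurable:
  assumes xa [measurable]: "xa \<in> borel_measurable M" and ya [measurable]: "ya \<in> borel_measurable M"
    and xa_in: "\<And>\<omega>. \<omega> \<in> space M \<Longrightarrow> xa \<omega> \<in> X" and ya_in: "\<And>\<omega>. \<omega> \<in> space M \<Longrightarrow> ya \<omega> \<in> Y"
  shows "(\<lambda>\<omega>. gap X Y G K J (xa \<omega>, ya \<omega>)) \<in> borel_measurable M"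
proof -
  define H where "H z' = (SUP z\<in>X \<times> Y. ereal (K (fst z') \<bullet> snd z - J (snd z) - G (fst z) - K (fst z) \<bullet> snd z'))"
    for z' :: "'a \<times> 'b"
  have contK: "continuous_on UNIV K"
    using K_linear by (simp add: linear_continuous_on linear_conv_bounded_linear)
  have [measurable]: "H \<in> borel_measurable borel"
  proof (rule borel_measurableI_greater)
    fix c
    have "{z' \<in> space borel. c < H z'} =
        (\<Union>z\<in>X \<times> Y. {z'. c < ereal (K (fst z') \<bullet> snd z - J (snd z) - G (fst z) - K (fst z) \<bullet> snd z')})"
      by (simp only: H_def less_SUP_iff space_borel) blast
    also have "open \<dots>"
      by (intro open_UN ballI open_Collect_less continuous_intros continuous_on_compose2[OF contK]) auto
    finally show "{z' \<in> space borel. c < H z'} \<in> sets borel" by simp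
  qed
  have "G \<in> borel_measurable (restrict_space borel X)"
    using G_gradient by (intro borel_measurable_continuous_on_restrict)
      (auto simp: gradient_on_def intro!: has_derivative_continuous_on)
  moreover have "xa \<in> M \<rightarrow>\<^sub>M restrict_space borel X"
    using xa xa_in by (intro measurable_restrict_space2) auto
  ultimately have [measurable]: "(\<lambda>\<omega>. G (xa \<omega>)) \<in> borel_measurable M"
    by (rule measurable_compose[rotated])
  have [measurable]: "(\<lambda>\<omega>. J (ya \<omega>)) \<in> borel_measurable M"
  proof (rule borel_measurableI_le)
    fix c
    have "{y \<in> Y. J y \<le> c} \<in> sets borel"
      using lsc_on_sublevel_closed[OF J_lsc Y.closed_S] by simp
    from measurable_sets[OF ya this] show "{\<omega> \<in> space M. J (ya \<omega>) \<le> c} \<in> sets M"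
      by (rule back_subst[of "\<lambda>A. A \<in> sets M"]) (use ya_in in auto)
  qed
  have "gap X Y G K J (xa \<omega>, ya \<omega>) = ereal (G (xa \<omega>) + J (ya \<omega>)) + H (xa \<omega>, ya \<omega>)" for \<omega>
  proof -
    have "gap X Y G K J (xa \<omega>, ya \<omega>) = (SUP z\<in>X \<times> Y. ereal (G (xa \<omega>) + J (ya \<omega>)) +
        ereal (K (xa \<omega>) \<bullet> snd z - J (snd z) - G (fst z) - K (fst z) \<bullet> ya \<omega>))"
      unfolding gap_def by (intro SUP_cong refl) (simp add: Q_gap_def)
    also have "\<dots> = ereal (G (xa \<omega>) + J (ya \<omega>)) + H (xa \<omega>, ya \<omega>)"
      unfolding H_def fst_conv snd_conv
      using X.nonempty_S Y.nonempty_S by (intro SUP_ereal_add_right) auto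
    finally show ?thesis .
  qed
  then show ?thesis by simp
qed

section \<open>The stochastic algorithm\<close>

locale stochastic_apd =
  saddle_problem nX X dX gX \<alpha>X VX \<Omega>X nY Y dY gY \<alpha>Y VY \<Omega>Y G gradG L_G K L_K J \<beta> \<theta> \<eta> \<tau> \<gamma> p q x1 y1 +
  call_samples M D \<xi>
  for nX :: "'a::euclidean_space \<Rightarrow> real" and X dX gX \<alpha>X VX \<Omega>X
    and nY :: "'b::euclidean_space \<Rightarrow> real" and Y dY gY \<alpha>Y VY \<Omega>Y G gradG L_G K L_K J \<beta> \<theta> \<eta> \<tau> \<gamma> p q x1 y1
    and M :: "'w measure" and D :: "'s measure" and \<xi> +
  fixes OG :: "'a \<Rightarrow> 's \<Rightarrow> 'a" and OKx :: "'a \<Rightarrow> 's \<Rightarrow> 'b" and OKy :: "'b \<Rightarrow> 's \<Rightarrow> 'a"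
    and x xmd xag xbar :: "nat \<Rightarrow> 'w \<Rightarrow> 'a" and y yag :: "nat \<Rightarrow> 'w \<Rightarrow> 'b"
  assumes unbiased: "unbiased_oracle D X OG gradG" "unbiased_oracle D (extrapolated X \<theta>) OKx K"
      "unbiased_oracle D Y OKy (adjoint K)"
    and run: "\<And>\<omega>. \<omega> \<in> space M \<Longrightarrow>
      APD_run X Y J VX VY \<beta> \<theta> \<eta> \<tau>
        (\<lambda>t u. OG u (\<xi> CallG t \<omega>)) (\<lambda>t u. OKx u (\<xi> CallKx t \<omega>)) (\<lambda>t v. OKy v (\<xi> CallKy t \<omega>))
        x1 y1 (\<lambda>t. x t \<omega>) (\<lambda>t. y t \<omega>) (\<lambda>t. xmd t \<omega>) (\<lambda>t. xag t \<omega>) (\<lambda>t. yag t \<omega>) (\<lambda>t. xbar t \<omega>)"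
begin

lemma path:
  assumes "\<omega> \<in> space M"
  shows "apd_path nX X dX gX \<alpha>X VX \<Omega>X nY Y dY gY \<alpha>Y VY \<Omega>Y G gradG L_G K L_K J \<beta> \<theta> \<eta> \<tau> \<gamma> p q x1 y1
    (\<lambda>t u. OG u (\<xi> CallG t \<omega>)) (\<lambda>t u. OKx u (\<xi> CallKx t \<omega>)) (\<lambda>t v. OKy v (\<xi> CallKy t \<omega>))
    (\<lambda>t. x t \<omega>) (\<lambda>t. xmd t \<omega>) (\<lambda>t. xag t \<omega>) (\<lambda>t. xbar t \<omega>) (\<lambda>t. y t \<omega>) (\<lambda>t. yag t \<omega>)"
  by unfold_locales (rule run[OF assms])

lemmas path_start = apd_path.start[OF path]
lemmas path_update = apd_path.update[OF path]
lemmas path_in = apd_path.x_in[OF path] apd_path.y_in[OF path] apd_path.xag_in[OF path]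
  apd_path.yag_in[OF path] apd_path.xmd_in[OF path] apd_path.xbar_in[OF path]

lemma past_measurable_mono: "f \<in> past k \<rightarrow>\<^sub>M N \<Longrightarrow> k \<le> l \<Longrightarrow> f \<in> past l \<rightarrow>\<^sub>M N"
  using past_mono[of k l] by (auto simp: measurable_def)

lemma past_measurable_M: "f \<in> past k \<rightarrow>\<^sub>M N \<Longrightarrow> f \<in> M \<rightarrow>\<^sub>M N"
  using sets_past[of k] by (auto simp: measurable_def)

lemma answer_measurable:
  assumes "unbiased_oracle D S Or f" "U \<in> borel_measurable (past k)" "k \<le> l" "t \<ge> 1" "3 * t + call_rank c < l"
  shows "(\<lambda>\<omega>. Or (U \<omega>) (\<xi> c t \<omega>)) \<in> borel_measurable (past l)"
proof -
  have [measurable]: "(\<lambda>(u, s). Or u s) \<in> borel_measurable (borel \<Otimes>\<^sub>M D)"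
    using assms(1) by (simp add: unbiased_oracle_def)
  note [measurable] = past_measurable_mono[OF assms(2,3)] sample_past[OF assms(4,5)]
  show ?thesis by measurable
qed

text \<open>
  Each prox step minimises a strongly convex function tilted by a vector that depends measurably on
  earlier data, so the new iterate is measurable. The dual step uses one new sample, the primal step
  all three of its iteration.
\<close>

lemma y_step_measurable:
  assumes t: "t \<ge> 1" and xbar_m: "xbar t \<in> borel_measurable (past (3 * t))"
    and y_m: "y t \<in> borel_measurable (past (3 * t))"
  shows "y (t + 1) \<in> borel_measurable (past (3 * t + 1))"
proof (rule Y.argmin_tilted_measurable)
  note [measurable] = past_measurable_mono[OF y_m, of "3 * t + 1"]
    answer_measurable[OF unbiased(2) xbar_m, of "3 * t + 1" t CallKx]
  let ?s = "\<lambda>\<omega>. - \<tau> t *\<^sub>R OKx (xbar t \<omega>) (\<xi> CallKx t \<omega>) - gY (y t \<omega>)"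
  let ?h = "\<lambda>v. \<tau> t * J v + dY v"
  show "?s \<in> borel_measurable (past (3 * t + 1))"
    using t by measurable
  show "strongly_convex_on Y nY \<alpha>Y ?h"
    unfolding strongly_convex_on_def
  proof (intro conjI ballI allI impI)
    fix a b :: 'b and r s :: real assume *: "a \<in> Y" "b \<in> Y" "0 \<le> r" "0 \<le> s" "r + s = 1"
    have "J (r *\<^sub>R a + s *\<^sub>R b) \<le> r * J a + s * J b"
      using J_convex * by (simp add: convex_on_def)
    then have "\<tau> t * J (r *\<^sub>R a + s *\<^sub>R b) \<le> \<tau> t * (r * J a + s * J b)"
      using \<tau>_pos[OF t] by (intro mult_left_mono) auto
    moreover have "dY (r *\<^sub>R a + s *\<^sub>R b) \<le> r * dY a + s * dY b - \<alpha>Y / 2 * r * s * (nY (a - b))\<^sup>2"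
      using Y.strongly_convex * unfolding strongly_convex_on_def by blast
    ultimately show "?h (r *\<^sub>R a + s *\<^sub>R b) \<le> r * ?h a + s * ?h b - \<alpha>Y / 2 * r * s * (nY (a - b))\<^sup>2"
      by (simp add: algebra_simps)
  qed (rule Y.convex_S)
  fix \<omega> assume "\<omega> \<in> space (past (3 * t + 1))"
  then have \<omega>: "\<omega> \<in> space M" by simp
  show y_in: "y (t + 1) \<omega> \<in> Y" using path_in(2)[OF \<omega>] by simp
  fix v assume v: "v \<in> Y"
  have "- OKx (xbar t \<omega>) (\<xi> CallKx t \<omega>) \<bullet> y (t + 1) \<omega> + J (y (t + 1) \<omega>) + 1 / \<tau> t * VY (y (t + 1) \<omega>) (y t \<omega>)
      \<le> - OKx (xbar t \<omega>) (\<xi> CallKx t \<omega>) \<bullet> v + J v + 1 / \<tau> t * VY v (y t \<omega>)"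
    using path_update(2)[OF \<omega> t] v unfolding is_arg_min_def by (meson not_le)
  then have "\<tau> t * (- OKx (xbar t \<omega>) (\<xi> CallKx t \<omega>) \<bullet> y (t + 1) \<omega> + J (y (t + 1) \<omega>) + 1 / \<tau> t * VY (y (t + 1) \<omega>) (y t \<omega>))
      \<le> \<tau> t * (- OKx (xbar t \<omega>) (\<xi> CallKx t \<omega>) \<bullet> v + J v + 1 / \<tau> t * VY v (y t \<omega>))"
    using \<tau>_pos[OF t] by (intro mult_left_mono) auto
  then show "?s \<omega> \<bullet> y (t + 1) \<omega> + ?h (y (t + 1) \<omega>) \<le> ?s \<omega> \<bullet> v + ?h v"
    using \<tau>_pos[OF t] Y.V_eq[OF y_in path_in(2)[OF \<omega> t]] Y.V_eq[OF v path_in(2)[OF \<omega> t]]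
    by (simp add: inner_diff_left inner_diff_right algebra_simps)
qed (rule Y.\<alpha>_pos)

lemma x_step_measurable:
  assumes t: "t \<ge> 1" and xmd_m: "xmd t \<in> borel_measurable (past (3 * t))"
    and x_m: "x t \<in> borel_measurable (past (3 * t))" and y_m: "y (t + 1) \<in> borel_measurable (past (3 * t + 1))"
  shows "x (t + 1) \<in> borel_measurable (past (3 * t + 3))"
proof (rule X.argmin_tilted_measurable[OF X.strongly_convex X.\<alpha>_pos])
  note [measurable] = past_measurable_mono[OF x_m, of "3 * t + 3"]
    answer_measurable[OF unbiased(1) xmd_m, of "3 * t + 3" t CallG]
    answer_measurable[OF unbiased(3) y_m, of "3 * t + 3" t CallKy]
  let ?a = "\<lambda>\<omega>. OG (xmd t \<omega>) (\<xi> CallG t \<omega>)" and ?b = "\<lambda>\<omega>. OKy (y (t + 1) \<omega>) (\<xi> CallKy t \<omega>)"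
  let ?s = "\<lambda>\<omega>. \<eta> t *\<^sub>R (?a \<omega> + ?b \<omega>) - gX (x t \<omega>)"
  show "?s \<in> borel_measurable (past (3 * t + 3))"
    using t by measurable
  fix \<omega> assume "\<omega> \<in> space (past (3 * t + 3))"
  then have \<omega>: "\<omega> \<in> space M" by simp
  show x_in: "x (t + 1) \<omega> \<in> X" using path_in(1)[OF \<omega>] by simp
  fix u assume u: "u \<in> X"
  have "?a \<omega> \<bullet> x (t + 1) \<omega> + x (t + 1) \<omega> \<bullet> ?b \<omega> + 1 / \<eta> t * VX (x (t + 1) \<omega>) (x t \<omega>)
      \<le> ?a \<omega> \<bullet> u + u \<bullet> ?b \<omega> + 1 / \<eta> t * VX u (x t \<omega>)"
    using path_update(3)[OF \<omega> t] u unfolding is_arg_min_def by (meson not_le)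
  then have "\<eta> t * (?a \<omega> \<bullet> x (t + 1) \<omega> + x (t + 1) \<omega> \<bullet> ?b \<omega> + 1 / \<eta> t * VX (x (t + 1) \<omega>) (x t \<omega>))
      \<le> \<eta> t * (?a \<omega> \<bullet> u + u \<bullet> ?b \<omega> + 1 / \<eta> t * VX u (x t \<omega>))"
    using \<eta>_pos[OF t] by (intro mult_left_mono) auto
  then show "?s \<omega> \<bullet> x (t + 1) \<omega> + dX (x (t + 1) \<omega>) \<le> ?s \<omega> \<bullet> u + dX u"
    using \<eta>_pos[OF t] X.V_eq[OF x_in path_in(1)[OF \<omega> t]] X.V_eq[OF u path_in(1)[OF \<omega> t]]
    by (simp add: inner_diff_left inner_diff_right inner_add_left inner_add_right distrib_left inner_commute)
qed

lemma xmd_measurable: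
  assumes t: "t \<ge> 1" and [measurable]: "xag t \<in> borel_measurable (past k)" "x t \<in> borel_measurable (past k)"
  shows "xmd t \<in> borel_measurable (past k)"
proof -
  have "(\<lambda>\<omega>. (1 - 1 / \<beta> t) *\<^sub>R xag t \<omega> + (1 / \<beta> t) *\<^sub>R x t \<omega>) \<in> borel_measurable (past k)"
    by measurable
  then show ?thesis
    by (rule measurable_cong[THEN iffD1, rotated]) (simp add: path_update(1)[OF _ t])
qed

lemma constant_past:
  fixes z :: "'w \<Rightarrow> 'c::euclidean_space"
  shows "(\<And>\<omega>. \<omega> \<in> space M \<Longrightarrow> z \<omega> = c) \<Longrightarrow> z \<in> borel_measurable (past k)"
  by (subst measurable_cong[of _ _ "\<lambda>_. c"]) auto

lemma iterates_measurable:
  assumes "t \<ge> 1"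
  shows "x t \<in> borel_measurable (past (3 * t)) \<and> xag t \<in> borel_measurable (past (3 * t)) \<and>
    xbar t \<in> borel_measurable (past (3 * t)) \<and> y t \<in> borel_measurable (past (3 * t)) \<and>
    yag t \<in> borel_measurable (past (3 * t))"
  using assms
proof (induction t rule: dec_induct)
  case base
  show ?case
    by (intro conjI constant_past) (rule path_start, assumption)+
next
  case (step t)
  have [measurable]: "x t \<in> borel_measurable (past (3 * (t + 1)))" "xag t \<in> borel_measurable (past (3 * (t + 1)))"
    "yag t \<in> borel_measurable (past (3 * (t + 1)))"
    using step.IH by (auto intro: past_measurable_mono)
  have y': "y (t + 1) \<in> borel_measurable (past (3 * t + 1))"
    using step by (intro y_step_measurable) auto
  then have [measurable]: "y (t + 1) \<in> borel_measurable (past (3 * (t + 1)))"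
    by (rule past_measurable_mono) simp
  have "x (t + 1) \<in> borel_measurable (past (3 * t + 3))"
    using step y' by (intro x_step_measurable xmd_measurable) auto
  then have [measurable]: "x (t + 1) \<in> borel_measurable (past (3 * (t + 1)))"
    by (rule past_measurable_mono) simp
  have "xag (t + 1) \<in> borel_measurable (past (3 * (t + 1)))"
  proof -
    have "(\<lambda>\<omega>. (1 - 1 / \<beta> t) *\<^sub>R xag t \<omega> + (1 / \<beta> t) *\<^sub>R x (t + 1) \<omega>) \<in> borel_measurable (past (3 * (t + 1)))"
      by measurable
    then show ?thesis
      by (rule measurable_cong[THEN iffD1, rotated]) (rule path_update(4)[OF _ step.hyps(1), symmetric], simp)
  qed
  moreover have "yag (t + 1) \<in> borel_measurable (past (3 * (t + 1)))"
  proof -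
    have "(\<lambda>\<omega>. (1 - 1 / \<beta> t) *\<^sub>R yag t \<omega> + (1 / \<beta> t) *\<^sub>R y (t + 1) \<omega>) \<in> borel_measurable (past (3 * (t + 1)))"
      by measurable
    then show ?thesis
      by (rule measurable_cong[THEN iffD1, rotated]) (rule path_update(5)[OF _ step.hyps(1), symmetric], simp)
  qed
  moreover have "xbar (t + 1) \<in> borel_measurable (past (3 * (t + 1)))"
  proof -
    have "(\<lambda>\<omega>. \<theta> (t + 1) *\<^sub>R (x (t + 1) \<omega> - x t \<omega>) + x (t + 1) \<omega>) \<in> borel_measurable (past (3 * (t + 1)))"
      by measurable
    then show ?thesis
      by (rule measurable_cong[THEN iffD1, rotated]) (rule path_update(6)[OF _ step.hyps(1), symmetric], simp)
  qed
  ultimately show ?case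
    using \<open>x (t + 1) \<in> borel_measurable (past (3 * (t + 1)))\<close> \<open>y (t + 1) \<in> borel_measurable (past (3 * (t + 1)))\<close>
    by simp
qed

lemma query_G_measurable: "t \<ge> 1 \<Longrightarrow> xmd t \<in> borel_measurable (past (3 * t))"
  using iterates_measurable[of t] by (intro xmd_measurable) auto

lemma query_Ky_measurable: "t \<ge> 1 \<Longrightarrow> y (t + 1) \<in> borel_measurable (past (3 * t + 1))"
  using iterates_measurable[of t] by (intro y_step_measurable) auto

sublocale GQ: oracle_queries M "\<lambda>t. past (3 * t + call_rank CallG)" D "\<xi> CallG" X OG gradG xmd
proof (intro oracle_queries.intro fresh oracle_queries_axioms.intro unbiased)
  show "xmd t \<in> borel_measurable (past (3 * t + call_rank CallG))" if "t \<ge> 1" for t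
    by (rule past_measurable_mono[OF query_G_measurable[OF that]]) simp
qed (rule path_in)

sublocale KxQ: oracle_queries M "\<lambda>t. past (3 * t + call_rank CallKx)" D "\<xi> CallKx" "extrapolated X \<theta>" OKx K xbar
  using iterates_measurable
  by (intro oracle_queries.intro fresh oracle_queries_axioms.intro unbiased path_in) auto

sublocale KyQ: oracle_queries M "\<lambda>t. past (3 * t + call_rank CallKy)" D "\<xi> CallKy" Y OKy "adjoint K" "\<lambda>t. y (Suc t)"
proof (intro oracle_queries.intro fresh oracle_queries_axioms.intro unbiased)
  show "y (Suc t) \<in> borel_measurable (past (3 * t + call_rank CallKy))" if "t \<ge> 1" for t
    using query_Ky_measurable[OF that] by (auto intro: past_measurable_mono)
  show "y (Suc t) \<omega> \<in> Y" if "\<omega> \<in> space M" for t \<omega>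
    using path_in(2)[OF that] by simp
qed

text \<open>
  The quantities of the estimate along one run, now as functions of the outcome. The shadow of
  iteration \<open>t\<close> uses the noise of earlier iterations only; \<open>dir_Ky\<close> uses the gradient noise of
  iteration \<open>t\<close> as well, which is why the oracle for \<open>adjoint K\<close> comes last in the order of the calls.
\<close>

definition shadow_x_at :: "nat \<Rightarrow> 'w \<Rightarrow> 'a" where
  "shadow_x_at t \<omega> = shadow_x (\<lambda>i. GQ.noise i \<omega>) (\<lambda>i. KyQ.noise i \<omega>) t"

definition shadow_y_at :: "nat \<Rightarrow> 'w \<Rightarrow> 'b" where
  "shadow_y_at t \<omega> = shadow_y (\<lambda>i. KxQ.noise i \<omega>) t"

definition dir_G :: "nat \<Rightarrow> 'w \<Rightarrow> 'a" where
  "dir_G t \<omega> = shadow_x_at t \<omega> - x t \<omega>"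

definition dir_Ky :: "nat \<Rightarrow> 'w \<Rightarrow> 'a" where
  "dir_Ky t \<omega> = X.prox_step (\<eta> t) (- GQ.noise t \<omega>) (shadow_x_at t \<omega>)
     - X.prox_step (\<eta> t / (1 - q)) (GQ.noise t \<omega>) (x t \<omega>)"

definition dir_Kx :: "nat \<Rightarrow> 'w \<Rightarrow> 'b" where
  "dir_Kx t \<omega> = y t \<omega> - shadow_y_at t \<omega>"

lemma noise_past:
  assumes "t \<ge> 1"
  shows "GQ.noise t \<in> borel_measurable (past (3 * t + 2))" "KxQ.noise t \<in> borel_measurable (past (3 * t + 1))"
    "KyQ.noise t \<in> borel_measurable (past (3 * t + 3))"
proof -
  have "(\<lambda>\<omega>. OG (xmd t \<omega>) (\<xi> CallG t \<omega>)) \<in> borel_measurable (past (3 * t + 2))"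
    by (rule answer_measurable[OF unbiased(1) query_G_measurable]) (use assms in auto)
  moreover have "(\<lambda>\<omega>. gradG (xmd t \<omega>)) \<in> borel_measurable (past (3 * t + 2))"
    by (rule past_measurable_mono[OF GQ.truth_measurable[OF assms]]) simp
  ultimately show "GQ.noise t \<in> borel_measurable (past (3 * t + 2))"
    unfolding GQ.noise_def by (rule borel_measurable_diff)
  have "(\<lambda>\<omega>. OKx (xbar t \<omega>) (\<xi> CallKx t \<omega>)) \<in> borel_measurable (past (3 * t + 1))"
    by (rule answer_measurable[OF unbiased(2), of _ "3 * t"]) (use assms iterates_measurable in auto)
  moreover have "(\<lambda>\<omega>. K (xbar t \<omega>)) \<in> borel_measurable (past (3 * t + 1))"
    by (rule past_measurable_mono[OF KxQ.truth_measurable[OF assms]]) simp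
  ultimately show "KxQ.noise t \<in> borel_measurable (past (3 * t + 1))"
    unfolding KxQ.noise_def by (rule borel_measurable_diff)
  have "(\<lambda>\<omega>. OKy (y (Suc t) \<omega>) (\<xi> CallKy t \<omega>)) \<in> borel_measurable (past (3 * t + 3))"
    by (rule answer_measurable[OF unbiased(3), of _ "3 * t + 1"]) (use assms query_Ky_measurable in auto)
  moreover have "(\<lambda>\<omega>. adjoint K (y (Suc t) \<omega>)) \<in> borel_measurable (past (3 * t + 3))"
    by (rule past_measurable_mono[OF KyQ.truth_measurable[OF assms]]) simp
  ultimately show "KyQ.noise t \<in> borel_measurable (past (3 * t + 3))"
    unfolding KyQ.noise_def by (rule borel_measurable_diff)
qed

lemma shadow_measurable:
  assumes "t \<ge> 1"
  shows "shadow_x_at t \<in> borel_measurable (past (3 * t)) \<and> shadow_y_at t \<in> borel_measurable (past (3 * t))"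
  using assms
proof (induction t rule: dec_induct)
  case base
  show ?case by (simp add: shadow_x_at_def[abs_def] shadow_y_at_def[abs_def])
next
  case (step t)
  have [measurable]: "shadow_x_at t \<in> borel_measurable (past (3 * (t + 1)))"
    "shadow_y_at t \<in> borel_measurable (past (3 * (t + 1)))"
    using step.IH by (auto intro: past_measurable_mono)
  have [measurable]: "GQ.noise t \<in> borel_measurable (past (3 * (t + 1)))"
    "KxQ.noise t \<in> borel_measurable (past (3 * (t + 1)))" "KyQ.noise t \<in> borel_measurable (past (3 * (t + 1)))"
    using noise_past[OF step.hyps(1)] by (auto intro: past_measurable_mono)
  have "shadow_x_at (t + 1) = (\<lambda>\<omega>. X.prox_step (\<eta> t) (- KyQ.noise t \<omega>)
      (X.prox_step (\<eta> t) (- GQ.noise t \<omega>) (shadow_x_at t \<omega>)))"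
    "shadow_y_at (t + 1) = (\<lambda>\<omega>. Y.prox_step (\<tau> t) (KxQ.noise t \<omega>) (shadow_y_at t \<omega>))"
    using step.hyps(1) by (auto simp: shadow_x_at_def shadow_y_at_def fun_eq_iff)
  note eq = this
  have "shadow_x_at (t + 1) \<in> borel_measurable (past (3 * (t + 1)))"
    "shadow_y_at (t + 1) \<in> borel_measurable (past (3 * (t + 1)))"
    unfolding eq by measurable
  then show ?case by (simp only: Suc_eq_plus1 simp_thms)
qed

sublocale GC: oracle_calls M "\<lambda>t. past (3 * t + call_rank CallG)" D "\<xi> CallG" X OG gradG xmd
  nX dir_G "sqrt 2 * \<Omega>X / sqrt \<alpha>X" \<gamma>
proof unfold_locales
  fix t :: nat assume t: "t \<ge> 1"
  have [measurable]: "shadow_x_at t \<in> borel_measurable (past (3 * t + call_rank CallG))"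
    "x t \<in> borel_measurable (past (3 * t + call_rank CallG))"
    using shadow_measurable[OF t] iterates_measurable[OF t] by (auto intro: past_measurable_mono)
  show "dir_G t \<in> borel_measurable (past (3 * t + call_rank CallG))"
    unfolding dir_G_def by measurable
  fix \<omega> assume "\<omega> \<in> space M"
  with t show "nX (dir_G t \<omega>) \<le> sqrt 2 * \<Omega>X / sqrt \<alpha>X"
    unfolding dir_G_def shadow_x_at_def by (intro X.diameter shadow_x_in path_in)
qed (use X.\<Omega>_pos X.\<alpha>_pos \<gamma>_pos in auto)

sublocale KyC: oracle_calls M "\<lambda>t. past (3 * t + call_rank CallKy)" D "\<xi> CallKy" Y OKy "adjoint K" "\<lambda>t. y (Suc t)"
  nX dir_Ky "sqrt 2 * \<Omega>X / sqrt \<alpha>X" \<gamma>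
proof unfold_locales
  fix t :: nat assume t: "t \<ge> 1"
  have [measurable]: "shadow_x_at t \<in> borel_measurable (past (3 * t + call_rank CallKy))"
    "x t \<in> borel_measurable (past (3 * t + call_rank CallKy))"
    "GQ.noise t \<in> borel_measurable (past (3 * t + call_rank CallKy))"
    using shadow_measurable[OF t] iterates_measurable[OF t] noise_past[OF t]
    by (auto intro: past_measurable_mono)
  show "dir_Ky t \<in> borel_measurable (past (3 * t + call_rank CallKy))"
    unfolding dir_Ky_def by measurable
  show "nX (dir_Ky t \<omega>) \<le> sqrt 2 * \<Omega>X / sqrt \<alpha>X" for \<omega>
    unfolding dir_Ky_def by (intro X.diameter X.prox_step_in)
qed (use X.\<Omega>_pos X.\<alpha>_pos \<gamma>_pos in auto)

sublocale KxC: oracle_calls M "\<lambda>t. past (3 * t + call_rank CallKx)" D "\<xi> CallKx" "extrapolated X \<theta>" OKx K xbar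
  nY dir_Kx "sqrt 2 * \<Omega>Y / sqrt \<alpha>Y" \<gamma>
proof unfold_locales
  fix t :: nat assume t: "t \<ge> 1"
  have [measurable]: "shadow_y_at t \<in> borel_measurable (past (3 * t + call_rank CallKx))"
    "y t \<in> borel_measurable (past (3 * t + call_rank CallKx))"
    using shadow_measurable[OF t] iterates_measurable[OF t] by (auto intro: past_measurable_mono)
  show "dir_Kx t \<in> borel_measurable (past (3 * t + call_rank CallKx))"
    unfolding dir_Kx_def by measurable
  fix \<omega> assume "\<omega> \<in> space M"
  with t show "nY (dir_Kx t \<omega>) \<le> sqrt 2 * \<Omega>Y / sqrt \<alpha>Y"
    unfolding dir_Kx_def shadow_y_at_def by (intro Y.diameter shadow_y_in path_in)
qed (use Y.\<Omega>_pos Y.\<alpha>_pos \<gamma>_pos in auto)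

definition gap_at :: "nat \<Rightarrow> 'w \<Rightarrow> ereal" where
  "gap_at t \<omega> = gap X Y G K J (xag (t + 1) \<omega>, yag (t + 1) \<omega>)"

lemma gap_at_measurable:
  assumes "t \<ge> 1"
  shows "gap_at t \<in> borel_measurable M"
  unfolding gap_at_def
proof (rule gap_measurable)
  show "xag (t + 1) \<in> borel_measurable M" "yag (t + 1) \<in> borel_measurable M"
    using iterates_measurable[of "t + 1"] by (auto intro: past_measurable_M)
  show "xag (t + 1) \<omega> \<in> X" "yag (t + 1) \<omega> \<in> Y" if "\<omega> \<in> space M" for \<omega>
    using path_in(3,4)[OF that] by auto
qed

lemma gap_at_nonneg: "t \<ge> 1 \<Longrightarrow> \<omega> \<in> space M \<Longrightarrow> gap_at t \<omega> \<ge> 0"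
  unfolding gap_at_def by (rule apd_path.gap_nonneg[OF path])

definition coeff_x :: "nat \<Rightarrow> real" where
  "coeff_x i = (2 - q) * \<eta> i * \<gamma> i / ((1 - q) * \<alpha>X)"

definition coeff_y :: "nat \<Rightarrow> real" where
  "coeff_y i = (2 - p) * \<tau> i * \<gamma> i / ((1 - p) * \<alpha>Y)"

lemma coeff_pos: "i \<ge> 1 \<Longrightarrow> coeff_x i > 0" "i \<ge> 1 \<Longrightarrow> coeff_y i > 0"
  unfolding coeff_x_def coeff_y_def
  using pq \<eta>_pos \<tau>_pos \<gamma>_pos X.\<alpha>_pos Y.\<alpha>_pos by (intro divide_pos_pos mult_pos_pos; simp)+

definition diameter_term :: "nat \<Rightarrow> real" where
  "diameter_term t = 1 / (\<beta> t * \<gamma> t) * (2 * \<gamma> t / \<eta> t * \<Omega>X\<^sup>2 + 2 * \<gamma> t / \<tau> t * \<Omega>Y\<^sup>2)"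

definition square_term :: "nat \<Rightarrow> 'w \<Rightarrow> real" where
  "square_term t \<omega> = (\<Sum>i=1..t. coeff_x i * (dual_norm nX (GQ.noise i \<omega>))\<^sup>2)
     + (\<Sum>i=1..t. coeff_x i * (dual_norm nX (KyQ.noise i \<omega>))\<^sup>2)
     + (\<Sum>i=1..t. coeff_y i * (dual_norm nY (KxQ.noise i \<omega>))\<^sup>2)"

definition linear_term :: "nat \<Rightarrow> 'w \<Rightarrow> real" where
  "linear_term t \<omega> = (\<Sum>i=1..t. \<gamma> i * (GQ.noise i \<omega> \<bullet> dir_G i \<omega>))
     + (\<Sum>i=1..t. \<gamma> i * (KyQ.noise i \<omega> \<bullet> dir_Ky i \<omega>))
     + (\<Sum>i=1..t. \<gamma> i * (KxQ.noise i \<omega> \<bullet> dir_Kx i \<omega>))"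

lemma gap_at_le:
  assumes t: "t \<ge> 1" and \<omega>: "\<omega> \<in> space M"
  shows "gap_at t \<omega> \<le> ereal (diameter_term t + 1 / (2 * \<beta> t * \<gamma> t) * square_term t \<omega> + 1 / (\<beta> t * \<gamma> t) * linear_term t \<omega>)"
proof -
  interpret path: apd_path nX X dX gX \<alpha>X VX \<Omega>X nY Y dY gY \<alpha>Y VY \<Omega>Y G gradG L_G K L_K J \<beta> \<theta> \<eta> \<tau> \<gamma> p q x1 y1
    "\<lambda>t u. OG u (\<xi> CallG t \<omega>)" "\<lambda>t u. OKx u (\<xi> CallKx t \<omega>)" "\<lambda>t v. OKy v (\<xi> CallKy t \<omega>)"
    "\<lambda>t. x t \<omega>" "\<lambda>t. xmd t \<omega>" "\<lambda>t. xag t \<omega>" "\<lambda>t. xbar t \<omega>" "\<lambda>t. y t \<omega>" "\<lambda>t. yag t \<omega>"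
    by (rule path[OF \<omega>])
  have noise: "path.noise_G = (\<lambda>i. GQ.noise i \<omega>)" "path.noise_Kx = (\<lambda>i. KxQ.noise i \<omega>)"
    "path.noise_Ky = (\<lambda>i. KyQ.noise i \<omega>)"
    by (simp_all add: fun_eq_iff path.noise_G_def path.noise_Kx_def path.noise_Ky_def
          GQ.noise_def KxQ.noise_def KyQ.noise_def)
  have dir: "path.dir_G i = dir_G i \<omega>" "path.dir_Ky i = dir_Ky i \<omega>" "path.dir_Kx i = dir_Kx i \<omega>" for i
    unfolding path.dir_G_def path.dir_Ky_def path.dir_Kx_def dir_G_def dir_Ky_def dir_Kx_def
      shadow_x_at_def shadow_y_at_def noise by simp_all
  have "(\<Sum>i=1..t. path.noise_square i) = square_term t \<omega>"
    unfolding path.noise_square_def square_term_def noise coeff_x_def coeff_y_def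
    by (simp only: distrib_left sum.distrib)
  moreover have "(\<Sum>i=1..t. path.noise_linear i) = linear_term t \<omega>"
    unfolding path.noise_linear_def linear_term_def noise dir by (simp only: sum.distrib)
  ultimately show ?thesis
    using path.gap_le[OF t] unfolding gap_at_def diameter_term_def by simp
qed

definition bound_mean :: "real \<Rightarrow> real \<Rightarrow> nat \<Rightarrow> real" where
  "bound_mean \<sigma>x \<sigma>y t = diameter_term t + 1 / (2 * \<beta> t * \<gamma> t) * (\<Sum>i=1..t. coeff_x i * \<sigma>x\<^sup>2 + coeff_y i * \<sigma>y\<^sup>2)"

lemma expected_gap_le:
  assumes var: "bounded_variance D nX X OG gradG \<sigma>xG" "bounded_variance D nY (extrapolated X \<theta>) OKx K \<sigma>y"
      "bounded_variance D nX Y OKy (adjoint K) \<sigma>xK"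
    and \<sigma>x: "\<sigma>x\<^sup>2 = \<sigma>xG\<^sup>2 + \<sigma>xK\<^sup>2" and t: "t \<ge> 1"
  shows "(\<integral>\<^sup>+ \<omega>. e2ennreal (gap_at t \<omega>) \<partial>M) \<le> ennreal (bound_mean \<sigma>x \<sigma>y t)"
proof -
  let ?R = "\<lambda>\<omega>. diameter_term t + 1 / (2 * \<beta> t * \<gamma> t) * square_term t \<omega> + 1 / (\<beta> t * \<gamma> t) * linear_term t \<omega>"
  have pos: "2 * \<beta> t * \<gamma> t > 0" using \<beta>_ge_1[OF t] \<gamma>_pos[OF t] by auto
  have sq_i: "integrable M (\<lambda>\<omega>. \<Sum>i=1..t. coeff_x i * (dual_norm nX (GQ.noise i \<omega>))\<^sup>2)"
    "integrable M (\<lambda>\<omega>. \<Sum>i=1..t. coeff_x i * (dual_norm nX (KyQ.noise i \<omega>))\<^sup>2)"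
    "integrable M (\<lambda>\<omega>. \<Sum>i=1..t. coeff_y i * (dual_norm nY (KxQ.noise i \<omega>))\<^sup>2)"
    by (intro Bochner_Integration.integrable_sum integrable_mult_right
        GC.noise_second_moment(1)[OF var(1)] KyC.noise_second_moment(1)[OF var(3)] KxC.noise_second_moment(1)[OF var(2)]; simp)+
  then have sq_int: "integrable M (square_term t)"
    unfolding square_term_def by (intro Bochner_Integration.integrable_add)
  have lin_i: "integrable M (\<lambda>\<omega>. \<Sum>i=1..t. \<gamma> i * (GQ.noise i \<omega> \<bullet> dir_G i \<omega>))"
    "integrable M (\<lambda>\<omega>. \<Sum>i=1..t. \<gamma> i * (KyQ.noise i \<omega> \<bullet> dir_Ky i \<omega>))"
    "integrable M (\<lambda>\<omega>. \<Sum>i=1..t. \<gamma> i * (KxQ.noise i \<omega> \<bullet> dir_Kx i \<omega>))"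
    by (intro Bochner_Integration.integrable_sum integrable_mult_right
        GC.noise_inner_mean(1)[OF var(1)] KyC.noise_inner_mean(1)[OF var(3)] KxC.noise_inner_mean(1)[OF var(2)]; simp)+
  then have lin_int: "integrable M (linear_term t)"
    unfolding linear_term_def by (intro Bochner_Integration.integrable_add)
  have R_int: "integrable M ?R" using sq_int lin_int by simp
  have sum_le: "(LINT \<omega>|M. (\<Sum>i=1..t. c i * f i \<omega>)) \<le> (\<Sum>i=1..t. c i * s)"
    if "\<And>i. i \<ge> 1 \<Longrightarrow> integrable M (f i)" "\<And>i. i \<ge> 1 \<Longrightarrow> (LINT \<omega>|M. f i \<omega>) \<le> s" "\<And>i. i \<ge> 1 \<Longrightarrow> c i > 0"
    for c :: "nat \<Rightarrow> real" and f s
    using that by (subst Bochner_Integration.integral_sum) (auto intro!: sum_mono mult_left_mono simp: less_imp_le)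
  have sq: "(LINT \<omega>|M. square_term t \<omega>) \<le> (\<Sum>i=1..t. coeff_x i * \<sigma>xG\<^sup>2) + (\<Sum>i=1..t. coeff_x i * \<sigma>xK\<^sup>2) + (\<Sum>i=1..t. coeff_y i * \<sigma>y\<^sup>2)"
    unfolding square_term_def
    by (subst Bochner_Integration.integral_add[OF Bochner_Integration.integrable_add[OF sq_i(1,2)] sq_i(3)],
        subst Bochner_Integration.integral_add[OF sq_i(1,2)])
      (intro add_mono sum_le coeff_pos GC.noise_second_moment[OF var(1)] KyC.noise_second_moment[OF var(3)] KxC.noise_second_moment[OF var(2)])
  have zero: "(LINT \<omega>|M. (\<Sum>i=1..t. \<gamma> i * f i \<omega>)) = 0"
    if "\<And>i. i \<ge> 1 \<Longrightarrow> integrable M (f i)" "\<And>i. i \<ge> 1 \<Longrightarrow> (LINT \<omega>|M. f i \<omega>) = 0" for f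
    using that by (subst Bochner_Integration.integral_sum) auto
  have lin: "(LINT \<omega>|M. linear_term t \<omega>) = 0"
    unfolding linear_term_def
      Bochner_Integration.integral_add[OF Bochner_Integration.integrable_add[OF lin_i(1,2)] lin_i(3)]
      Bochner_Integration.integral_add[OF lin_i(1,2)]
    by (subst zero, (rule GC.noise_inner_mean[OF var(1)]; assumption)+,
        subst zero, (rule KyC.noise_inner_mean[OF var(3)]; assumption)+,
        subst zero, (rule KxC.noise_inner_mean[OF var(2)]; assumption)+, simp)
  have R_nonneg: "0 \<le> ?R \<omega>" if "\<omega> \<in> space M" for \<omega>
    using order.trans[OF gap_at_nonneg[OF t that] gap_at_le[OF t that]] by (simp add: zero_ereal_def)
  have "(\<integral>\<^sup>+ \<omega>. e2ennreal (gap_at t \<omega>) \<partial>M) \<le> (\<integral>\<^sup>+ \<omega>. ennreal (?R \<omega>) \<partial>M)"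
    using gap_at_le[OF t] by (intro nn_integral_mono) (metis e2ennreal_mono e2ennreal_ereal)
  also have "\<dots> = ennreal (LINT \<omega>|M. ?R \<omega>)"
    by (intro nn_integral_eq_integral R_int AE_I2 R_nonneg)
  also have "(LINT \<omega>|M. ?R \<omega>) = diameter_term t + 1 / (2 * \<beta> t * \<gamma> t) * (LINT \<omega>|M. square_term t \<omega>)"
    using sq_int lin_int lin by (simp add: prob_space)
  also have "\<dots> \<le> bound_mean \<sigma>x \<sigma>y t"
  proof -
    have "(\<Sum>i=1..t. coeff_x i * \<sigma>xG\<^sup>2) + (\<Sum>i=1..t. coeff_x i * \<sigma>xK\<^sup>2) + (\<Sum>i=1..t. coeff_y i * \<sigma>y\<^sup>2)
        = (\<Sum>i=1..t. coeff_x i * \<sigma>x\<^sup>2 + coeff_y i * \<sigma>y\<^sup>2)"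
      unfolding \<sigma>x by (simp only: distrib_left sum.distrib)
    with sq pos show ?thesis
      unfolding bound_mean_def by (intro add_left_mono mult_left_mono) auto
  qed
  finally show ?thesis by (simp add: ennreal_leI)
qed

definition bound_deviation :: "real \<Rightarrow> real \<Rightarrow> nat \<Rightarrow> real" where
  "bound_deviation \<sigma>x \<sigma>y t =
     1 / (\<beta> t * \<gamma> t) * (sqrt 2 * \<sigma>x * \<Omega>X / sqrt \<alpha>X + \<sigma>y * \<Omega>Y / sqrt \<alpha>Y) * sqrt (2 * (\<Sum>i=1..t. (\<gamma> i)\<^sup>2))
     + 1 / (2 * \<beta> t * \<gamma> t) * (\<Sum>i=1..t. coeff_x i * \<sigma>x\<^sup>2 + coeff_y i * \<sigma>y\<^sup>2)"

lemma prob_gap_gt: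
  assumes lt: "light_tail D nX X OG gradG \<sigma>xG" "light_tail D nY (extrapolated X \<theta>) OKx K \<sigma>y"
      "light_tail D nX Y OKy (adjoint K) \<sigma>xK"
    and \<sigma>: "\<sigma>xG \<ge> 0" "\<sigma>y \<ge> 0" "\<sigma>xK \<ge> 0" "\<sigma>x = sqrt (\<sigma>xG\<^sup>2 + \<sigma>xK\<^sup>2)" and t: "t \<ge> 1" and lam: "lam > 0"
  shows "prob {\<omega> \<in> space M. gap_at t \<omega> > ereal (bound_mean \<sigma>x \<sigma>y t + lam * bound_deviation \<sigma>x \<sigma>y t)}
    \<le> 3 * exp (- (lam\<^sup>2 / 3)) + 3 * exp (- lam)"
proof -
  let ?RX = "sqrt 2 * \<Omega>X / sqrt \<alpha>X" and ?RY = "sqrt 2 * \<Omega>Y / sqrt \<alpha>Y"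
  let ?S = "sqrt (\<Sum>i=1..t. (\<gamma> i)\<^sup>2)"
  define L1 where "L1 = {\<omega> \<in> space M. (\<Sum>i=1..t. \<gamma> i * (GQ.noise i \<omega> \<bullet> dir_G i \<omega>)) > lam * (?RX * \<sigma>xG * ?S)}"
  define L2 where "L2 = {\<omega> \<in> space M. (\<Sum>i=1..t. \<gamma> i * (KyQ.noise i \<omega> \<bullet> dir_Ky i \<omega>)) > lam * (?RX * \<sigma>xK * ?S)}"
  define L3 where "L3 = {\<omega> \<in> space M. (\<Sum>i=1..t. \<gamma> i * (KxQ.noise i \<omega> \<bullet> dir_Kx i \<omega>)) > lam * (?RY * \<sigma>y * ?S)}"
  define S1 where "S1 = {\<omega> \<in> space M. (\<Sum>i=1..t. coeff_x i * (dual_norm nX (GQ.noise i \<omega>))\<^sup>2) > (1 + lam) * (\<Sum>i=1..t. coeff_x i * \<sigma>xG\<^sup>2)}"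
  define S2 where "S2 = {\<omega> \<in> space M. (\<Sum>i=1..t. coeff_x i * (dual_norm nX (KyQ.noise i \<omega>))\<^sup>2) > (1 + lam) * (\<Sum>i=1..t. coeff_x i * \<sigma>xK\<^sup>2)}"
  define S3 where "S3 = {\<omega> \<in> space M. (\<Sum>i=1..t. coeff_y i * (dual_norm nY (KxQ.noise i \<omega>))\<^sup>2) > (1 + lam) * (\<Sum>i=1..t. coeff_y i * \<sigma>y\<^sup>2)}"
  note events_def = L1_def L2_def L3_def S1_def S2_def S3_def
  have [measurable]: "GQ.noise i \<in> borel_measurable M" "KyQ.noise i \<in> borel_measurable M" "KxQ.noise i \<in> borel_measurable M"
    "dir_G i \<in> borel_measurable M" "dir_Ky i \<in> borel_measurable M" "dir_Kx i \<in> borel_measurable M"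
    if "i \<in> {1..t}" for i
    using that by (auto intro: GQ.noise_measurable_M KyQ.noise_measurable_M KxQ.noise_measurable_M
        GC.direction_measurable_M KyC.direction_measurable_M KxC.direction_measurable_M)
  have ev [measurable]: "L1 \<in> events" "L2 \<in> events" "L3 \<in> events" "S1 \<in> events" "S2 \<in> events" "S3 \<in> events"
    unfolding events_def by measurable
  have "{\<omega> \<in> space M. gap_at t \<omega> > ereal (bound_mean \<sigma>x \<sigma>y t + lam * bound_deviation \<sigma>x \<sigma>y t)}
      \<subseteq> L1 \<union> L2 \<union> L3 \<union> (S1 \<union> S2 \<union> S3)"
  proof (rule subsetI, rule ccontr)
    fix \<omega> assume *: "\<omega> \<in> {\<omega> \<in> space M. gap_at t \<omega> > ereal (bound_mean \<sigma>x \<sigma>y t + lam * bound_deviation \<sigma>x \<sigma>y t)}"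
      and no: "\<omega> \<notin> L1 \<union> L2 \<union> L3 \<union> (S1 \<union> S2 \<union> S3)"
    from * have \<omega>: "\<omega> \<in> space M" by simp
    let ?c = "\<beta> t * \<gamma> t"
    let ?Q = "\<Sum>i=1..t. coeff_x i * \<sigma>x\<^sup>2 + coeff_y i * \<sigma>y\<^sup>2"
    have c: "?c > 0" using \<beta>_ge_1[OF t] \<gamma>_pos[OF t] by simp
    have \<sigma>x2: "\<sigma>x\<^sup>2 = \<sigma>xG\<^sup>2 + \<sigma>xK\<^sup>2" using \<sigma>(4) by simp
    have "square_term t \<omega> \<le> (1 + lam) * (\<Sum>i=1..t. coeff_x i * \<sigma>xG\<^sup>2) + (1 + lam) * (\<Sum>i=1..t. coeff_x i * \<sigma>xK\<^sup>2)
        + (1 + lam) * (\<Sum>i=1..t. coeff_y i * \<sigma>y\<^sup>2)"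
      unfolding square_term_def using no \<omega> by (intro add_mono) (auto simp: events_def)
    also have "\<dots> = (1 + lam) * ?Q"
      unfolding \<sigma>x2 by (simp only: distrib_left sum.distrib)
    finally have sq: "square_term t \<omega> \<le> (1 + lam) * ?Q" .
    \<comment> \<open>the sum of the two standard deviations costs the factor \<open>sqrt 2\<close>\<close>
    have "(\<sigma>xG + \<sigma>xK)\<^sup>2 \<le> (sqrt 2 * \<sigma>x)\<^sup>2"
      using sum_squares_bound[of \<sigma>xG \<sigma>xK] by (simp add: power_mult_distrib \<sigma>x2 power2_sum)
    then have \<sigma>sum: "\<sigma>xG + \<sigma>xK \<le> sqrt 2 * \<sigma>x"
      by (rule power2_le_imp_le) (simp add: \<sigma>(4))
    have "linear_term t \<omega> \<le> lam * (?RX * \<sigma>xG * ?S) + lam * (?RX * \<sigma>xK * ?S) + lam * (?RY * \<sigma>y * ?S)"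
      unfolding linear_term_def using no \<omega> by (intro add_mono) (auto simp: events_def)
    also have "\<dots> = lam * ?S * (?RX * (\<sigma>xG + \<sigma>xK) + ?RY * \<sigma>y)"
      by (simp add: algebra_simps add_divide_distrib)
    also have "\<dots> \<le> lam * ?S * (?RX * (sqrt 2 * \<sigma>x) + ?RY * \<sigma>y)"
      using lam X.\<Omega>_pos X.\<alpha>_pos \<sigma>sum by (intro mult_left_mono add_right_mono) (auto simp: sum_nonneg)
    also have "\<dots> = lam * ((sqrt 2 * \<sigma>x * \<Omega>X / sqrt \<alpha>X + \<sigma>y * \<Omega>Y / sqrt \<alpha>Y) * sqrt (2 * (\<Sum>i=1..t. (\<gamma> i)\<^sup>2)))"
      by (simp add: real_sqrt_mult algebra_simps)
    finally have lin: "linear_term t \<omega> \<le> \<dots>" .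
    have "diameter_term t + 1 / (2 * \<beta> t * \<gamma> t) * square_term t \<omega> + 1 / ?c * linear_term t \<omega>
      \<le> diameter_term t + 1 / (2 * \<beta> t * \<gamma> t) * ((1 + lam) * ?Q)
        + 1 / ?c * (lam * ((sqrt 2 * \<sigma>x * \<Omega>X / sqrt \<alpha>X + \<sigma>y * \<Omega>Y / sqrt \<alpha>Y) * sqrt (2 * (\<Sum>i=1..t. (\<gamma> i)\<^sup>2))))"
      using c by (intro add_mono mult_left_mono sq lin order.refl) (auto simp: mult.assoc)
    also have "\<dots> = bound_mean \<sigma>x \<sigma>y t + lam * bound_deviation \<sigma>x \<sigma>y t"
      unfolding bound_mean_def bound_deviation_def by (simp only: distrib_left distrib_right mult_1_left) (simp only: mult_ac add_ac)
    finally have "gap_at t \<omega> \<le> ereal (bound_mean \<sigma>x \<sigma>y t + lam * bound_deviation \<sigma>x \<sigma>y t)"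
      using gap_at_le[OF t \<omega>] by (meson ereal_less_eq(3) order.trans)
    moreover have "gap_at t \<omega> > ereal (bound_mean \<sigma>x \<sigma>y t + lam * bound_deviation \<sigma>x \<sigma>y t)"
      using * by simp
    ultimately show False using leD by blast
  qed
  then have "prob {\<omega> \<in> space M. gap_at t \<omega> > ereal (bound_mean \<sigma>x \<sigma>y t + lam * bound_deviation \<sigma>x \<sigma>y t)}
      \<le> prob (L1 \<union> L2 \<union> L3 \<union> (S1 \<union> S2 \<union> S3))"
    by (intro finite_measure_mono) measurable
  also have "\<dots> \<le> (prob L1 + prob L2 + prob L3) + (prob S1 + prob S2 + prob S3)"
    by (intro order.trans[OF measure_Un_le] add_mono order.refl sets.Un ev)
  also have "\<dots> \<le> (exp (- (lam\<^sup>2 / 3)) + exp (- (lam\<^sup>2 / 3)) + exp (- (lam\<^sup>2 / 3)))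
      + (exp (- lam) + exp (- lam) + exp (- lam))"
    unfolding events_def
    by (intro add_mono GC.prob_noise_linear[OF lt(1)] KyC.prob_noise_linear[OF lt(3)] KxC.prob_noise_linear[OF lt(2)]
        GC.prob_noise_square[OF lt(1)] KyC.prob_noise_square[OF lt(3)] KxC.prob_noise_square[OF lt(2)]
        \<sigma> lam t coeff_pos)
  finally show ?thesis by simp
qed

end

theorem theorem3p1:
  fixes nX :: "'a::euclidean_space \<Rightarrow> real" and nY :: "'b::euclidean_space \<Rightarrow> real"
    and X :: "'a set" and Y :: "'b set"
    and G :: "'a \<Rightarrow> real" and gradG :: "'a \<Rightarrow> 'a" and L_G :: real
    and K :: "'a \<Rightarrow> 'b" and L_K :: real
    and J :: "'b \<Rightarrow> real"
    and dX :: "'a \<Rightarrow> real" and graddX :: "'a \<Rightarrow> 'a" and \<alpha>X :: real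
    and dY :: "'b \<Rightarrow> real" and graddY :: "'b \<Rightarrow> 'b" and \<alpha>Y :: real
    and VX :: "'a \<Rightarrow> 'a \<Rightarrow> real" and VY :: "'b \<Rightarrow> 'b \<Rightarrow> real"
    and D :: "'s measure" and M :: "'w measure"
    and \<xi> :: "oracle_call \<Rightarrow> nat \<Rightarrow> 'w \<Rightarrow> 's"
    and OG :: "'a \<Rightarrow> 's \<Rightarrow> 'a" and OKx :: "'a \<Rightarrow> 's \<Rightarrow> 'b" and OKy :: "'b \<Rightarrow> 's \<Rightarrow> 'a"
    and \<sigma>xG \<sigma>y \<sigma>xK \<sigma>x :: real
    and \<beta> \<theta> \<eta> \<tau> \<gamma> :: "nat \<Rightarrow> real"
    and p q \<Omega>X \<Omega>Y :: real
    and x1 :: 'a and y1 :: 'b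
    and x xmd xag xbar :: "nat \<Rightarrow> 'w \<Rightarrow> 'a" and y yag :: "nat \<Rightarrow> 'w \<Rightarrow> 'b"
    and Q0 Q1 :: "nat \<Rightarrow> real"
  assumes norms: "is_norm nX" "is_norm nY"
    and X: "closed X" "convex X" and Y: "closed Y" "convex Y"
    and G: "convex_on X G" "gradient_on X G gradG" "L_G \<ge> 0"
      "\<And>u v. u \<in> X \<Longrightarrow> v \<in> X \<Longrightarrow> G v - G u - gradG u \<bullet> (v - u) \<le> L_G / 2 * (nX (v - u))\<^sup>2"
    and K: "linear K" "L_K = induced_norm nX nY K"
    and J: "convex_on Y J" "lsc_on Y J"
    and dX: "\<alpha>X > 0" "strongly_convex_on X nX \<alpha>X dX" "gradient_on X dX graddX"
    and dY: "\<alpha>Y > 0" "strongly_convex_on Y nY \<alpha>Y dY" "gradient_on Y dY graddY"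
    and VX: "VX = bregman dX graddX" and VY: "VY = bregman dY graddY"
    \<comment> \<open>the stochastic oracle\<close>
    and M: "prob_space M"
    and samples: "prob_space.indep_vars M (\<lambda>_. D) (\<lambda>(c, t). \<xi> c t) (UNIV \<times> {1..})"
      "\<And>c t. t \<ge> 1 \<Longrightarrow> distr M D (\<xi> c t) = D"
    and oracles: "unbiased_oracle D X OG gradG"
      "unbiased_oracle D (extrapolated X \<theta>) OKx K"
      "unbiased_oracle D Y OKy (adjoint K)"
    and \<sigma>: "\<sigma>xG \<ge> 0" "\<sigma>y \<ge> 0" "\<sigma>xK \<ge> 0" "\<sigma>x = sqrt (\<sigma>xG\<^sup>2 + \<sigma>xK\<^sup>2)"
    \<comment> \<open>the algorithm\<close>
    and init: "x1 \<in> X" "y1 \<in> Y"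
    and steps_pos: "\<And>t. t \<ge> 1 \<Longrightarrow> \<eta> t > 0" "\<And>t. t \<ge> 1 \<Longrightarrow> \<tau> t > 0"
    and run: "\<And>\<omega>. \<omega> \<in> space M \<Longrightarrow>
      APD_run X Y J VX VY \<beta> \<theta> \<eta> \<tau>
        (\<lambda>t u. OG u (\<xi> CallG t \<omega>)) (\<lambda>t u. OKx u (\<xi> CallKx t \<omega>)) (\<lambda>t v. OKy v (\<xi> CallKy t \<omega>))
        x1 y1 (\<lambda>t. x t \<omega>) (\<lambda>t. y t \<omega>) (\<lambda>t. xmd t \<omega>) (\<lambda>t. xag t \<omega>) (\<lambda>t. yag t \<omega>) (\<lambda>t. xbar t \<omega>)"
    \<comment> \<open>the hypotheses of the theorem\<close>
    and \<Omega>: "\<Omega>X > 0" "\<Omega>Y > 0"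
      "\<And>u v. u \<in> X \<Longrightarrow> v \<in> X \<Longrightarrow> VX u v \<le> \<Omega>X\<^sup>2"
      "\<And>u v. u \<in> Y \<Longrightarrow> v \<in> Y \<Longrightarrow> VY u v \<le> \<Omega>Y\<^sup>2"
    and pq: "0 < p" "p < 1" "0 < q" "q < 1"
    and \<beta>: "\<beta> 1 = 1" "\<And>t. t \<ge> 1 \<Longrightarrow> \<beta> (t + 1) - 1 = \<beta> t * \<theta> (t + 1)"
    and \<theta>: "\<And>t. t \<ge> 2 \<Longrightarrow> 0 < \<theta> t \<and> \<theta> t \<le> min (\<eta> (t - 1) / \<eta> t) (\<tau> (t - 1) / \<tau> t)"
    and steps: "\<And>t. t \<ge> 1 \<Longrightarrow> q * \<alpha>X / \<eta> t - L_G / \<beta> t - L_K\<^sup>2 * \<tau> t / (p * \<alpha>Y) \<ge> 0"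
    and \<gamma>: "\<gamma> 1 = 1" "\<And>t. t \<ge> 2 \<Longrightarrow> \<gamma> t = inverse (\<theta> t) * \<gamma> (t - 1)"
    and Q0: "\<And>t. Q0 t =
      1 / (\<beta> t * \<gamma> t) * (2 * \<gamma> t / \<eta> t * \<Omega>X\<^sup>2 + 2 * \<gamma> t / \<tau> t * \<Omega>Y\<^sup>2)
      + 1 / (2 * \<beta> t * \<gamma> t) * (\<Sum>i=1..t.
          (2 - q) * \<eta> i * \<gamma> i / ((1 - q) * \<alpha>X) * \<sigma>x\<^sup>2 + (2 - p) * \<tau> i * \<gamma> i / ((1 - p) * \<alpha>Y) * \<sigma>y\<^sup>2)"
    and Q1: "\<And>t. Q1 t =
      1 / (\<beta> t * \<gamma> t) * (sqrt 2 * \<sigma>x * \<Omega>X / sqrt \<alpha>X + \<sigma>y * \<Omega>Y / sqrt \<alpha>Y) * sqrt (2 * (\<Sum>i=1..t. (\<gamma> i)\<^sup>2))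
      + 1 / (2 * \<beta> t * \<gamma> t) * (\<Sum>i=1..t.
          (2 - q) * \<eta> i * \<gamma> i / ((1 - q) * \<alpha>X) * \<sigma>x\<^sup>2 + (2 - p) * \<tau> i * \<gamma> i / ((1 - p) * \<alpha>Y) * \<sigma>y\<^sup>2)"
  shows
    \<comment> \<open>the gap of the iterates is a nonnegative random variable, so (a) and (b) are meaningful\<close>
    "(\<forall>t\<ge>1. (\<lambda>\<omega>. gap X Y G K J (xag (t + 1) \<omega>, yag (t + 1) \<omega>)) \<in> borel_measurable M \<and>
        (\<forall>\<omega>\<in>space M. gap X Y G K J (xag (t + 1) \<omega>, yag (t + 1) \<omega>) \<ge> 0)) \<and>
     (bounded_variance D nX X OG gradG \<sigma>xG \<and>
      bounded_variance D nY (extrapolated X \<theta>) OKx K \<sigma>y \<and>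
      bounded_variance D nX Y OKy (adjoint K) \<sigma>xK \<longrightarrow>
        (\<forall>t\<ge>1. (\<integral>\<^sup>+ \<omega>. e2ennreal (gap X Y G K J (xag (t + 1) \<omega>, yag (t + 1) \<omega>)) \<partial>M)
           \<le> ennreal (Q0 t))) \<and>
     (light_tail D nX X OG gradG \<sigma>xG \<and>
      light_tail D nY (extrapolated X \<theta>) OKx K \<sigma>y \<and>
      light_tail D nX Y OKy (adjoint K) \<sigma>xK \<longrightarrow>
        (\<forall>lam>0. \<forall>t\<ge>1.
           measure M {\<omega> \<in> space M.
               gap X Y G K J (xag (t + 1) \<omega>, yag (t + 1) \<omega>) > ereal (Q0 t + lam * Q1 t)}
             \<le> 3 * exp (- (lam\<^sup>2 / 3)) + 3 * exp (- lam)))"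
proof -
  have "X \<noteq> {}" "Y \<noteq> {}" using init by auto
  \<comment> \<open>the Bregman distances only see the components of the gradients along \<open>X - X\<close> and \<open>Y - Y\<close>\<close>
  obtain gX where gX: "gX \<in> borel_measurable borel" "gradient_on X dX gX"
      "\<And>x u. x \<in> X \<Longrightarrow> u \<in> X \<Longrightarrow> gX u \<bullet> (x - u) = graddX u \<bullet> (x - u)"
    using gradient_on_borel_representative[OF dX(3) X(2,1) \<open>X \<noteq> {}\<close>] by blast
  obtain gY where gY: "gY \<in> borel_measurable borel" "gradient_on Y dY gY"
      "\<And>x u. x \<in> Y \<Longrightarrow> u \<in> Y \<Longrightarrow> gY u \<bullet> (x - u) = graddY u \<bullet> (x - u)"
    using gradient_on_borel_representative[OF dY(3) Y(2,1) \<open>Y \<noteq> {}\<close>] by blast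
  interpret M: prob_space M by (rule M)
  interpret X: mirror_setup nX X dX gX \<alpha>X VX \<Omega>X
    by unfold_locales (use norms X dX gX \<Omega> \<open>X \<noteq> {}\<close> in \<open>auto simp: VX bregman_def\<close>)
  interpret Y: mirror_setup nY Y dY gY \<alpha>Y VY \<Omega>Y
    by unfold_locales (use norms Y dY gY \<Omega> \<open>Y \<noteq> {}\<close> in \<open>auto simp: VY bregman_def\<close>)
  interpret saddle_problem nX X dX gX \<alpha>X VX \<Omega>X nY Y dY gY \<alpha>Y VY \<Omega>Y
    G gradG L_G K L_K J \<beta> \<theta> \<eta> \<tau> \<gamma> p q x1 y1
  proof (intro saddle_problem.intro saddle_problem_axioms.intro X.mirror_setup_axioms Y.mirror_setup_axioms)
    show "K u \<bullet> v \<le> L_K * nX u * nY v" for u v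
      unfolding K(2) by (rule inner_le_induced_norm[OF norms K(1)])
  qed (fact G K(1) J steps_pos pq \<beta> \<theta> steps \<gamma> init)+
  interpret stochastic_apd nX X dX gX \<alpha>X VX \<Omega>X nY Y dY gY \<alpha>Y VY \<Omega>Y
    G gradG L_G K L_K J \<beta> \<theta> \<eta> \<tau> \<gamma> p q x1 y1 M D \<xi> OG OKx OKy x xmd xag xbar y yag
    by unfold_locales (fact samples oracles run)+
  have Q0_eq: "Q0 t = bound_mean \<sigma>x \<sigma>y t" for t
    unfolding Q0 bound_mean_def diameter_term_def coeff_x_def coeff_y_def ..
  have Q1_eq: "Q1 t = bound_deviation \<sigma>x \<sigma>y t" for t
    unfolding Q1 bound_deviation_def coeff_x_def coeff_y_def ..
  have \<sigma>x2: "\<sigma>x\<^sup>2 = \<sigma>xG\<^sup>2 + \<sigma>xK\<^sup>2" using \<sigma>(4) by simp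
  show ?thesis
    unfolding Q0_eq Q1_eq gap_at_def[symmetric]
    using gap_at_measurable[unfolded gap_at_def[abs_def]] gap_at_nonneg
      expected_gap_le[OF _ _ _ \<sigma>x2] prob_gap_gt[OF _ _ _ \<sigma>]
    by (auto simp: gap_at_def[abs_def])
qed

end
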